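(* Let $Q$ and $K$ be finite groups. Then $$\mathrm{Hom}(Q,\underline{\mathrm{Aut}}^{\otimes}_{\,0}(\mathrm{Vec}_K))\simeq\mathrm{Hom}(K,\underline{\mathrm{Aut}}^{\otimes}_{\,0}(\mathrm{Vec}_Q)),$$ so that actions of $Q$ on $\mathrm{Vec}_K$ by tensor autoequivalences that fix isomorphism classes of objects are in bijection with actions of $K$ on $\mathrm{Vec}_Q$ by tensor autoequivalences that fix isomorphism classes of objects. More explicitly, either action consists of the same data of functions $$\omega:Q\times K\times K\to\mathbb{C}^\times,\qquad \eta:K\times Q\times Q\to\mathbb{C}^\times$$ subject to the conditions $\partial_q\omega=\partial_k\eta$, $\partial_k\omega=0$, $\partial_q\eta=0$.
   Context: $\mathrm{Vec}_K$ is the fusion category of finite dimensional $K$-graded complex vector spaces with convolution product and trivial associator. $\underline{\mathrm{Aut}}^\otimes(\mathrm{Vec}_K)$ is the 2-group of tensor autoequivalences of $\mathrm{Vec}_K$ and monoidal natural isomorphisms, and $\underline{\mathrm{Aut}}^\otimes_{\,0}(\mathrm{Vec}_K)$ is its full sub-2-group of autoequivalences that preserve the isomorphism classes of objects. $\mathrm{Hom}(Q,-)$ denotes homomorphisms of 2-groups (monoidal functors from $Q$ regarded as a discrete monoidal category), considered up to equivalence, i.e. monoidal natural isomorphism. $\partial_q$ and $\partial_k$ are the group cohomology differentials (with trivial coefficients $\mathbb{C}^\times$) in the $Q$-variables and in the $K$-variables respectively, the other variables being treated as parameters. *)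

theory Defs
  imports "Jordan_Normal_Form.Matrix" "HOL-Algebra.Group" "HOL-Library.FuncSet"
begin

section \<open>Monoidal categories, monoidal functors, monoidal natural transformations\<close>

text \<open>
  A category is given by a set of objects and a set of arrows that know their domain and codomain;
  \<open>Cmp C g f\<close> is ``\<open>g\<close> after \<open>f\<close>''. All maps out of \<open>Ob C\<close> and \<open>Ar C\<close> that
  occur as parts of functors and transformations are taken to be extensional, so that HOL equality
  of these data is equality of functors and transformations.
\<close>

record ('o, 'm) mcat =
  Ob :: "'o set"
  Ar :: "'m set"
  Dm :: "'m \<Rightarrow> 'o"
  Cd :: "'m \<Rightarrow> 'o"
  Idn :: "'o \<Rightarrow> 'm"
  Cmp :: "'m \<Rightarrow> 'm \<Rightarrow> 'm"
  TensO :: "'o \<Rightarrow> 'o \<Rightarrow> 'o"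
  TensA :: "'m \<Rightarrow> 'm \<Rightarrow> 'm"
  Unt :: "'o"
  Assc :: "'o \<Rightarrow> 'o \<Rightarrow> 'o \<Rightarrow> 'm"  \<comment> \<open>\<open>(X \<otimes> Y) \<otimes> Z \<rightarrow> X \<otimes> (Y \<otimes> Z)\<close>\<close>
  LUnt :: "'o \<Rightarrow> 'm"  \<comment> \<open>\<open>1 \<otimes> X \<rightarrow> X\<close>\<close>
  RUnt :: "'o \<Rightarrow> 'm"  \<comment> \<open>\<open>X \<otimes> 1 \<rightarrow> X\<close>\<close>

record ('o, 'm) lin_mcat = "('o, 'm) mcat" +
  AddA :: "'m \<Rightarrow> 'm \<Rightarrow> 'm"
  SclA :: "complex \<Rightarrow> 'm \<Rightarrow> 'm"

definition arrows :: "('o, 'm, 'x) mcat_scheme \<Rightarrow> 'o \<Rightarrow> 'o \<Rightarrow> 'm set" where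
  "arrows C X Y = {f \<in> Ar C. Dm C f = X \<and> Cd C f = Y}"

definition iso_arrow :: "('o, 'm, 'x) mcat_scheme \<Rightarrow> 'm \<Rightarrow> bool" where
  "iso_arrow C f \<longleftrightarrow> f \<in> Ar C \<and>
     (\<exists>g \<in> arrows C (Cd C f) (Dm C f).
        Cmp C g f = Idn C (Dm C f) \<and> Cmp C f g = Idn C (Cd C f))"

definition isomorphic :: "('o, 'm, 'x) mcat_scheme \<Rightarrow> 'o \<Rightarrow> 'o \<Rightarrow> bool" where
  "isomorphic C X Y \<longleftrightarrow> (\<exists>f \<in> arrows C X Y. iso_arrow C f)"

definition is_functor ::
  "('o, 'm, 'x) mcat_scheme \<Rightarrow> ('p, 'n, 'y) mcat_scheme \<Rightarrow> ('o \<Rightarrow> 'p) \<Rightarrow> ('m \<Rightarrow> 'n) \<Rightarrow> bool" where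
  "is_functor C D FO FA \<longleftrightarrow>
     FO \<in> Ob C \<rightarrow>\<^sub>E Ob D \<and> FA \<in> Ar C \<rightarrow>\<^sub>E Ar D \<and>
     (\<forall>f \<in> Ar C. Dm D (FA f) = FO (Dm C f) \<and> Cd D (FA f) = FO (Cd C f)) \<and>
     (\<forall>X \<in> Ob C. FA (Idn C X) = Idn D (FO X)) \<and>
     (\<forall>f \<in> Ar C. \<forall>g \<in> Ar C. Dm C g = Cd C f \<longrightarrow> FA (Cmp C g f) = Cmp D (FA g) (FA f))"

definition nat_iso ::
  "('o, 'm, 'x) mcat_scheme \<Rightarrow> ('p, 'n, 'y) mcat_scheme \<Rightarrow> ('o \<Rightarrow> 'p) \<Rightarrow> ('m \<Rightarrow> 'n) \<Rightarrow>
   ('o \<Rightarrow> 'p) \<Rightarrow> ('m \<Rightarrow> 'n) \<Rightarrow> ('o \<Rightarrow> 'n) \<Rightarrow> bool" where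
  "nat_iso C D FO FA GO GA \<alpha> \<longleftrightarrow>
     \<alpha> \<in> Ob C \<rightarrow>\<^sub>E Ar D \<and>
     (\<forall>X \<in> Ob C. \<alpha> X \<in> arrows D (FO X) (GO X) \<and> iso_arrow D (\<alpha> X)) \<and>
     (\<forall>f \<in> Ar C. Cmp D (\<alpha> (Cd C f)) (FA f) = Cmp D (GA f) (\<alpha> (Dm C f)))"

definition is_equivalence ::
  "('o, 'm, 'x) mcat_scheme \<Rightarrow> ('p, 'n, 'y) mcat_scheme \<Rightarrow> ('o \<Rightarrow> 'p) \<Rightarrow> ('m \<Rightarrow> 'n) \<Rightarrow> bool" where
  "is_equivalence C D FO FA \<longleftrightarrow> is_functor C D FO FA \<and>
     (\<exists>GO GA \<alpha> \<beta>. is_functor D C GO GA \<and>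
        nat_iso C C (\<lambda>X. GO (FO X)) (\<lambda>f. GA (FA f)) (\<lambda>X. X) (\<lambda>f. f) \<alpha> \<and>
        nat_iso D D (\<lambda>Y. FO (GO Y)) (\<lambda>g. FA (GA g)) (\<lambda>Y. Y) (\<lambda>g. g) \<beta>)"

record ('o, 'm, 'p, 'n) mfun =
  FOb :: "'o \<Rightarrow> 'p"
  FAr :: "'m \<Rightarrow> 'n"
  FTens :: "'o \<times> 'o \<Rightarrow> 'n"  \<comment> \<open>\<open>F X \<otimes> F Y \<rightarrow> F (X \<otimes> Y)\<close>\<close>
  FUnt :: "'n"  \<comment> \<open>\<open>1 \<rightarrow> F 1\<close>\<close>

definition monoidal_functors ::
  "('o, 'm, 'x) mcat_scheme \<Rightarrow> ('p, 'n, 'y) mcat_scheme \<Rightarrow> ('o, 'm, 'p, 'n) mfun set" where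
  "monoidal_functors C D = {F.
     is_functor C D (FOb F) (FAr F) \<and>
     FTens F \<in> Ob C \<times> Ob C \<rightarrow>\<^sub>E Ar D \<and>
     (\<forall>X \<in> Ob C. \<forall>Y \<in> Ob C.
        FTens F (X, Y) \<in> arrows D (TensO D (FOb F X) (FOb F Y)) (FOb F (TensO C X Y)) \<and>
        iso_arrow D (FTens F (X, Y))) \<and>
     (\<forall>f \<in> Ar C. \<forall>g \<in> Ar C.
        Cmp D (FAr F (TensA C f g)) (FTens F (Dm C f, Dm C g)) =
        Cmp D (FTens F (Cd C f, Cd C g)) (TensA D (FAr F f) (FAr F g))) \<and>
     FUnt F \<in> arrows D (Unt D) (FOb F (Unt C)) \<and> iso_arrow D (FUnt F) \<and>
     (\<forall>X \<in> Ob C. \<forall>Y \<in> Ob C. \<forall>Z \<in> Ob C.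
        Cmp D (FAr F (Assc C X Y Z))
          (Cmp D (FTens F (TensO C X Y, Z)) (TensA D (FTens F (X, Y)) (Idn D (FOb F Z)))) =
        Cmp D (FTens F (X, TensO C Y Z))
          (Cmp D (TensA D (Idn D (FOb F X)) (FTens F (Y, Z)))
             (Assc D (FOb F X) (FOb F Y) (FOb F Z)))) \<and>
     (\<forall>X \<in> Ob C.
        Cmp D (FAr F (LUnt C X))
          (Cmp D (FTens F (Unt C, X)) (TensA D (FUnt F) (Idn D (FOb F X)))) = LUnt D (FOb F X)) \<and>
     (\<forall>X \<in> Ob C.
        Cmp D (FAr F (RUnt C X))
          (Cmp D (FTens F (X, Unt C)) (TensA D (Idn D (FOb F X)) (FUnt F))) = RUnt D (FOb F X))}"

definition monoidal_nat_iso ::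
  "('o, 'm, 'x) mcat_scheme \<Rightarrow> ('p, 'n, 'y) mcat_scheme \<Rightarrow>
   ('o, 'm, 'p, 'n) mfun \<Rightarrow> ('o, 'm, 'p, 'n) mfun \<Rightarrow> ('o \<Rightarrow> 'n) \<Rightarrow> bool" where
  "monoidal_nat_iso C D F G \<alpha> \<longleftrightarrow>
     nat_iso C D (FOb F) (FAr F) (FOb G) (FAr G) \<alpha> \<and>
     (\<forall>X \<in> Ob C. \<forall>Y \<in> Ob C.
        Cmp D (\<alpha> (TensO C X Y)) (FTens F (X, Y)) =
        Cmp D (FTens G (X, Y)) (TensA D (\<alpha> X) (\<alpha> Y))) \<and>
     Cmp D (\<alpha> (Unt C)) (FUnt F) = FUnt G"

definition mfun_equiv ::
  "('o, 'm, 'x) mcat_scheme \<Rightarrow> ('p, 'n, 'y) mcat_scheme \<Rightarrow>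
   (('o, 'm, 'p, 'n) mfun \<times> ('o, 'm, 'p, 'n) mfun) set" where
  "mfun_equiv C D = {(F, G). F \<in> monoidal_functors C D \<and> G \<in> monoidal_functors C D \<and>
     (\<exists>\<alpha>. monoidal_nat_iso C D F G \<alpha>)}"

definition linear_on_arrows :: "('o, 'm, 'x) lin_mcat_scheme \<Rightarrow> ('m \<Rightarrow> 'm) \<Rightarrow> bool" where
  "linear_on_arrows C FA \<longleftrightarrow>
     (\<forall>f \<in> Ar C. \<forall>c. FA (SclA C c f) = SclA C c (FA f)) \<and>
     (\<forall>f \<in> Ar C. \<forall>g \<in> Ar C. Dm C f = Dm C g \<and> Cd C f = Cd C g \<longrightarrow>
        FA (AddA C f g) = AddA C (FA f) (FA g))"


section \<open>The 2-group of tensor autoequivalences\<close>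

definition mfun_comp ::
  "('o, 'm, 'x) mcat_scheme \<Rightarrow> ('o, 'm, 'o, 'm) mfun \<Rightarrow> ('o, 'm, 'o, 'm) mfun \<Rightarrow>
   ('o, 'm, 'o, 'm) mfun" where
  "mfun_comp C F G = \<lparr>
     FOb = (\<lambda>X \<in> Ob C. FOb F (FOb G X)),
     FAr = (\<lambda>f \<in> Ar C. FAr F (FAr G f)),
     FTens = (\<lambda>(X, Y) \<in> Ob C \<times> Ob C.
       Cmp C (FAr F (FTens G (X, Y))) (FTens F (FOb G X, FOb G Y))),
     FUnt = Cmp C (FAr F (FUnt G)) (FUnt F) \<rparr>"

definition mfun_id :: "('o, 'm, 'x) mcat_scheme \<Rightarrow> ('o, 'm, 'o, 'm) mfun" where
  "mfun_id C = \<lparr>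
     FOb = (\<lambda>X \<in> Ob C. X),
     FAr = (\<lambda>f \<in> Ar C. f),
     FTens = (\<lambda>(X, Y) \<in> Ob C \<times> Ob C. Idn C (TensO C X Y)),
     FUnt = Idn C (Unt C) \<rparr>"

definition tensor_autoequivalences ::
  "('o, 'm, 'x) lin_mcat_scheme \<Rightarrow> ('o, 'm, 'o, 'm) mfun set" where
  "tensor_autoequivalences C = {F \<in> monoidal_functors C C.
     linear_on_arrows C (FAr F) \<and> is_equivalence C C (FOb F) (FAr F)}"

type_synonym ('o, 'm) mtrans =
  "('o, 'm, 'o, 'm) mfun \<times> ('o \<Rightarrow> 'm) \<times> ('o, 'm, 'o, 'm) mfun"

text \<open>
  An arrow \<open>(F, \<alpha>, G)\<close> is the transformation \<open>\<alpha> : F \<rightarrow> G\<close>; the tensor product is composition of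
  functors and horizontal composition of transformations. Composition of (extensional) monoidal
  functors is strictly associative and unital, so the structural isomorphisms are identities.
\<close>

definition Aut_tens ::
  "('o, 'm, 'x) lin_mcat_scheme \<Rightarrow> (('o, 'm, 'o, 'm) mfun, ('o, 'm) mtrans) mcat" where
  "Aut_tens C = (let idt = (\<lambda>F. (F, (\<lambda>X \<in> Ob C. Idn C (FOb F X)), F)) in \<lparr>
     Ob = tensor_autoequivalences C,
     Ar = {(F, \<alpha>, G). F \<in> tensor_autoequivalences C \<and> G \<in> tensor_autoequivalences C \<and>
             monoidal_nat_iso C C F G \<alpha>},
     Dm = (\<lambda>(F, \<alpha>, G). F),
     Cd = (\<lambda>(F, \<alpha>, G). G),
     Idn = idt,
     Cmp = (\<lambda>(G, \<beta>, H) (F, \<alpha>, G'). (F, (\<lambda>X \<in> Ob C. Cmp C (\<beta> X) (\<alpha> X)), H)),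
     TensO = mfun_comp C,
     TensA = (\<lambda>(F, \<alpha>, F') (G, \<beta>, G').
       (mfun_comp C F G,
        (\<lambda>X \<in> Ob C. Cmp C (\<alpha> (FOb G' X)) (FAr F (\<beta> X))),
        mfun_comp C F' G')),
     Unt = mfun_id C,
     Assc = (\<lambda>F G H. idt (mfun_comp C (mfun_comp C F G) H)),
     LUnt = idt,
     RUnt = idt \<rparr>)"

definition full_sub :: "('o, 'm, 'x) mcat_scheme \<Rightarrow> 'o set \<Rightarrow> ('o, 'm, 'x) mcat_scheme" where
  "full_sub C S = C \<lparr> Ob := Ob C \<inter> S, Ar := {f \<in> Ar C. Dm C f \<in> S \<and> Cd C f \<in> S} \<rparr>"

definition Aut_tens0 ::
  "('o, 'm, 'x) lin_mcat_scheme \<Rightarrow> (('o, 'm, 'o, 'm) mfun, ('o, 'm) mtrans) mcat" where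
  "Aut_tens0 C = full_sub (Aut_tens C) {F. \<forall>X \<in> Ob C. isomorphic C (FOb F X) X}"


section \<open>Homomorphisms from a group to a 2-group\<close>

definition disc :: "('g, 'b) monoid_scheme \<Rightarrow> ('g, 'g) mcat" where
  "disc G = \<lparr>
     Ob = carrier G, Ar = carrier G, Dm = (\<lambda>x. x), Cd = (\<lambda>x. x), Idn = (\<lambda>x. x),
     Cmp = (\<lambda>g f. f),
     TensO = (\<lambda>x y. x \<otimes>\<^bsub>G\<^esub> y), TensA = (\<lambda>x y. x \<otimes>\<^bsub>G\<^esub> y),
     Unt = \<one>\<^bsub>G\<^esub>,
     Assc = (\<lambda>x y z. x \<otimes>\<^bsub>G\<^esub> y \<otimes>\<^bsub>G\<^esub> z), LUnt = (\<lambda>x. x), RUnt = (\<lambda>x. x) \<rparr>"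

definition Hom_2grp ::
  "('g, 'b) monoid_scheme \<Rightarrow> ('p, 'n, 'y) mcat_scheme \<Rightarrow> ('g, 'g, 'p, 'n) mfun set set" where
  "Hom_2grp G A = monoidal_functors (disc G) A // mfun_equiv (disc G) A"

definition hom_class ::
  "('g, 'b) monoid_scheme \<Rightarrow> ('p, 'n, 'y) mcat_scheme \<Rightarrow> ('g, 'g, 'p, 'n) mfun \<Rightarrow>
   ('g, 'g, 'p, 'n) mfun set" where
  "hom_class G A F = mfun_equiv (disc G) A `` {F}"


section \<open>Graded vector spaces\<close>

text \<open>
  The underlying vector spaces are the \<open>\<complex>\<^sup>n\<close>, with linear maps given by matrices. A \<open>K\<close>-grading
  \<open>\<complex>\<^sup>n = \<Oplus>\<^sub>g V\<^sub>g\<close> is an arbitrary direct sum decomposition, recorded by its family of projections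
  \<open>P\<^sub>g\<close> onto the \<open>V\<^sub>g\<close> (so \<open>V\<^sub>g\<close> is the range of \<open>P\<^sub>g\<close>). With the Kronecker product in lexicographic
  order the tensor product is strictly associative and unital, so that the trivial associator is
  literally the identity.
\<close>

type_synonym 'k gvs = "nat \<times> ('k \<Rightarrow> complex mat)"
type_synonym 'k gmap = "'k gvs \<times> complex mat \<times> 'k gvs"

definition mat_sum :: "nat \<Rightarrow> nat \<Rightarrow> ('i \<Rightarrow> complex mat) \<Rightarrow> 'i set \<Rightarrow> complex mat" where
  "mat_sum nr nc A I = mat nr nc (\<lambda>(i, j). \<Sum>x\<in>I. A x $$ (i, j))"

definition kron :: "complex mat \<Rightarrow> complex mat \<Rightarrow> complex mat" where
  "kron A B = mat (dim_row A * dim_row B) (dim_col A * dim_col B)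
     (\<lambda>(i, j). A $$ (i div dim_row B, j div dim_col B) * B $$ (i mod dim_row B, j mod dim_col B))"

definition gvs_objects :: "('k, 'b) monoid_scheme \<Rightarrow> 'k gvs set" where
  "gvs_objects K = {(n, P).
     P \<in> carrier K \<rightarrow>\<^sub>E carrier_mat n n \<and>
     (\<forall>g \<in> carrier K. \<forall>h \<in> carrier K. P g * P h = (if g = h then P g else 0\<^sub>m n n)) \<and>
     mat_sum n n P (carrier K) = 1\<^sub>m n}"

text \<open>A matrix is a graded map iff it commutes with the projections, i.e. maps \<open>V\<^sub>g\<close> into \<open>W\<^sub>g\<close>.\<close>

definition gvs_arrows :: "('k, 'b) monoid_scheme \<Rightarrow> 'k gmap set" where
  "gvs_arrows K = {(V, M, W). V \<in> gvs_objects K \<and> W \<in> gvs_objects K \<and>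
     M \<in> carrier_mat (fst W) (fst V) \<and> (\<forall>g \<in> carrier K. M * snd V g = snd W g * M)}"

text \<open>The convolution product: \<open>(V \<otimes> W)\<^sub>k\<close> is the sum of the \<open>V\<^sub>g \<otimes> W\<^sub>h\<close> with \<open>g h = k\<close>.\<close>

definition gvs_tensor :: "('k, 'b) monoid_scheme \<Rightarrow> 'k gvs \<Rightarrow> 'k gvs \<Rightarrow> 'k gvs" where
  "gvs_tensor K V W = (fst V * fst W,
     (\<lambda>k \<in> carrier K. mat_sum (fst V * fst W) (fst V * fst W)
        (\<lambda>(g, h). kron (snd V g) (snd W h))
        {(g, h). g \<in> carrier K \<and> h \<in> carrier K \<and> g \<otimes>\<^bsub>K\<^esub> h = k}))"

definition gvs_unit :: "('k, 'b) monoid_scheme \<Rightarrow> 'k gvs" where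
  "gvs_unit K = (1, (\<lambda>k \<in> carrier K. if k = \<one>\<^bsub>K\<^esub> then 1\<^sub>m 1 else 0\<^sub>m 1 1))"

definition gvs_id :: "'k gvs \<Rightarrow> 'k gmap" where
  "gvs_id V = (V, 1\<^sub>m (fst V), V)"

definition Vec :: "('k, 'b) monoid_scheme \<Rightarrow> ('k gvs, 'k gmap) lin_mcat" where
  "Vec K = \<lparr>
     Ob = gvs_objects K,
     Ar = gvs_arrows K,
     Dm = (\<lambda>(V, M, W). V),
     Cd = (\<lambda>(V, M, W). W),
     Idn = gvs_id,
     Cmp = (\<lambda>(V', N, W) (U, M, V). (U, N * M, W)),
     TensO = gvs_tensor K,
     TensA = (\<lambda>(V, M, W) (V', M', W'). (gvs_tensor K V V', kron M M', gvs_tensor K W W')),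
     Unt = gvs_unit K,
     Assc = (\<lambda>U V W. gvs_id (gvs_tensor K (gvs_tensor K U V) W)),
     LUnt = gvs_id,
     RUnt = gvs_id,
     AddA = (\<lambda>(V, M, W) (V', M', W'). (V, M + M', W)),
     SclA = (\<lambda>c (V, M, W). (V, c \<cdot>\<^sub>m M, W)) \<rparr>"


section \<open>Actions given by cochains\<close>

text \<open>Group cohomology differentials on 1- and 2-cochains with values in \<open>\<complex>\<^sup>\<times>\<close>, trivial action,
  written multiplicatively.\<close>

definition cobd1 :: "('g, 'b) monoid_scheme \<Rightarrow> ('g \<Rightarrow> complex) \<Rightarrow> 'g \<Rightarrow> 'g \<Rightarrow> complex" where
  "cobd1 G f x y = f y * inverse (f (x \<otimes>\<^bsub>G\<^esub> y)) * f x"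

definition cobd2 ::
  "('g, 'b) monoid_scheme \<Rightarrow> ('g \<Rightarrow> 'g \<Rightarrow> complex) \<Rightarrow> 'g \<Rightarrow> 'g \<Rightarrow> 'g \<Rightarrow> complex" where
  "cobd2 G f x y z =
     f y z * inverse (f (x \<otimes>\<^bsub>G\<^esub> y) z) * f x (y \<otimes>\<^bsub>G\<^esub> z) * inverse (f x y)"

definition nonvanishing ::
  "('g, 'b) monoid_scheme \<Rightarrow> ('h, 'c) monoid_scheme \<Rightarrow> ('g \<Rightarrow> 'h \<Rightarrow> 'h \<Rightarrow> complex) \<Rightarrow> bool" where
  "nonvanishing G H \<omega> \<longleftrightarrow>
     (\<forall>g \<in> carrier G. \<forall>x \<in> carrier H. \<forall>y \<in> carrier H. \<omega> g x y \<noteq> 0)"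

definition cocycle_conditions ::
  "('q, 'a) monoid_scheme \<Rightarrow> ('k, 'b) monoid_scheme \<Rightarrow>
   ('q \<Rightarrow> 'k \<Rightarrow> 'k \<Rightarrow> complex) \<Rightarrow> ('k \<Rightarrow> 'q \<Rightarrow> 'q \<Rightarrow> complex) \<Rightarrow> bool" where
  "cocycle_conditions Q K \<omega> \<eta> \<longleftrightarrow>
     (\<forall>q \<in> carrier Q. \<forall>r \<in> carrier Q. \<forall>k \<in> carrier K. \<forall>l \<in> carrier K.
        cobd1 Q (\<lambda>q. \<omega> q k l) q r = cobd1 K (\<lambda>k. \<eta> k q r) k l) \<and>
     (\<forall>q \<in> carrier Q. \<forall>k \<in> carrier K. \<forall>l \<in> carrier K. \<forall>m \<in> carrier K.
        cobd2 K (\<omega> q) k l m = 1) \<and>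
     (\<forall>k \<in> carrier K. \<forall>q \<in> carrier Q. \<forall>r \<in> carrier Q. \<forall>s \<in> carrier Q.
        cobd2 Q (\<eta> k) q r s = 1)"

text \<open>The endomorphism of \<open>V\<close> that is the scalar \<open>c g\<close> on \<open>V\<^sub>g\<close>.\<close>

definition scalar1 :: "('k, 'b) monoid_scheme \<Rightarrow> ('k \<Rightarrow> complex) \<Rightarrow> 'k gvs \<Rightarrow> 'k gmap" where
  "scalar1 K c V = (V, mat_sum (fst V) (fst V) (\<lambda>g. c g \<cdot>\<^sub>m snd V g) (carrier K), V)"

text \<open>The endomorphism of \<open>V \<otimes> W\<close> that is the scalar \<open>c g h\<close> on \<open>V\<^sub>g \<otimes> W\<^sub>h\<close>.\<close>

definition scalar2 ::
  "('k, 'b) monoid_scheme \<Rightarrow> ('k \<Rightarrow> 'k \<Rightarrow> complex) \<Rightarrow> 'k gvs \<Rightarrow> 'k gvs \<Rightarrow> 'k gmap" where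
  "scalar2 K c V W = (gvs_tensor K V W,
     mat_sum (fst V * fst W) (fst V * fst W)
       (\<lambda>(g, h). c g h \<cdot>\<^sub>m kron (snd V g) (snd W h)) (carrier K \<times> carrier K),
     gvs_tensor K V W)"

text \<open>
  The identity functor of \<open>Vec K\<close> with tensor structure \<open>c\<close>, and the action of \<open>Q\<close> on \<open>Vec K\<close> by
  the functors \<open>F\<^sub>q\<close> with tensor structure \<open>\<omega> q\<close> and with composition isomorphisms
  \<open>F\<^sub>q F\<^sub>r \<rightarrow> F\<^bsub>q r\<^esub>\<close> acting on degree \<open>k\<close> by \<open>\<eta> k q r\<close>. The cochains are not assumed normalized;
  the unit isomorphisms below are the ones forced by the unit axioms.
\<close>

definition twisted_id ::
  "('k, 'b) monoid_scheme \<Rightarrow> ('k \<Rightarrow> 'k \<Rightarrow> complex) \<Rightarrow>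
   ('k gvs, 'k gmap, 'k gvs, 'k gmap) mfun" where
  "twisted_id K c = \<lparr>
     FOb = (\<lambda>V \<in> Ob (Vec K). V),
     FAr = (\<lambda>f \<in> Ar (Vec K). f),
     FTens = (\<lambda>(V, W) \<in> Ob (Vec K) \<times> Ob (Vec K). scalar2 K c V W),
     FUnt = SclA (Vec K) (inverse (c \<one>\<^bsub>K\<^esub> \<one>\<^bsub>K\<^esub>)) (Idn (Vec K) (Unt (Vec K))) \<rparr>"

definition action_of ::
  "('q, 'a) monoid_scheme \<Rightarrow> ('k, 'b) monoid_scheme \<Rightarrow>
   ('q \<Rightarrow> 'k \<Rightarrow> 'k \<Rightarrow> complex) \<Rightarrow> ('k \<Rightarrow> 'q \<Rightarrow> 'q \<Rightarrow> complex) \<Rightarrow>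
   ('q, 'q, ('k gvs, 'k gmap, 'k gvs, 'k gmap) mfun, ('k gvs, 'k gmap) mtrans) mfun" where
  "action_of Q K \<omega> \<eta> = \<lparr>
     FOb = (\<lambda>q \<in> carrier Q. twisted_id K (\<omega> q)),
     FAr = (\<lambda>q \<in> carrier Q. Idn (Aut_tens0 (Vec K)) (twisted_id K (\<omega> q))),
     FTens = (\<lambda>(q, r) \<in> carrier Q \<times> carrier Q.
       (mfun_comp (Vec K) (twisted_id K (\<omega> q)) (twisted_id K (\<omega> r)),
        (\<lambda>V \<in> Ob (Vec K). scalar1 K (\<lambda>k. \<eta> k q r) V),
        twisted_id K (\<omega> (q \<otimes>\<^bsub>Q\<^esub> r)))),
     FUnt = (mfun_id (Vec K),
        (\<lambda>V \<in> Ob (Vec K). scalar1 K (\<lambda>k. inverse (\<eta> k \<one>\<^bsub>Q\<^esub> \<one>\<^bsub>Q\<^esub>)) V),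
        twisted_id K (\<omega> \<one>\<^bsub>Q\<^esub>)) \<rparr>"

abbreviation actions ::
  "('q, 'a) monoid_scheme \<Rightarrow> ('k, 'b) monoid_scheme \<Rightarrow>
   ('q, 'q, ('k gvs, 'k gmap, 'k gvs, 'k gmap) mfun, ('k gvs, 'k gmap) mtrans) mfun set" where
  "actions Q K \<equiv> monoidal_functors (disc Q) (Aut_tens0 (Vec K))"

end

theory Submission
  imports Defs
begin

text \<open>
  The one-dimensional space \<open>\<delta>\<^sub>k\<close> of degree \<open>k\<close> is alone in its isomorphism class, and
  \<open>\<delta>\<^sub>k \<otimes> \<delta>\<^sub>l = \<delta>\<^bsub>kl\<^esub>\<close> holds strictly. So the functors of an action fix all \<open>\<delta>\<^sub>k\<close>, and evaluating the structure
  maps of the action at these objects gives scalars \<open>\<omega> q k l\<close> and \<open>\<eta> k q r\<close>; the coherence axioms at the \<open>\<delta>\<^sub>k\<close>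
  are exactly the three cocycle conditions. Conversely the identity of every \<open>V\<close> is a sum of composites
  \<open>V \<rightarrow> \<delta>\<^sub>k \<rightarrow> V\<close>, so arrows out of \<open>F V\<close> for a linear \<open>F\<close> are determined by their restrictions along the images of
  the \<open>\<delta>\<^sub>k \<rightarrow> V\<close>, and any family of scalars \<open>\<theta> k\<close> extends uniquely to a natural transformation between two
  linear functors fixing the \<open>\<delta>\<^sub>k\<close>. Therefore two actions are equivalent iff their cochains \<open>(\<omega>, \<eta>)\<close> differ by
  the coboundary of some \<open>\<theta> : Q \<times> K \<rightarrow> \<complex>\<^sup>\<times>\<close>. This relation and the cocycle conditions are symmetric under
  exchanging \<open>(Q, \<omega>)\<close> with \<open>(K, \<eta>)\<close>.
\<close>

section \<open>Kronecker products and sums of matrices\<close>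

text \<open>Away from the lines \<open>delta k\<close> a functor \<open>F\<close> of an action is
  not explicit: \<open>F V\<close> is isomorphic to \<open>V\<close> by no given map, and
  \<open>F f\<close> is not computable from the matrix of \<open>f\<close>. So a transformation
  \<open>F \<rightarrow> G\<close> is not given by a block scalar matrix; it is carried along
  composites \<open>F V \<rightarrow> delta k \<rightarrow> G V\<close>, over which linearity gives
  control, since a linear functor fixes every arrow between lines. The arrows that resolve the
  identity of \<open>V\<close> are the columns and rows of its projections: as these are idempotent,
  no basis of a graded piece has to be chosen. A line is alone in its isomorphism class because
  conjugation by a scalar does not change a 1 by 1 projection. Unit data add no scalars. The
  cochains are not normalized, and each unit axiom makes the unit scalar the inverse of the cochain
  at the neutral element. The bijection reads off \<open>(\<omega>, \<eta>)\<close> and rebuilds an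
  action with the groups exchanged. This can be undone only up to equivalence, because a rebuilt
  action consists of identity functors with changed tensor structure, whatever functors it came
  from.\<close>

lemma mat_sum_carrier [simp]: "mat_sum nr nc A I \<in> carrier_mat nr nc"
  by (simp add: mat_sum_def)

lemma mat_sum_dim [simp]:
  "dim_row (mat_sum nr nc A I) = nr" "dim_col (mat_sum nr nc A I) = nc"
  by (simp_all add: mat_sum_def)

lemma mat_sum_index [simp]:
  "i < nr \<Longrightarrow> j < nc \<Longrightarrow> mat_sum nr nc A I $$ (i, j) = (\<Sum>x\<in>I. A x $$ (i, j))"
  by (simp add: mat_sum_def)

lemma mat_sum_cong:
  "I = J \<Longrightarrow> (\<And>x. x \<in> J \<Longrightarrow> A x = B x) \<Longrightarrow> mat_sum nr nc A I = mat_sum nr nc B J"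
  by (rule eq_matI) (auto intro: sum.cong)

lemma mat_sum_empty: "mat_sum nr nc A {} = 0\<^sub>m nr nc"
  by (rule eq_matI) auto

lemma mat_sum_insert:
  assumes "finite I" "x \<notin> I" "A x \<in> carrier_mat nr nc"
  shows "mat_sum nr nc A (insert x I) = A x + mat_sum nr nc A I"
  using assms by (intro eq_matI) auto

lemma mat_sum_delta:
  assumes "finite I" "x \<in> I" "A x \<in> carrier_mat nr nc"
    "\<And>y. y \<in> I \<Longrightarrow> y \<noteq> x \<Longrightarrow> A y = 0\<^sub>m nr nc"
  shows "mat_sum nr nc A I = A x"
proof (rule eq_matI)
  fix i j assume ij: "i < dim_row (A x)" "j < dim_col (A x)"
  have "(\<Sum>y\<in>I. A y $$ (i, j)) = (\<Sum>y\<in>I. if y = x then A x $$ (i, j) else 0)"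
    using assms ij by (intro sum.cong) auto
  then show "mat_sum nr nc A I $$ (i, j) = A x $$ (i, j)"
    using assms ij by auto
qed (use assms in auto)

lemma mat_sum_mult_left:
  assumes "M \<in> carrier_mat p nr" "\<And>x. x \<in> I \<Longrightarrow> A x \<in> carrier_mat nr nc"
  shows "M * mat_sum nr nc A I = mat_sum p nc (\<lambda>x. M * A x) I"
proof (rule eq_matI)
  fix i j assume "i < dim_row (mat_sum p nc (\<lambda>x. M * A x) I)" "j < dim_col (mat_sum p nc (\<lambda>x. M * A x) I)"
  then have ij: "i < p" "j < nc" by auto
  have "(M * mat_sum nr nc A I) $$ (i, j) = (\<Sum>k = 0..<nr. M $$ (i, k) * (\<Sum>x\<in>I. A x $$ (k, j)))"
    using assms ij by (simp add: scalar_prod_def)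
  also have "\<dots> = (\<Sum>x\<in>I. \<Sum>k = 0..<nr. M $$ (i, k) * A x $$ (k, j))"
    by (simp add: sum_distrib_left) (rule sum.swap)
  also have "\<dots> = (\<Sum>x\<in>I. (M * A x) $$ (i, j))"
  proof (rule sum.cong)
    fix x assume "x \<in> I"
    from assms(2)[OF this] show "(\<Sum>k = 0..<nr. M $$ (i, k) * A x $$ (k, j)) = (M * A x) $$ (i, j)"
      using assms(1) ij by (auto simp: scalar_prod_def)
  qed simp
  finally show "(M * mat_sum nr nc A I) $$ (i, j) = mat_sum p nc (\<lambda>x. M * A x) I $$ (i, j)"
    using ij by simp
qed (use assms in auto)

lemma mat_sum_mult_right:
  assumes "M \<in> carrier_mat nc p" "\<And>x. x \<in> I \<Longrightarrow> A x \<in> carrier_mat nr nc"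
  shows "mat_sum nr nc A I * M = mat_sum nr p (\<lambda>x. A x * M) I"
proof (rule eq_matI)
  fix i j assume "i < dim_row (mat_sum nr p (\<lambda>x. A x * M) I)" "j < dim_col (mat_sum nr p (\<lambda>x. A x * M) I)"
  then have ij: "i < nr" "j < p" by auto
  have "(mat_sum nr nc A I * M) $$ (i, j) = (\<Sum>k = 0..<nc. (\<Sum>x\<in>I. A x $$ (i, k)) * M $$ (k, j))"
    using assms ij by (simp add: scalar_prod_def)
  also have "\<dots> = (\<Sum>x\<in>I. \<Sum>k = 0..<nc. A x $$ (i, k) * M $$ (k, j))"
    by (simp add: sum_distrib_right) (rule sum.swap)
  also have "\<dots> = (\<Sum>x\<in>I. (A x * M) $$ (i, j))"
  proof (rule sum.cong)
    fix x assume "x \<in> I"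
    from assms(2)[OF this] show "(\<Sum>k = 0..<nc. A x $$ (i, k) * M $$ (k, j)) = (A x * M) $$ (i, j)"
      using assms(1) ij by (auto simp: scalar_prod_def)
  qed simp
  finally show "(mat_sum nr nc A I * M) $$ (i, j) = mat_sum nr p (\<lambda>x. A x * M) I $$ (i, j)"
    using ij by simp
qed (use assms in auto)

lemma mat_sum_smult:
  assumes "\<And>x. x \<in> I \<Longrightarrow> A x \<in> carrier_mat nr nc"
  shows "c \<cdot>\<^sub>m mat_sum nr nc A I = mat_sum nr nc (\<lambda>x. c \<cdot>\<^sub>m A x) I"
proof (rule eq_matI)
  fix i j assume "i < dim_row (mat_sum nr nc (\<lambda>x. c \<cdot>\<^sub>m A x) I)" "j < dim_col (mat_sum nr nc (\<lambda>x. c \<cdot>\<^sub>m A x) I)"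
  then have ij: "i < nr" "j < nc" by auto
  have "(\<Sum>x\<in>I. c * A x $$ (i, j)) = (\<Sum>x\<in>I. (c \<cdot>\<^sub>m A x) $$ (i, j))"
  proof (rule sum.cong)
    fix x assume "x \<in> I"
    from assms[OF this] show "c * A x $$ (i, j) = (c \<cdot>\<^sub>m A x) $$ (i, j)" using ij by auto
  qed simp
  with ij show "(c \<cdot>\<^sub>m mat_sum nr nc A I) $$ (i, j) = mat_sum nr nc (\<lambda>x. c \<cdot>\<^sub>m A x) I $$ (i, j)"
    by (simp add: sum_distrib_left)
qed auto

section \<open>Kronecker products: mixed product rule, strict associativity and units\<close>

lemma kron_carrier [simp, intro]:
  "A \<in> carrier_mat a b \<Longrightarrow> B \<in> carrier_mat c d \<Longrightarrow> kron A B \<in> carrier_mat (a * c) (b * d)"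
  by (auto simp: kron_def)

lemma kron_dim [simp]:
  "dim_row (kron A B) = dim_row A * dim_row B" "dim_col (kron A B) = dim_col A * dim_col B"
  by (simp_all add: kron_def)

lemma kron_index [simp]:
  "i < dim_row A * dim_row B \<Longrightarrow> j < dim_col A * dim_col B \<Longrightarrow>
   kron A B $$ (i, j) = A $$ (i div dim_row B, j div dim_col B) * B $$ (i mod dim_row B, j mod dim_col B)"
  by (simp add: kron_def)

lemma div_mod_bounds:
  "(i::nat) < a * b \<Longrightarrow> i div b < a" "(i::nat) < a * b \<Longrightarrow> i mod b < b"
  by (auto simp: less_mult_imp_div_less) (metis gr_zeroI mod_less_divisor mult_0_right not_less0)

lemma mult_add_less: "(x::nat) < a \<Longrightarrow> y < b \<Longrightarrow> x * b + y < a * b"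
proof -
  assume "x < a" "y < b"
  then have "x * b + y < Suc x * b" by simp
  also have "\<dots> \<le> a * b" using \<open>x < a\<close> by (intro mult_le_mono1) simp
  finally show ?thesis .
qed

text \<open>An inner index below \<open>b * b'\<close> is the pair of its quotient and remainder by
  \<open>b'\<close>; this turns the sum over it into a double sum that factors.\<close>

lemma kron_mult:
  assumes "A \<in> carrier_mat a b" "C \<in> carrier_mat b c" "B \<in> carrier_mat a' b'" "D \<in> carrier_mat b' c'"
  shows "kron A B * kron C D = kron (A * C) (B * D)"
proof (rule eq_matI)
  fix i j assume "i < dim_row (kron (A * C) (B * D))" "j < dim_col (kron (A * C) (B * D))"
  then have ij: "i < a * a'" "j < c * c'" using assms by auto
  note bds = div_mod_bounds[OF ij(1)] div_mod_bounds[OF ij(2)]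
  define f where "f x y = A $$ (i div a', x) * C $$ (x, j div c') * (B $$ (i mod a', y) * D $$ (y, j mod c'))"
    for x y
  have "(kron A B * kron C D) $$ (i, j) = (\<Sum>k = 0..<b * b'. kron A B $$ (i, k) * kron C D $$ (k, j))"
    using assms ij by (auto simp: scalar_prod_def)
  also have "\<dots> = (\<Sum>k = 0..<b * b'. f (k div b') (k mod b'))"
    using assms ij by (intro sum.cong) (auto simp: f_def)
  also have "\<dots> = (\<Sum>(x, y)\<in>{0..<b} \<times> {0..<b'}. f x y)"
    by (rule sum.reindex_bij_witness[where i = "\<lambda>(x, y). x * b' + y" and j = "\<lambda>k. (k div b', k mod b')"])
       (auto simp: div_mod_bounds mult_add_less)
  also have "\<dots> = (\<Sum>x = 0..<b. A $$ (i div a', x) * C $$ (x, j div c')) *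
      (\<Sum>y = 0..<b'. B $$ (i mod a', y) * D $$ (y, j mod c'))"
    by (simp add: f_def sum_product sum.cartesian_product)
  also have "\<dots> = kron (A * C) (B * D) $$ (i, j)"
    using assms ij bds by (auto simp: scalar_prod_def)
  finally show "(kron A B * kron C D) $$ (i, j) = kron (A * C) (B * D) $$ (i, j)" .
qed (use assms in auto)

text \<open>Lexicographic numbering of triples is the same for both bracketings, so iterated
  quotients and remainders agree. This strictness lets the associator of \<open>Vec K\<close> be an
  identity.\<close>

lemma kron_assoc: "kron (kron A B) C = kron A (kron B C)"
proof (rule eq_matI)
  fix i j assume "i < dim_row (kron A (kron B C))" "j < dim_col (kron A (kron B C))"
  then have ij: "i < dim_row A * (dim_row B * dim_row C)" "j < dim_col A * (dim_col B * dim_col C)"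
    by auto
  have ij': "i < dim_row A * dim_row B * dim_row C" "j < dim_col A * dim_col B * dim_col C"
    using ij by (simp_all add: mult.assoc)
  note b = div_mod_bounds[OF ij(1)] div_mod_bounds[OF ij(2)]
    div_mod_bounds[OF ij'(1)] div_mod_bounds[OF ij'(2)]
  \<comment> \<open>Valid indices \<open>i\<close> and \<open>j\<close> exist only if the last
    factor has rows and columns; this is the positivity that the rewriting in \<open>1\<close> asks
    for.\<close>
  have pos: "dim_row C > 0" "dim_col C > 0" using ij by (auto intro: gr0I)
  have 1: "x div (y * z) = x div z div y" "x mod (y * z) div z = x div z mod y"
    "x mod (y * z) mod z = x mod z" if "z > 0" for x y z :: nat
    using that by (simp_all add: div_mult2_eq mult.commute[of y z] mod_mult2_eq)
  show "kron (kron A B) C $$ (i, j) = kron A (kron B C) $$ (i, j)"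
    using ij ij' b pos by (simp add: 1 mult.assoc)
qed (auto simp: mult.assoc)

lemma kron_one: "kron (1\<^sub>m a) (1\<^sub>m b) = 1\<^sub>m (a * b)"
proof (rule eq_matI)
  fix i j assume "i < dim_row (1\<^sub>m (a * b) :: complex mat)" "j < dim_col (1\<^sub>m (a * b) :: complex mat)"
  then have ij: "i < a * b" "j < a * b" by auto
  have "i div b = j div b \<and> i mod b = j mod b \<longleftrightarrow> i = j"
    by (metis div_mult_mod_eq)
  then show "kron (1\<^sub>m a) (1\<^sub>m b) $$ (i, j) = 1\<^sub>m (a * b) $$ (i, j)"
    using ij div_mod_bounds[OF ij(1)] div_mod_bounds[OF ij(2)] by auto
qed auto

lemma kron_one_left: "kron (1\<^sub>m (Suc 0)) A = A"
  by (rule eq_matI) auto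

lemma kron_one_right: "kron A (1\<^sub>m (Suc 0)) = A"
  by (rule eq_matI) auto

lemma kron_smult: "kron (c \<cdot>\<^sub>m A) (d \<cdot>\<^sub>m B) = (c * d) \<cdot>\<^sub>m kron A B"
  by (rule eq_matI) (auto simp: div_mod_bounds)

lemma kron_zero:
  "kron (0\<^sub>m a b) B = 0\<^sub>m (a * dim_row B) (b * dim_col B)"
  "kron A (0\<^sub>m c d) = 0\<^sub>m (dim_row A * c) (dim_col A * d)"
  by (rule eq_matI; auto simp: div_mod_bounds)+

lemma kron_mat_sum:
  assumes "\<And>x. x \<in> I \<Longrightarrow> A x \<in> carrier_mat a b" "\<And>y. y \<in> J \<Longrightarrow> B y \<in> carrier_mat c d"
  shows "kron (mat_sum a b A I) (mat_sum c d B J) =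
    mat_sum (a * c) (b * d) (\<lambda>(x, y). kron (A x) (B y)) (I \<times> J)"
proof (rule eq_matI)
  fix i j assume "i < dim_row (mat_sum (a * c) (b * d) (\<lambda>(x, y). kron (A x) (B y)) (I \<times> J))"
    "j < dim_col (mat_sum (a * c) (b * d) (\<lambda>(x, y). kron (A x) (B y)) (I \<times> J))"
  then have ij: "i < a * c" "j < b * d" by auto
  have "(\<Sum>(x, y)\<in>I \<times> J. kron (A x) (B y) $$ (i, j)) =
     (\<Sum>(x, y)\<in>I \<times> J. A x $$ (i div c, j div d) * B y $$ (i mod c, j mod d))"
  proof (rule sum.cong, rule refl, clarify)
    fix x y assume "x \<in> I" "y \<in> J"
    with assms(1)[of x] assms(2)[of y]
    have "A x \<in> carrier_mat a b" "B y \<in> carrier_mat c d" by auto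
    then show "kron (A x) (B y) $$ (i, j) = A x $$ (i div c, j div d) * B y $$ (i mod c, j mod d)"
      using ij by auto
  qed
  then show "kron (mat_sum a b A I) (mat_sum c d B J) $$ (i, j) =
     mat_sum (a * c) (b * d) (\<lambda>(x, y). kron (A x) (B y)) (I \<times> J) $$ (i, j)"
    using ij div_mod_bounds[OF ij(1)] div_mod_bounds[OF ij(2)]
    by (simp add: sum_product sum.cartesian_product case_prod_unfold)
qed auto

text \<open>A resolution of the identity, used to test equality of matrices block by block; the
  projections of a grading and their Kronecker products are the instances.\<close>

definition resolves :: "nat \<Rightarrow> ('i \<Rightarrow> complex mat) \<Rightarrow> 'i set \<Rightarrow> bool" where
  "resolves n E I \<longleftrightarrow> (\<forall>x\<in>I. E x \<in> carrier_mat n n) \<and> mat_sum n n E I = 1\<^sub>m n"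

text \<open>Insert the resolved identity on the right: \<open>M\<close> is the sum of the products
  \<open>M * E x\<close>.\<close>

lemma resolves_eqI:
  assumes "resolves n E I" "M \<in> carrier_mat p n" "N \<in> carrier_mat p n"
    and "\<And>x. x \<in> I \<Longrightarrow> M * E x = N * E x"
  shows "M = N"
proof -
  have "M = M * mat_sum n n E I" using assms by (simp add: resolves_def)
  also have "\<dots> = mat_sum p n (\<lambda>x. M * E x) I"
    using assms by (intro mat_sum_mult_left) (auto simp: resolves_def)
  also have "\<dots> = mat_sum p n (\<lambda>x. N * E x) I"
    using assms by (intro mat_sum_cong) auto
  also have "\<dots> = N * mat_sum n n E I"
    using assms by (intro mat_sum_mult_left[symmetric]) (auto simp: resolves_def)
  also have "\<dots> = N" using assms by (simp add: resolves_def)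
  finally show ?thesis .
qed

lemma resolves_kron:
  assumes "resolves n E I" "resolves m F J"
  shows "resolves (n * m) (\<lambda>(x, y). kron (E x) (F y)) (I \<times> J)"
  using assms unfolding resolves_def
  by (auto simp: kron_mat_sum[symmetric] kron_one)

section \<open>The category of graded vector spaces\<close>

locale fin_group = group K for K :: "('k, 'b) monoid_scheme" (structure) +
  assumes fin: "finite (carrier K)"
begin

abbreviation obj :: "'k gvs set" where "obj \<equiv> gvs_objects K"
abbreviation arr :: "'k gvs \<Rightarrow> 'k gvs \<Rightarrow> 'k gmap set" where "arr \<equiv> arrows (Vec K)"
abbreviation idn :: "'k gvs \<Rightarrow> 'k gmap" where "idn \<equiv> gvs_id"
abbreviation comp :: "'k gmap \<Rightarrow> 'k gmap \<Rightarrow> 'k gmap" (infixl "\<star>" 70)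
  where "g \<star> f \<equiv> Cmp (Vec K) g f"
abbreviation tensO :: "'k gvs \<Rightarrow> 'k gvs \<Rightarrow> 'k gvs" (infixl "\<boxdot>" 72)
  where "X \<boxdot> Y \<equiv> gvs_tensor K X Y"
abbreviation tensA :: "'k gmap \<Rightarrow> 'k gmap \<Rightarrow> 'k gmap" (infixl "\<boxtimes>" 72)
  where "f \<boxtimes> g \<equiv> TensA (Vec K) f g"
abbreviation scale :: "complex \<Rightarrow> 'k gmap \<Rightarrow> 'k gmap" where "scale \<equiv> SclA (Vec K)"

definition delta :: "'k \<Rightarrow> 'k gvs" where
  "delta k = (1, (\<lambda>g\<in>carrier K. if g = k then 1\<^sub>m 1 else 0\<^sub>m 1 1))"

text \<open>Meant for arrows between lines, whose matrix is 1 by 1: there it is the scalar by which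
  the arrow acts.\<close>

definition entry :: "'k gmap \<Rightarrow> complex" where
  "entry f = fst (snd f) $$ (0, 0)"

lemma Vec_simps [simp]:
  "Ob (Vec K) = obj" "Ar (Vec K) = gvs_arrows K" "Idn (Vec K) = idn" "TensO (Vec K) = gvs_tensor K"
  "Dm (Vec K) (X, M, Y) = X" "Cd (Vec K) (X, M, Y) = Y"
  "Unt (Vec K) = delta \<one>" "Assc (Vec K) X Y Z = idn (X \<boxdot> Y \<boxdot> Z)" "LUnt (Vec K) = idn" "RUnt (Vec K) = idn"
  by (simp_all add: Vec_def gvs_unit_def delta_def)

lemma Vec_ops:
  "(V', N, W) \<star> (U, M, V) = (U, N * M, W)"
  "(V, M, W) \<boxtimes> (V', M', W') = (V \<boxdot> V', kron M M', W \<boxdot> W')"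
  "scale c (V, M, W) = (V, c \<cdot>\<^sub>m M, W)"
  "AddA (Vec K) (V, M, W) (V', M', W') = (V, M + M', W)"
  by (simp_all add: Vec_def)

lemma objD:
  assumes "X \<in> obj"
  shows "g \<in> carrier K \<Longrightarrow> snd X g \<in> carrier_mat (fst X) (fst X)"
    "g \<in> carrier K \<Longrightarrow> h \<in> carrier K \<Longrightarrow> snd X g * snd X h = (if g = h then snd X g else 0\<^sub>m (fst X) (fst X))"
    "snd X \<in> extensional (carrier K)"
    "resolves (fst X) (snd X) (carrier K)"
  using assms by (auto simp: gvs_objects_def resolves_def PiE_def)

lemma obj_dim [simp]:
  assumes "X \<in> obj" "g \<in> carrier K"
  shows "dim_row (snd X g) = fst X" "dim_col (snd X g) = fst X"
  using objD(1)[OF assms] by auto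

lemma objI:
  assumes "\<And>g. g \<in> carrier K \<Longrightarrow> P g \<in> carrier_mat n n"
    "\<And>g h. g \<in> carrier K \<Longrightarrow> h \<in> carrier K \<Longrightarrow> P g * P h = (if g = h then P g else 0\<^sub>m n n)"
    "P \<in> extensional (carrier K)" "mat_sum n n P (carrier K) = 1\<^sub>m n"
  shows "(n, P) \<in> obj"
  using assms unfolding gvs_objects_def by (auto simp: PiE_def)

lemma obj_eqI:
  assumes "fst X = fst Y" "snd X \<in> extensional (carrier K)" "snd Y \<in> extensional (carrier K)"
    "\<And>g. g \<in> carrier K \<Longrightarrow> snd X g = snd Y g"
  shows "X = Y"
  using assms by (intro prod_eqI extensionalityI) auto

section \<open>The convolution product as a grading, with strict associativity and units\<close>

lemma tensO_fst [simp]: "fst (X \<boxdot> Y) = fst X * fst Y"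
  by (simp add: gvs_tensor_def)

lemma tensO_ext: "snd (X \<boxdot> Y) \<in> extensional (carrier K)"
  by (simp add: gvs_tensor_def)

lemma tensO_snd_carrier [simp]:
  "u \<in> carrier K \<Longrightarrow> snd (X \<boxdot> Y) u \<in> carrier_mat (fst X * fst Y) (fst X * fst Y)"
  by (simp add: gvs_tensor_def)

text \<open>By the mixed product rule and orthogonality of the projections, only the summand
  \<open>(g, h)\<close> of \<open>snd (X \<boxdot> Y) u\<close> can survive, and it occurs exactly
  when \<open>g \<otimes> h = u\<close>.\<close>

lemma tensO_proj:
  assumes "X \<in> obj" "Y \<in> obj" "u \<in> carrier K" "g \<in> carrier K" "h \<in> carrier K"
  shows "snd (X \<boxdot> Y) u * kron (snd X g) (snd Y h) =
    (if g \<otimes> h = u then kron (snd X g) (snd Y h) else 0\<^sub>m (fst X * fst Y) (fst X * fst Y))"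
proof -
  let ?S = "{(g, h). g \<in> carrier K \<and> h \<in> carrier K \<and> g \<otimes> h = u}" and ?n = "fst X * fst Y"
  have "?S \<subseteq> carrier K \<times> carrier K" by auto
  then have finS: "finite ?S" using fin finite_subset by blast
  let ?A = "\<lambda>(g', h'). kron (snd X g') (snd Y h') * kron (snd X g) (snd Y h)"
  have A: "?A (g', h') = (if g' = g \<and> h' = h then kron (snd X g) (snd Y h) else 0\<^sub>m ?n ?n)"
    if "g' \<in> carrier K" "h' \<in> carrier K" for g' h'
  proof -
    have "?A (g', h') = kron (snd X g' * snd X g) (snd Y h' * snd Y h)"
      using kron_mult[OF objD(1)[OF assms(1)] objD(1)[OF assms(1)] objD(1)[OF assms(2)] objD(1)[OF assms(2)]]
        assms that by simp
    then show ?thesis using assms that objD(1)[OF assms(1)] objD(1)[OF assms(2)]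
      by (auto simp: objD(2) kron_zero)
  qed
  have "snd (X \<boxdot> Y) u * kron (snd X g) (snd Y h) = mat_sum ?n ?n ?A ?S"
    using assms objD(1) unfolding gvs_tensor_def
    by (auto simp: case_prod_unfold intro!: mat_sum_mult_right kron_carrier)
  also have "\<dots> = (if g \<otimes> h = u then kron (snd X g) (snd Y h) else 0\<^sub>m ?n ?n)"
  proof (cases "g \<otimes> h = u")
    case True
    have "mat_sum ?n ?n ?A ?S = ?A (g, h)"
      using True assms A objD(1) by (intro mat_sum_delta finS) auto
    then show ?thesis using A True assms by simp
  next
    case False
    have "mat_sum ?n ?n ?A ?S = mat_sum ?n ?n (\<lambda>_. 0\<^sub>m ?n ?n) ?S"
    proof (intro mat_sum_cong refl)
      fix p assume "p \<in> ?S"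
      then obtain g' h' where p: "p = (g', h')" "g' \<in> carrier K" "h' \<in> carrier K" "g' \<otimes> h' = u"
        by auto
      show "?A p = 0\<^sub>m ?n ?n"
        unfolding p(1) A[OF p(2,3)] using False p(4) by auto
    qed
    then show ?thesis using False by (auto intro!: eq_matI)
  qed
  finally show ?thesis .
qed

lemma resolves_tensO:
  assumes "X \<in> obj" "Y \<in> obj"
  shows "resolves (fst X * fst Y) (\<lambda>(g, h). kron (snd X g) (snd Y h)) (carrier K \<times> carrier K)"
  using assms by (intro resolves_kron objD)

lemma tensO_eqI:
  assumes "X \<in> obj" "Y \<in> obj" "M \<in> carrier_mat p (fst X * fst Y)" "N \<in> carrier_mat p (fst X * fst Y)"
    and "\<And>g h. g \<in> carrier K \<Longrightarrow> h \<in> carrier K \<Longrightarrow>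
       M * kron (snd X g) (snd Y h) = N * kron (snd X g) (snd Y h)"
  shows "M = N"
  using resolves_eqI[OF resolves_tensO[OF assms(1,2)] assms(3,4)] assms(5) by auto

lemma kron_proj_carrier:
  "X \<in> obj \<Longrightarrow> Y \<in> obj \<Longrightarrow> g \<in> carrier K \<Longrightarrow> h \<in> carrier K \<Longrightarrow>
   kron (snd X g) (snd Y h) \<in> carrier_mat (fst X * fst Y) (fst X * fst Y)"
  by (simp add: objD(1))

text \<open>Both grading axioms are tested on the blocks \<open>kron (snd X g) (snd Y h)\<close>,
  where \<open>tensO_proj\<close> replaces each projection of the product by one or zero.\<close>

lemma tensO_obj [simp, intro]:
  assumes X: "X \<in> obj" and Y: "Y \<in> obj"
  shows "X \<boxdot> Y \<in> obj"
proof -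
  let ?n = "fst X * fst Y" and ?T = "snd (X \<boxdot> Y)" and ?E = "\<lambda>g h. kron (snd X g) (snd Y h)"
  note E = kron_proj_carrier[OF X Y]
  have T: "?T u \<in> carrier_mat ?n ?n" if "u \<in> carrier K" for u using that by simp
  have "(?n, ?T) \<in> obj"
  proof (rule objI)
    fix u v assume uv: "u \<in> carrier K" "v \<in> carrier K"
    show "?T u * ?T v = (if u = v then ?T u else 0\<^sub>m ?n ?n)"
    proof (rule tensO_eqI[OF X Y])
      fix g h assume gh: "g \<in> carrier K" "h \<in> carrier K"
      have "?T u * ?T v * ?E g h = ?T u * (?T v * ?E g h)"
        by (rule assoc_mult_mat[OF T T E]) (use uv gh in auto)
      then show "?T u * ?T v * ?E g h = (if u = v then ?T u else 0\<^sub>m ?n ?n) * ?E g h"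
        using uv gh X Y E[OF gh] right_mult_zero_mat[OF T[of u]] left_mult_zero_mat[OF E[OF gh]]
        by (auto simp: tensO_proj)
    qed (use uv T mult_carrier_mat[OF T T, of u v] in auto)
  next
    show "mat_sum ?n ?n ?T (carrier K) = 1\<^sub>m ?n"
    proof (rule tensO_eqI[OF X Y])
      fix g h assume gh: "g \<in> carrier K" "h \<in> carrier K"
      have "mat_sum ?n ?n ?T (carrier K) * ?E g h = mat_sum ?n ?n (\<lambda>u. ?T u * ?E g h) (carrier K)"
        using E[OF gh] by (intro mat_sum_mult_right) auto
      also have "\<dots> = mat_sum ?n ?n (\<lambda>u. if g \<otimes> h = u then ?E g h else 0\<^sub>m ?n ?n) (carrier K)"
        using X Y gh by (intro mat_sum_cong) (auto simp: tensO_proj)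
      also have "\<dots> = ?E g h"
        using gh E[OF gh] mat_sum_delta[OF fin, of "g \<otimes> h" "\<lambda>u. if g \<otimes> h = u then ?E g h else 0\<^sub>m ?n ?n" ?n ?n]
        by auto
      finally show "mat_sum ?n ?n ?T (carrier K) * ?E g h = 1\<^sub>m ?n * ?E g h"
        using left_mult_one_mat[OF E[OF gh]] by simp
    qed auto
  qed (auto simp: tensO_ext)
  then show ?thesis by (simp add: gvs_tensor_def)
qed

text \<open>On a block of degrees \<open>g\<close>, \<open>h\<close>, \<open>m\<close> the
  projections of both bracketings act by the same rule, because \<open>K\<close> is associative;
  \<open>tensO_assoc\<close> compares them block by block.\<close>

lemma tensO_proj3:
  assumes "X \<in> obj" "Y \<in> obj" "Z \<in> obj" "u \<in> carrier K" "g \<in> carrier K" "h \<in> carrier K" "m \<in> carrier K"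
  defines "E \<equiv> kron (kron (snd X g) (snd Y h)) (snd Z m)"
  shows "snd (X \<boxdot> Y \<boxdot> Z) u * E = (if g \<otimes> h \<otimes> m = u then E else 0\<^sub>m (fst X * fst Y * fst Z) (fst X * fst Y * fst Z))"
    "snd (X \<boxdot> (Y \<boxdot> Z)) u * E = (if g \<otimes> h \<otimes> m = u then E else 0\<^sub>m (fst X * fst Y * fst Z) (fst X * fst Y * fst Z))"
proof -
  let ?n = "fst X * fst Y * fst Z"
  have XY: "X \<boxdot> Y \<in> obj" and YZ: "Y \<boxdot> Z \<in> obj" using assms by auto
  have gh: "g \<otimes> h \<in> carrier K" "h \<otimes> m \<in> carrier K" using assms by auto
  have c: "snd X g \<in> carrier_mat (fst X) (fst X)" "snd Y h \<in> carrier_mat (fst Y) (fst Y)"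
     "snd Z m \<in> carrier_mat (fst Z) (fst Z)" using assms objD(1) by auto
  have E: "E \<in> carrier_mat ?n ?n" unfolding E_def using c by auto
  \<comment> \<open>The block lies in degree \<open>g \<otimes> h\<close> of
    \<open>X \<boxdot> Y\<close>, so the coarser block reproduces it; inserting that block makes the
    two-factor rule \<open>tensO_proj\<close> applicable.\<close>
  have 1: "E = kron (snd (X \<boxdot> Y) (g \<otimes> h)) (snd Z m) * E"
  proof -
    have "kron (snd (X \<boxdot> Y) (g \<otimes> h)) (snd Z m) * E =
      kron (snd (X \<boxdot> Y) (g \<otimes> h) * kron (snd X g) (snd Y h)) (snd Z m * snd Z m)"
      unfolding E_def
      by (rule kron_mult[OF tensO_snd_carrier[OF gh(1)] kron_carrier[OF c(1,2)] c(3) c(3)])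
    then show ?thesis unfolding E_def using assms by (simp add: tensO_proj objD(2))
  qed
  have 2: "E = kron (snd X g) (snd (Y \<boxdot> Z) (h \<otimes> m)) * E"
  proof -
    have "kron (snd X g) (snd (Y \<boxdot> Z) (h \<otimes> m)) * E =
      kron (snd X g * snd X g) (snd (Y \<boxdot> Z) (h \<otimes> m) * kron (snd Y h) (snd Z m))"
      unfolding E_def kron_assoc
      by (rule kron_mult[OF c(1) c(1) tensO_snd_carrier[OF gh(2)] kron_carrier[OF c(2,3)]])
    then show ?thesis unfolding E_def kron_assoc using assms by (simp add: tensO_proj objD(2))
  qed
  let ?A = "snd (X \<boxdot> Y \<boxdot> Z) u" and ?B = "kron (snd (X \<boxdot> Y) (g \<otimes> h)) (snd Z m)"
  have B: "?B \<in> carrier_mat ?n ?n" and A: "?A \<in> carrier_mat ?n ?n"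
    using c gh assms(4) kron_proj_carrier[OF XY assms(3) gh(1) assms(7)]
      tensO_snd_carrier[OF assms(4), of "X \<boxdot> Y" Z] by auto
  have "?A * E = (?A * ?B) * E"
    by (subst 1) (rule assoc_mult_mat[OF A B E, symmetric])
  also have "\<dots> = (if g \<otimes> h \<otimes> m = u then E else 0\<^sub>m ?n ?n)"
    using XY assms(3,4,7) gh(1) E 1[symmetric] by (auto simp: tensO_proj)
  finally show "?A * E = (if g \<otimes> h \<otimes> m = u then E else 0\<^sub>m ?n ?n)" .
  let ?A = "snd (X \<boxdot> (Y \<boxdot> Z)) u" and ?B = "kron (snd X g) (snd (Y \<boxdot> Z) (h \<otimes> m))"
  have B: "?B \<in> carrier_mat ?n ?n" and A: "?A \<in> carrier_mat ?n ?n"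
    using c gh assms(4) kron_proj_carrier[OF assms(1) YZ assms(5) gh(2)]
      tensO_snd_carrier[OF assms(4), of X "Y \<boxdot> Z"] by (auto simp: mult.assoc)
  have "?A * E = (?A * ?B) * E"
    by (subst 2) (rule assoc_mult_mat[OF A B E, symmetric])
  also have "\<dots> = (if g \<otimes> h \<otimes> m = u then E else 0\<^sub>m ?n ?n)"
    using YZ assms(1,4-7) gh(2) E 2[symmetric] by (auto simp: tensO_proj m_assoc mult.assoc)
  finally show "?A * E = (if g \<otimes> h \<otimes> m = u then E else 0\<^sub>m ?n ?n)" .
qed

lemma tensO3_eqI:
  assumes "X \<in> obj" "Y \<in> obj" "Z \<in> obj"
    and "M \<in> carrier_mat p (fst X * fst Y * fst Z)" "N \<in> carrier_mat p (fst X * fst Y * fst Z)"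
    and "\<And>g h m. g \<in> carrier K \<Longrightarrow> h \<in> carrier K \<Longrightarrow> m \<in> carrier K \<Longrightarrow>
       M * kron (kron (snd X g) (snd Y h)) (snd Z m) = N * kron (kron (snd X g) (snd Y h)) (snd Z m)"
  shows "M = N"
  using resolves_eqI[OF resolves_kron[OF resolves_tensO[OF assms(1,2)] objD(4)[OF assms(3)]] assms(4,5)]
    assms(6) by auto

lemma tensO_assoc:
  assumes "X \<in> obj" "Y \<in> obj" "Z \<in> obj"
  shows "X \<boxdot> Y \<boxdot> Z = X \<boxdot> (Y \<boxdot> Z)"
proof (rule obj_eqI)
  fix u assume u: "u \<in> carrier K"
  show "snd (X \<boxdot> Y \<boxdot> Z) u = snd (X \<boxdot> (Y \<boxdot> Z)) u"
  proof (rule tensO3_eqI[OF assms])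
    show "snd (X \<boxdot> Y \<boxdot> Z) u \<in> carrier_mat (fst X * fst Y * fst Z) (fst X * fst Y * fst Z)"
      using tensO_snd_carrier[OF u, of "X \<boxdot> Y" Z] by simp
    show "snd (X \<boxdot> (Y \<boxdot> Z)) u \<in> carrier_mat (fst X * fst Y * fst Z) (fst X * fst Y * fst Z)"
      using tensO_snd_carrier[OF u, of X "Y \<boxdot> Z"] by (simp add: mult.assoc)
  qed (use u assms in \<open>simp add: tensO_proj3\<close>)
qed (auto simp: tensO_ext mult.assoc)

lemma delta_fst [simp]: "fst (delta k) = 1"
  by (simp add: delta_def)

lemma delta_snd [simp]: "g \<in> carrier K \<Longrightarrow> snd (delta k) g = (if g = k then 1\<^sub>m 1 else 0\<^sub>m 1 1)"
  by (simp add: delta_def)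

lemma delta_obj [simp, intro]:
  assumes "k \<in> carrier K"
  shows "delta k \<in> obj"
  unfolding delta_def
proof (rule objI)
  let ?P = "\<lambda>g\<in>carrier K. if g = k then 1\<^sub>m 1 else 0\<^sub>m 1 1 :: complex mat"
  have "mat_sum 1 1 ?P (carrier K) = ?P k"
    using assms by (intro mat_sum_delta fin) auto
  then show "mat_sum 1 1 ?P (carrier K) = 1\<^sub>m 1" using assms by simp
qed auto

lemma tensO_delta:
  assumes "k \<in> carrier K" "l \<in> carrier K"
  shows "delta k \<boxdot> delta l = delta (k \<otimes> l)"
proof (rule obj_eqI)
  fix u assume u: "u \<in> carrier K"
  \<comment> \<open>For two lines the block in degrees \<open>k\<close>, \<open>l\<close> is the 1
    by 1 identity matrix, so it may be inserted freely.\<close>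
  have "snd (delta k \<boxdot> delta l) u = snd (delta k \<boxdot> delta l) u * kron (snd (delta k) k) (snd (delta l) l)"
    using assms tensO_snd_carrier[OF u, of "delta k" "delta l"] by (simp add: kron_one)
  also have "\<dots> = snd (delta (k \<otimes> l)) u"
    using assms u by (subst tensO_proj) (auto simp: kron_one)
  finally show "snd (delta k \<boxdot> delta l) u = snd (delta (k \<otimes> l)) u" .
qed (auto simp: tensO_ext, simp add: delta_def)

lemma tensO_unit:
  assumes X: "X \<in> obj"
  shows "delta \<one> \<boxdot> X = X" "X \<boxdot> delta \<one> = X"
proof -
  have one: "delta \<one> \<in> obj" "\<one> \<in> carrier K" by auto
  show "delta \<one> \<boxdot> X = X"
  proof (rule obj_eqI)
    fix u assume u: "u \<in> carrier K"
    show "snd (delta \<one> \<boxdot> X) u = snd X u"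
    proof (rule resolves_eqI[OF objD(4)[OF X]])
      fix h assume h: "h \<in> carrier K"
      show "snd (delta \<one> \<boxdot> X) u * snd X h = snd X u * snd X h"
        using tensO_proj[OF one(1) X u one(2) h] X h u by (auto simp: objD(2) kron_one_left)
    qed (use u X objD(1)[OF X] tensO_snd_carrier[OF u, of "delta \<one>" X] in auto)
  qed (auto simp: tensO_ext X objD)
  show "X \<boxdot> delta \<one> = X"
  proof (rule obj_eqI)
    fix u assume u: "u \<in> carrier K"
    show "snd (X \<boxdot> delta \<one>) u = snd X u"
    proof (rule resolves_eqI[OF objD(4)[OF X]])
      fix h assume h: "h \<in> carrier K"
      show "snd (X \<boxdot> delta \<one>) u * snd X h = snd X u * snd X h"
        using tensO_proj[OF X one(1) u h one(2)] X h u by (auto simp: objD(2) kron_one_right)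
    qed (use u X objD(1)[OF X] tensO_snd_carrier[OF u, of X "delta \<one>"] in auto)
  qed (auto simp: tensO_ext X objD)
qed

section \<open>Arrows of \<open>Vec K\<close>: composition, tensor product, scalars\<close>

lemma arr_iff:
  "f \<in> arr X Y \<longleftrightarrow> X \<in> obj \<and> Y \<in> obj \<and> (\<exists>M. f = (X, M, Y) \<and> M \<in> carrier_mat (fst Y) (fst X) \<and>
     (\<forall>g \<in> carrier K. M * snd X g = snd Y g * M))"
  by (auto simp: arrows_def gvs_arrows_def)

lemma arrE:
  assumes "f \<in> arr X Y"
  obtains M where "f = (X, M, Y)" "M \<in> carrier_mat (fst Y) (fst X)" "X \<in> obj" "Y \<in> obj"
     "\<And>g. g \<in> carrier K \<Longrightarrow> M * snd X g = snd Y g * M"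
  using assms unfolding arr_iff by blast

lemma arr_objD: "f \<in> arr X Y \<Longrightarrow> X \<in> obj" "f \<in> arr X Y \<Longrightarrow> Y \<in> obj"
  by (auto simp: arr_iff)

lemma Ar_iff: "f \<in> gvs_arrows K \<longleftrightarrow> (\<exists>X Y. f \<in> arr X Y)"
  by (auto simp: arrows_def)

lemma arrD: "f \<in> arr X Y \<Longrightarrow> f \<in> gvs_arrows K" "f \<in> arr X Y \<Longrightarrow> Dm (Vec K) f = X" "f \<in> arr X Y \<Longrightarrow> Cd (Vec K) f = Y"
  by (auto simp: arrows_def)

lemma idn_in [simp, intro]: "X \<in> obj \<Longrightarrow> idn X \<in> arr X X"
  using objD(1) by (force simp: arr_iff gvs_id_def)

lemma comp_in [intro]:
  assumes "g \<in> arr Y Z" "f \<in> arr X Y"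
  shows "g \<star> f \<in> arr X Z"
proof -
  obtain M where M: "f = (X, M, Y)" "M \<in> carrier_mat (fst Y) (fst X)" "X \<in> obj" "Y \<in> obj"
     "\<And>g. g \<in> carrier K \<Longrightarrow> M * snd X g = snd Y g * M" by (rule arrE[OF assms(2)]) blast
  obtain N where N: "g = (Y, N, Z)" "N \<in> carrier_mat (fst Z) (fst Y)" "Z \<in> obj"
     "\<And>g. g \<in> carrier K \<Longrightarrow> N * snd Y g = snd Z g * N" by (rule arrE[OF assms(1)]) blast
  have "N * M * snd X h = snd Z h * (N * M)" if h: "h \<in> carrier K" for h
  proof -
    note c = objD(1)[OF M(3) h] objD(1)[OF M(4) h] objD(1)[OF N(3) h]
    have "N * M * snd X h = N * (M * snd X h)" by (rule assoc_mult_mat[OF N(2) M(2) c(1)])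
    also have "\<dots> = N * snd Y h * M" using M(5)[OF h] assoc_mult_mat[OF N(2) c(2) M(2)] by simp
    also have "\<dots> = snd Z h * (N * M)" using N(4)[OF h] assoc_mult_mat[OF c(3) N(2) M(2)] by simp
    finally show ?thesis .
  qed
  then show ?thesis using M N by (auto simp: arr_iff Vec_ops)
qed

lemma scale_in [simp, intro]: "f \<in> arr X Y \<Longrightarrow> scale c f \<in> arr X Y"
proof (elim arrE)
  fix M assume M: "f = (X, M, Y)" "M \<in> carrier_mat (fst Y) (fst X)" "X \<in> obj" "Y \<in> obj"
     "\<And>g. g \<in> carrier K \<Longrightarrow> M * snd X g = snd Y g * M"
  have "c \<cdot>\<^sub>m M * snd X g = snd Y g * (c \<cdot>\<^sub>m M)" if g: "g \<in> carrier K" for g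
    using M g objD(1)[OF M(3) g] objD(1)[OF M(4) g]
    by (simp add: mult_smult_assoc_mat[OF M(2)] mult_smult_distrib[OF _ M(2)])
  then show ?thesis using M by (auto simp: arr_iff Vec_ops)
qed

text \<open>Since \<open>M\<close> and \<open>N\<close> intertwine the projections,
  \<open>kron M N\<close> intertwines the blocks of source and target. On one block the projection
  of degree \<open>u\<close> acts by one or zero, on both sides by the same rule.\<close>

lemma tens_in [intro]:
  assumes "f \<in> arr X Y" "f' \<in> arr X' Y'"
  shows "f \<boxtimes> f' \<in> arr (X \<boxdot> X') (Y \<boxdot> Y')"
proof -
  obtain M where M: "f = (X, M, Y)" "M \<in> carrier_mat (fst Y) (fst X)" "X \<in> obj" "Y \<in> obj"
     "\<And>g. g \<in> carrier K \<Longrightarrow> M * snd X g = snd Y g * M" by (rule arrE[OF assms(1)]) blast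
  obtain N where N: "f' = (X', N, Y')" "N \<in> carrier_mat (fst Y') (fst X')" "X' \<in> obj" "Y' \<in> obj"
     "\<And>g. g \<in> carrier K \<Longrightarrow> N * snd X' g = snd Y' g * N" by (rule arrE[OF assms(2)]) blast
  let ?MN = "kron M N"
  have MN: "?MN \<in> carrier_mat (fst Y * fst Y') (fst X * fst X')" using M N by auto
  have "?MN * snd (X \<boxdot> X') u = snd (Y \<boxdot> Y') u * ?MN" if u: "u \<in> carrier K" for u
  proof (rule tensO_eqI[OF M(3) N(3)])
    note T = tensO_snd_carrier[OF u]
    fix g h assume gh: "g \<in> carrier K" "h \<in> carrier K"
    let ?E = "kron (snd X g) (snd X' h)" and ?E' = "kron (snd Y g) (snd Y' h)"
    note E = kron_proj_carrier[OF M(3) N(3) gh] and E' = kron_proj_carrier[OF M(4) N(4) gh]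
    have 1: "?MN * ?E = ?E' * ?MN"
      using kron_mult[OF M(2) objD(1)[OF M(3) gh(1)] N(2) objD(1)[OF N(3) gh(2)]]
        kron_mult[OF objD(1)[OF M(4) gh(1)] M(2) objD(1)[OF N(4) gh(2)] N(2)] M(5) N(5) gh by simp
    have "?MN * snd (X \<boxdot> X') u * ?E = ?MN * (snd (X \<boxdot> X') u * ?E)"
      by (rule assoc_mult_mat[OF MN T E])
    also have "\<dots> = (if g \<otimes> h = u then ?MN * ?E else 0\<^sub>m (fst Y * fst Y') (fst X * fst X'))"
      using MN M N u gh by (auto simp: tensO_proj)
    also have "\<dots> = snd (Y \<boxdot> Y') u * ?E' * ?MN"
      using MN M N u gh 1 by (auto simp: tensO_proj)
    also have "\<dots> = snd (Y \<boxdot> Y') u * ?MN * ?E"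
      using assoc_mult_mat[OF T E' MN] assoc_mult_mat[OF T MN E] 1 by simp
    finally show "?MN * snd (X \<boxdot> X') u * ?E = snd (Y \<boxdot> Y') u * ?MN * ?E" .
  qed (use mult_carrier_mat[OF MN tensO_snd_carrier[OF u]] mult_carrier_mat[OF tensO_snd_carrier[OF u] MN] in auto)
  then show ?thesis using M N MN by (auto simp: arr_iff Vec_ops)
qed

lemma comp_assoc:
  assumes "h \<in> arr Z W" "g \<in> arr Y Z" "f \<in> arr X Y"
  shows "h \<star> g \<star> f = h \<star> (g \<star> f)"
  using assms by (auto elim!: arrE simp: Vec_ops)

lemma comp_idn [simp]: "f \<in> arr X Y \<Longrightarrow> f \<star> idn X = f" "f \<in> arr X Y \<Longrightarrow> idn Y \<star> f = f"
  by (auto elim!: arrE simp: Vec_ops gvs_id_def)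

lemma interchange:
  assumes "g \<in> arr Y Z" "f \<in> arr X Y" "g' \<in> arr Y' Z'" "f' \<in> arr X' Y'"
  shows "(g \<boxtimes> g') \<star> (f \<boxtimes> f') = (g \<star> f) \<boxtimes> (g' \<star> f')"
  using assms by (auto elim!: arrE simp: Vec_ops intro!: kron_mult)

lemma tens_idn: "idn X \<boxtimes> idn Y = idn (X \<boxdot> Y)"
  by (auto simp: Vec_ops gvs_id_def kron_one)

lemma tens_assoc:
  assumes "f \<in> arr X X'" "g \<in> arr Y Y'" "h \<in> arr Z Z'"
  shows "f \<boxtimes> g \<boxtimes> h = f \<boxtimes> (g \<boxtimes> h)"
proof -
  from assms obtain L M N where "f = (X, L, X')" "g = (Y, M, Y')" "h = (Z, N, Z')"
    by (auto simp: arr_iff)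
  then show ?thesis
    using assms[THEN arr_objD(1)] assms[THEN arr_objD(2)] by (simp add: Vec_ops kron_assoc tensO_assoc)
qed

lemma scale_comp:
  "g \<in> arr Y Z \<Longrightarrow> f \<in> arr X Y \<Longrightarrow> scale c g \<star> f = scale c (g \<star> f)"
  "g \<in> arr Y Z \<Longrightarrow> f \<in> arr X Y \<Longrightarrow> g \<star> scale c f = scale c (g \<star> f)"
  by (auto elim!: arrE simp: Vec_ops mult_smult_assoc_mat mult_smult_distrib)

lemma scale_tens: "scale c f \<boxtimes> scale d g = scale (c * d) (f \<boxtimes> g)"
  by (cases f, cases g) (auto simp: Vec_ops kron_smult)

lemma scale_scale: "scale c (scale d f) = scale (c * d) f"
  by (cases f) (auto simp: Vec_ops)

lemma scale_one [simp]: "scale 1 f = f"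
  by (cases f) (auto simp: Vec_ops intro!: eq_matI)

text \<open>Zero arrows are written as \<open>scale 0 f\<close>; this makes the choice of
  \<open>f\<close> immaterial.\<close>

lemma scale_zero: "f \<in> arr X Y \<Longrightarrow> f' \<in> arr X Y \<Longrightarrow> scale 0 f = scale 0 f'"
  by (auto elim!: arrE simp: Vec_ops intro!: eq_matI)

lemma entry_scale [simp]: "entry (scale c (idn (delta k))) = c"
  by (simp add: entry_def gvs_id_def Vec_ops)

lemma arr_delta:
  assumes "f \<in> arr (delta k) (delta k)"
  shows "f = scale (entry f) (idn (delta k))"
  using assms by (auto elim!: arrE simp: entry_def gvs_id_def Vec_ops intro!: eq_matI)

text \<open>Lines of different degree have only the zero arrow between them: in degree
  \<open>k\<close> the source projection is one and the target projection is zero. The equation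
  \<open>f = scale 0 f\<close> is how vanishing is expressed.\<close>

lemma arr_delta_zero:
  assumes f: "f \<in> arr (delta k) (delta l)" and k: "k \<in> carrier K" and "k \<noteq> l"
  shows "f = scale 0 f"
  using f
proof (rule arrE)
  fix M assume M: "f = (delta k, M, delta l)" "M \<in> carrier_mat (fst (delta l)) (fst (delta k))"
     "\<And>g. g \<in> carrier K \<Longrightarrow> M * snd (delta k) g = snd (delta l) g * M"
  from M(3)[OF k] k M(2) assms(3) have "M = 0\<^sub>m 1 1" by simp
  then show ?thesis using M by (auto simp: Vec_ops)
qed

end

section \<open>Linear functors and one-dimensional objects\<close>

text \<open>A column is kept as an \<open>n\<close> by 1 matrix, so that it can be the matrix of an
  arrow out of a line.\<close>

definition col_mat :: "nat \<Rightarrow> complex mat \<Rightarrow> nat \<Rightarrow> complex mat" where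
  "col_mat n A j = mat n 1 (\<lambda>(i, _). A $$ (i, j))"

definition row_mat :: "nat \<Rightarrow> complex mat \<Rightarrow> nat \<Rightarrow> complex mat" where
  "row_mat n A j = mat 1 n (\<lambda>(_, i). A $$ (j, i))"

lemma col_mat_carrier [simp]: "col_mat n A j \<in> carrier_mat n 1"
  by (simp add: col_mat_def)

lemma row_mat_carrier [simp]: "row_mat n A j \<in> carrier_mat 1 n"
  by (simp add: row_mat_def)

lemma col_mat_row_mat_carrier_Suc [simp]:
  "col_mat n A j \<in> carrier_mat n (Suc 0)" "row_mat n A j \<in> carrier_mat (Suc 0) n"
  by (simp_all add: col_mat_def row_mat_def)

lemma mult_col_mat:
  assumes "A \<in> carrier_mat n n" "B \<in> carrier_mat n n" "j < n"
  shows "B * col_mat n A j = col_mat n (B * A) j"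
  using assms by (intro eq_matI) (auto simp: col_mat_def scalar_prod_def)

lemma row_mat_mult:
  assumes "A \<in> carrier_mat n n" "B \<in> carrier_mat n n" "j < n"
  shows "row_mat n A j * B = row_mat n (A * B) j"
  using assms by (intro eq_matI) (auto simp: row_mat_def scalar_prod_def)

lemma col_mat_zero: "j < n \<Longrightarrow> col_mat n (0\<^sub>m n n) j = 0\<^sub>m n 1"
  by (rule eq_matI) (auto simp: col_mat_def)

lemma row_mat_zero: "j < n \<Longrightarrow> row_mat n (0\<^sub>m n n) j = 0\<^sub>m 1 n"
  by (rule eq_matI) (auto simp: row_mat_def)

context fin_group begin

text \<open>Source and target are arguments because the empty sum has to be the zero arrow from
  \<open>X\<close> to \<open>Y\<close>.\<close>

definition arrow_sum :: "'k gvs \<Rightarrow> 'k gvs \<Rightarrow> ('i \<Rightarrow> 'k gmap) \<Rightarrow> 'i set \<Rightarrow> 'k gmap" where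
  "arrow_sum X Y f I = (X, mat_sum (fst Y) (fst X) (\<lambda>i. fst (snd (f i))) I, Y)"

lemma arr_mat:
  assumes "f \<in> arr X Y"
  shows "f = (X, fst (snd f), Y)" "fst (snd f) \<in> carrier_mat (fst Y) (fst X)"
    "g \<in> carrier K \<Longrightarrow> fst (snd f) * snd X g = snd Y g * fst (snd f)"
  using assms by (auto simp: arr_iff)

lemma arrow_sum_in [intro]:
  assumes "X \<in> obj" "Y \<in> obj" "\<And>i. i \<in> I \<Longrightarrow> f i \<in> arr X Y"
  shows "arrow_sum X Y f I \<in> arr X Y"
proof -
  let ?m = "\<lambda>i. fst (snd (f i))"
  have m: "?m i \<in> carrier_mat (fst Y) (fst X)" if "i \<in> I" for i
    using arr_mat(2)[OF assms(3)[OF that]] .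
  have "mat_sum (fst Y) (fst X) ?m I * snd X g = snd Y g * mat_sum (fst Y) (fst X) ?m I"
    if g: "g \<in> carrier K" for g
    using mat_sum_mult_right[OF objD(1)[OF assms(1) g], of I ?m "fst Y"]
      mat_sum_mult_left[OF objD(1)[OF assms(2) g], of I ?m "fst X"] m
      arr_mat(3)[OF assms(3) g] by (simp cong: mat_sum_cong)
  then show ?thesis using assms by (auto simp: arr_iff arrow_sum_def)
qed

lemma arrow_sum_cong: "(\<And>i. i \<in> I \<Longrightarrow> f i = f' i) \<Longrightarrow> arrow_sum X Y f I = arrow_sum X Y f' I"
  by (auto simp: arrow_sum_def cong: mat_sum_cong)

lemma comp_arrow_sum:
  assumes "g \<in> arr Y Z" "\<And>i. i \<in> I \<Longrightarrow> f i \<in> arr X Y"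
  shows "g \<star> arrow_sum X Y f I = arrow_sum X Z (\<lambda>i. g \<star> f i) I"
proof -
  obtain N where N: "g = (Y, N, Z)" "N \<in> carrier_mat (fst Z) (fst Y)" using arr_mat[OF assms(1)] by metis
  have "fst (snd (g \<star> f i)) = N * fst (snd (f i))" if "i \<in> I" for i
    by (subst arr_mat(1)[OF assms(2)[OF that]]) (simp add: N Vec_ops)
  then show ?thesis
    using N mat_sum_mult_left[OF N(2), of I "\<lambda>i. fst (snd (f i))" "fst X"] arr_mat(2)[OF assms(2)]
    by (auto simp: arrow_sum_def Vec_ops cong: mat_sum_cong)
qed

lemma arrow_sum_comp:
  assumes "g \<in> arr X Y" "\<And>i. i \<in> I \<Longrightarrow> f i \<in> arr Y Z"
  shows "arrow_sum Y Z f I \<star> g = arrow_sum X Z (\<lambda>i. f i \<star> g) I"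
proof -
  obtain N where N: "g = (X, N, Y)" "N \<in> carrier_mat (fst Y) (fst X)" using arr_mat[OF assms(1)] by metis
  have "fst (snd (f i \<star> g)) = fst (snd (f i)) * N" if "i \<in> I" for i
    by (subst arr_mat(1)[OF assms(2)[OF that]]) (simp add: N Vec_ops)
  then show ?thesis
    using N mat_sum_mult_right[OF N(2), of I "\<lambda>i. fst (snd (f i))" "fst Z"] arr_mat(2)[OF assms(2)]
    by (auto simp: arrow_sum_def Vec_ops cong: mat_sum_cong)
qed

lemma arrow_sum_scale:
  assumes "\<And>i. i \<in> I \<Longrightarrow> f i \<in> arr X Y"
  shows "scale c (arrow_sum X Y f I) = arrow_sum X Y (\<lambda>i. scale c (f i)) I"
proof -
  have "fst (snd (scale c (f i))) = c \<cdot>\<^sub>m fst (snd (f i))" for i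
    by (cases "f i") (simp add: Vec_ops)
  then show ?thesis
    using mat_sum_smult[of I "\<lambda>i. fst (snd (f i))" "fst Y" "fst X"] arr_mat(2)[OF assms]
    by (auto simp: arrow_sum_def Vec_ops cong: mat_sum_cong)
qed

lemma arrow_sum_tens:
  assumes "\<And>i. i \<in> I \<Longrightarrow> f i \<in> arr X Y" "\<And>j. j \<in> J \<Longrightarrow> f' j \<in> arr X' Y'"
  shows "arrow_sum X Y f I \<boxtimes> arrow_sum X' Y' f' J = arrow_sum (X \<boxdot> X') (Y \<boxdot> Y') (\<lambda>(i, j). f i \<boxtimes> f' j) (I \<times> J)"
proof -
  have "fst (snd (f i \<boxtimes> f' j)) = kron (fst (snd (f i))) (fst (snd (f' j)))" for i j
    by (cases "f i", cases "f' j") (simp add: Vec_ops)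
  then show ?thesis
    using kron_mat_sum[of I "\<lambda>i. fst (snd (f i))" "fst Y" "fst X" J "\<lambda>i. fst (snd (f' i))" "fst Y'" "fst X'"]
      arr_mat(2)[OF assms(1)] arr_mat(2)[OF assms(2)]
    by (auto simp: arrow_sum_def Vec_ops case_prod_unfold cong: mat_sum_cong)
qed

lemma arrow_sum_empty:
  assumes "f \<in> arr X Y"
  shows "arrow_sum X Y e {} = scale 0 f"
proof -
  have "0 \<cdot>\<^sub>m fst (snd f) = 0\<^sub>m (fst Y) (fst X)" using arr_mat(2)[OF assms] by (intro eq_matI) auto
  then show ?thesis by (subst arr_mat(1)[OF assms]) (simp add: arrow_sum_def mat_sum_empty Vec_ops)
qed

lemma arrow_sum_insert:
  assumes "finite I" "i \<notin> I" "f i \<in> arr X Y"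
  shows "arrow_sum X Y f (insert i I) = AddA (Vec K) (f i) (arrow_sum X Y f I)"
proof -
  obtain M where "f i = (X, M, Y)" "M \<in> carrier_mat (fst Y) (fst X)"
    using arr_mat[OF assms(3)] by metis
  then show ?thesis using assms by (simp add: arrow_sum_def mat_sum_insert Vec_ops)
qed

lemma zero_arr: "X \<in> obj \<Longrightarrow> Y \<in> obj \<Longrightarrow> (X, 0\<^sub>m (fst Y) (fst X), Y) \<in> arr X Y"
  using objD(1) by (auto simp: arr_iff)

text \<open>The columns of \<open>snd X g\<close> span the piece of degree \<open>g\<close>, so each
  of them is an arrow from the line of that degree; all columns are taken, linearly dependent or
  not.\<close>

definition col_incl :: "'k gvs \<Rightarrow> 'k \<times> nat \<Rightarrow> 'k gmap" where
  "col_incl X p = (delta (fst p), col_mat (fst X) (snd X (fst p)) (snd p), X)"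

definition row_proj :: "'k gvs \<Rightarrow> 'k \<times> nat \<Rightarrow> 'k gmap" where
  "row_proj X p = (X, row_mat (fst X) (snd X (fst p)) (snd p), delta (fst p))"

text \<open>An overcomplete index set in general, with \<open>fst X\<close> indices for every
  degree; it indexes a resolution of the identity, not a linearly independent family.\<close>

abbreviation basis_ix :: "'k gvs \<Rightarrow> ('k \<times> nat) set" where
  "basis_ix X \<equiv> carrier K \<times> {..<fst X}"

text \<open>Multiplying a column of \<open>snd X g\<close> by \<open>snd X h\<close> gives the
  column of the product of projections, which is the same column or zero.\<close>

lemma col_incl_in:
  assumes "X \<in> obj" "p \<in> basis_ix X"
  shows "col_incl X p \<in> arr (delta (fst p)) X"
proof -
  have "col_mat (fst X) (snd X (fst p)) (snd p) * snd (delta (fst p)) h =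
    snd X h * col_mat (fst X) (snd X (fst p)) (snd p)" if h: "h \<in> carrier K" for h
    using assms h objD(1)[OF assms(1)] right_mult_zero_mat[OF col_mat_carrier]
    by (auto simp: mult_col_mat objD(2) col_mat_zero) (metis One_nat_def col_mat_carrier right_mult_one_mat)
  then show ?thesis using assms by (auto simp: arr_iff col_incl_def)
qed

lemma row_proj_in:
  assumes "X \<in> obj" "p \<in> basis_ix X"
  shows "row_proj X p \<in> arr X (delta (fst p))"
proof -
  have "row_mat (fst X) (snd X (fst p)) (snd p) * snd X h =
    snd (delta (fst p)) h * row_mat (fst X) (snd X (fst p)) (snd p)" if h: "h \<in> carrier K" for h
    using assms h objD(1)[OF assms(1)] left_mult_zero_mat[OF row_mat_carrier]
    by (auto simp: row_mat_mult objD(2) row_mat_zero) (metis One_nat_def row_mat_carrier left_mult_one_mat)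
  then show ?thesis using assms by (auto simp: arr_iff row_proj_def)
qed

lemma fin_basis_ix [simp]: "finite (basis_ix X)"
  using fin by simp

text \<open>\<open>1 = \<Sum>\<^sub>g P\<^sub>g P\<^sub>g\<close>, and each \<open>P\<^sub>g P\<^sub>g\<close> is the sum over \<open>j\<close> of column \<open>j\<close> times row \<open>j\<close>.\<close>

lemma idn_decomp:
  assumes X: "X \<in> obj"
  shows "arrow_sum X X (\<lambda>p. col_incl X p \<star> row_proj X p) (basis_ix X) = idn X"
proof -
  let ?n = "fst X" and ?P = "snd X"
  let ?A = "\<lambda>p. col_mat ?n (?P (fst p)) (snd p) * row_mat ?n (?P (fst p)) (snd p)"
  have "mat_sum ?n ?n ?A (basis_ix X) = mat_sum ?n ?n ?P (carrier K)"
  proof (rule eq_matI)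
    fix a b assume "a < dim_row (mat_sum ?n ?n ?P (carrier K))" "b < dim_col (mat_sum ?n ?n ?P (carrier K))"
    then have ab: "a < ?n" "b < ?n" by auto
    have "(\<Sum>p\<in>basis_ix X. ?A p $$ (a, b)) = (\<Sum>p\<in>basis_ix X. ?P (fst p) $$ (a, snd p) * ?P (fst p) $$ (snd p, b))"
      using ab by (intro sum.cong) (auto simp: col_mat_def row_mat_def scalar_prod_def)
    also have "\<dots> = (\<Sum>g\<in>carrier K. \<Sum>j<?n. ?P g $$ (a, j) * ?P g $$ (j, b))"
      by (simp add: sum.cartesian_product case_prod_unfold)
    also have "\<dots> = (\<Sum>g\<in>carrier K. (?P g * ?P g) $$ (a, b))"
      using ab X by (intro sum.cong) (auto simp: scalar_prod_def lessThan_atLeast0 simp del: objD(2))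
    also have "\<dots> = (\<Sum>g\<in>carrier K. ?P g $$ (a, b))"
      using X by (intro sum.cong) (auto simp: objD(2))
    finally show "mat_sum ?n ?n ?A (basis_ix X) $$ (a, b) = mat_sum ?n ?n ?P (carrier K) $$ (a, b)"
      using ab by simp
  qed auto
  then show ?thesis using objD(4)[OF X]
    by (simp add: arrow_sum_def col_incl_def row_proj_def Vec_ops gvs_id_def resolves_def)
qed

text \<open>Separates the underlying functor from its tensor structure, so that the testing lemmas
  apply to \<open>twisted_id K c\<close> before any cocycle condition on \<open>c\<close> is
  known.\<close>

definition linear_functor :: "('k gvs, 'k gmap, 'k gvs, 'k gmap) mfun \<Rightarrow> bool" where
  "linear_functor F \<longleftrightarrow> is_functor (Vec K) (Vec K) (FOb F) (FAr F) \<and> linear_on_arrows (Vec K) (FAr F) \<and>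
     (\<forall>k\<in>carrier K. FOb F (delta k) = delta k)"

lemma linear_functor_obj: "linear_functor F \<Longrightarrow> X \<in> obj \<Longrightarrow> FOb F X \<in> obj"
  by (auto simp: linear_functor_def is_functor_def)

lemma linear_functor_delta: "linear_functor F \<Longrightarrow> k \<in> carrier K \<Longrightarrow> FOb F (delta k) = delta k"
  by (simp add: linear_functor_def)

lemma linear_functor_in: "linear_functor F \<Longrightarrow> f \<in> arr X Y \<Longrightarrow> FAr F f \<in> arr (FOb F X) (FOb F Y)"
  by (auto simp: linear_functor_def is_functor_def arrows_def)

lemma linear_functor_idn: "linear_functor F \<Longrightarrow> X \<in> obj \<Longrightarrow> FAr F (idn X) = idn (FOb F X)"
  by (auto simp: linear_functor_def is_functor_def)

lemma linear_functor_comp: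
  assumes "linear_functor F" "g \<in> arr Y Z" "f \<in> arr X Y"
  shows "FAr F (g \<star> f) = FAr F g \<star> FAr F f"
proof -
  have "\<forall>f\<in>gvs_arrows K. \<forall>g\<in>gvs_arrows K. Dm (Vec K) g = Cd (Vec K) f \<longrightarrow> FAr F (g \<star> f) = FAr F g \<star> FAr F f"
    using assms(1) by (simp add: linear_functor_def is_functor_def)
  then show ?thesis using arrD[OF assms(2)] arrD[OF assms(3)] by simp
qed

lemma linear_functor_scale: "linear_functor F \<Longrightarrow> f \<in> arr X Y \<Longrightarrow> FAr F (scale c f) = scale c (FAr F f)"
  using arrD by (auto simp: linear_functor_def linear_on_arrows_def)

lemma linear_functor_add: "linear_functor F \<Longrightarrow> f \<in> arr X Y \<Longrightarrow> g \<in> arr X Y \<Longrightarrow>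
    FAr F (AddA (Vec K) f g) = AddA (Vec K) (FAr F f) (FAr F g)"
  using arrD[of f X Y] arrD[of g X Y] by (auto simp: linear_functor_def linear_on_arrows_def)

lemma linear_functor_arrow_sum:
  assumes F: "linear_functor F" and X: "X \<in> obj" "Y \<in> obj" and "finite I" "\<And>i. i \<in> I \<Longrightarrow> f i \<in> arr X Y"
  shows "FAr F (arrow_sum X Y f I) = arrow_sum (FOb F X) (FOb F Y) (\<lambda>i. FAr F (f i)) I"
  using assms(4,5)
proof (induction I)
  case empty
  \<comment> \<open>Additivity says nothing about the empty sum; that zero goes to zero comes from
    homogeneity with the scalar 0.\<close>
  note z = zero_arr[OF X]
  show ?case
    using arrow_sum_empty[OF z, of f] arrow_sum_empty[OF linear_functor_in[OF F z], of "\<lambda>i. FAr F (f i)"] linear_functor_scale[OF F z]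
    by simp
next
  case (insert i I)
  have "arrow_sum X Y f I \<in> arr X Y" using X insert.prems by auto
  with insert show ?case
    using F by (simp add: arrow_sum_insert linear_functor_add[of _ _ X Y] linear_functor_in)
qed

text \<open>An arrow between lines is a multiple of an identity or zero, and linearity preserves
  both. This is the explicit knowledge about \<open>FAr F\<close> on which the later computations
  rest.\<close>

lemma linear_functor_delta_arr:
  assumes F: "linear_functor F" and kl: "k \<in> carrier K" "l \<in> carrier K" and f: "f \<in> arr (delta k) (delta l)"
  shows "FAr F f = f"
proof (cases "k = l")
  case True
  have id: "idn (delta k) \<in> arr (delta k) (delta k)" using kl by auto
  have "f = scale (entry f) (idn (delta k))" using arr_delta f True by simp
  with linear_functor_scale[OF F id, of "entry f"] show ?thesis
    using F kl by (simp add: linear_functor_idn linear_functor_delta)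
next
  case False
  from arr_delta_zero[OF f kl(1) False] have z: "f = scale 0 f" .
  have "FAr F f = scale 0 (FAr F f)" using linear_functor_scale[OF F f, of 0] z by simp
  also have "\<dots> = scale 0 f" using linear_functor_in[OF F f] f kl F by (intro scale_zero) (auto simp: linear_functor_delta)
  finally show ?thesis using z by simp
qed

lemma arrow_sum_eqI:
  assumes "arrow_sum Y Y e I = idn Y" "f \<in> arr Y Z" "f' \<in> arr Y Z"
    "\<And>i. i \<in> I \<Longrightarrow> e i \<in> arr Y Y" "\<And>i. i \<in> I \<Longrightarrow> f \<star> e i = f' \<star> e i"
  shows "f = f'"
proof -
  have "f = f \<star> arrow_sum Y Y e I" using assms by simp
  also have "\<dots> = arrow_sum Y Z (\<lambda>i. f \<star> e i) I" using assms by (intro comp_arrow_sum)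
  also have "\<dots> = arrow_sum Y Z (\<lambda>i. f' \<star> e i) I" using assms by (intro arrow_sum_cong)
  also have "\<dots> = f' \<star> arrow_sum Y Y e I" using assms by (intro comp_arrow_sum[symmetric])
  also have "\<dots> = f'" using assms by simp
  finally show ?thesis .
qed

lemma linear_functor_decomp:
  assumes "linear_functor F" "X \<in> obj"
  shows "arrow_sum (FOb F X) (FOb F X) (\<lambda>p. FAr F (col_incl X p) \<star> FAr F (row_proj X p)) (basis_ix X) = idn (FOb F X)"
proof -
  have "idn (FOb F X) = FAr F (arrow_sum X X (\<lambda>p. col_incl X p \<star> row_proj X p) (basis_ix X))"
    using assms by (simp add: idn_decomp linear_functor_idn)
  also have "\<dots> = arrow_sum (FOb F X) (FOb F X) (\<lambda>p. FAr F (col_incl X p \<star> row_proj X p)) (basis_ix X)"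
    using assms by (intro linear_functor_arrow_sum) (auto intro: comp_in col_incl_in row_proj_in)
  also have "\<dots> = arrow_sum (FOb F X) (FOb F X) (\<lambda>p. FAr F (col_incl X p) \<star> FAr F (row_proj X p)) (basis_ix X)"
    using assms by (intro arrow_sum_cong linear_functor_comp[OF _ col_incl_in row_proj_in])
  finally show ?thesis ..
qed

text \<open>Apply \<open>F\<close> to the decomposition of the identity of \<open>X\<close>. The
  test arrows are images \<open>FAr F x\<close>, and not arbitrary arrows into
  \<open>FOb F X\<close>, because naturality speaks only of images.\<close>

lemma epi1:
  assumes F: "linear_functor F" and X: "X \<in> obj" and f: "f \<in> arr (FOb F X) Z" "f' \<in> arr (FOb F X) Z"
    and eq: "\<And>k x. k \<in> carrier K \<Longrightarrow> x \<in> arr (delta k) X \<Longrightarrow> f \<star> FAr F x = f' \<star> FAr F x"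
  shows "f = f'"
proof (rule arrow_sum_eqI[OF linear_functor_decomp[OF F X] f])
  fix p assume p: "p \<in> basis_ix X"
  note i = linear_functor_in[OF F col_incl_in[OF X p]] and j = linear_functor_in[OF F row_proj_in[OF X p]]
  show "FAr F (col_incl X p) \<star> FAr F (row_proj X p) \<in> arr (FOb F X) (FOb F X)" using i j by auto
  show "f \<star> (FAr F (col_incl X p) \<star> FAr F (row_proj X p)) = f' \<star> (FAr F (col_incl X p) \<star> FAr F (row_proj X p))"
    using comp_assoc[OF f(1) i j] comp_assoc[OF f(2) i j] eq[OF _ col_incl_in[OF X p]] p by auto
qed

text \<open>The decomposition for \<open>G\<close> is pushed through \<open>F\<close> once more.
  Composites of two functors are the sources of the composition isomorphisms of an action.\<close>

lemma epi_comp: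
  assumes F: "linear_functor F" and G: "linear_functor G" and X: "X \<in> obj"
    and f: "f \<in> arr (FOb F (FOb G X)) Z" "f' \<in> arr (FOb F (FOb G X)) Z"
    and eq: "\<And>k x. k \<in> carrier K \<Longrightarrow> x \<in> arr (delta k) X \<Longrightarrow>
      f \<star> FAr F (FAr G x) = f' \<star> FAr F (FAr G x)"
  shows "f = f'"
proof (rule arrow_sum_eqI[OF _ f])
  let ?Y = "FOb F (FOb G X)"
  let ?e = "\<lambda>p. FAr F (FAr G (col_incl X p)) \<star> FAr F (FAr G (row_proj X p))"
  have Y: "FOb G X \<in> obj" using linear_functor_obj[OF G X] .
  have ar: "FAr G (col_incl X p) \<in> arr (delta (fst p)) (FOb G X)" "FAr G (row_proj X p) \<in> arr (FOb G X) (delta (fst p))"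
    if "p \<in> basis_ix X" for p
    using linear_functor_in[OF G col_incl_in[OF X that]] linear_functor_in[OF G row_proj_in[OF X that]] that by (auto simp: linear_functor_delta[OF G])
  have "idn ?Y = FAr F (arrow_sum (FOb G X) (FOb G X) (\<lambda>p. FAr G (col_incl X p) \<star> FAr G (row_proj X p)) (basis_ix X))"
    by (simp only: linear_functor_decomp[OF G X] linear_functor_idn[OF F Y])
  also have "\<dots> = arrow_sum ?Y ?Y (\<lambda>p. FAr F (FAr G (col_incl X p) \<star> FAr G (row_proj X p))) (basis_ix X)"
    using comp_in[OF ar] by (intro linear_functor_arrow_sum F Y) auto
  also have "\<dots> = arrow_sum ?Y ?Y ?e (basis_ix X)"
    using ar by (intro arrow_sum_cong linear_functor_comp[OF F])
  finally show "arrow_sum ?Y ?Y ?e (basis_ix X) = idn ?Y" ..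
  fix p assume p: "p \<in> basis_ix X"
  note i = linear_functor_in[OF F ar(1)[OF p]] and j = linear_functor_in[OF F ar(2)[OF p]]
  show "?e p \<in> arr ?Y ?Y" using i j by auto
  show "f \<star> ?e p = f' \<star> ?e p"
    using comp_assoc[OF f(1) i j] comp_assoc[OF f(2) i j] eq[OF _ col_incl_in[OF X p]] p by auto
qed

text \<open>Tensoring the two resolved identities resolves the identity of the product, and
  interchange splits each summand into a part through a product of two lines. Tensor structures are
  compared in this way.\<close>

lemma epi2:
  assumes F: "linear_functor F" and X: "X \<in> obj" "Y \<in> obj"
    and f: "f \<in> arr (FOb F X \<boxdot> FOb F Y) Z" "f' \<in> arr (FOb F X \<boxdot> FOb F Y) Z"
    and eq: "\<And>k l x y. k \<in> carrier K \<Longrightarrow> l \<in> carrier K \<Longrightarrow> x \<in> arr (delta k) X \<Longrightarrow> y \<in> arr (delta l) Y \<Longrightarrow>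
      f \<star> (FAr F x \<boxtimes> FAr F y) = f' \<star> (FAr F x \<boxtimes> FAr F y)"
  shows "f = f'"
proof (rule arrow_sum_eqI[OF _ f])
  let ?e = "\<lambda>X p. FAr F (col_incl X p) \<star> FAr F (row_proj X p)"
  let ?E = "\<lambda>(p, q). ?e X p \<boxtimes> ?e Y q"
  let ?W = "FOb F X \<boxdot> FOb F Y"
  have ar: "FAr F (col_incl X p) \<in> arr (delta (fst p)) (FOb F X)" "FAr F (row_proj X p) \<in> arr (FOb F X) (delta (fst p))"
    if "p \<in> basis_ix X" "X \<in> obj" for p X
    using linear_functor_in[OF F col_incl_in[OF that(2,1)]] linear_functor_in[OF F row_proj_in[OF that(2,1)]] that by (auto simp: linear_functor_delta[OF F])
  have "arrow_sum ?W ?W ?E (basis_ix X \<times> basis_ix Y) =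
     arrow_sum (FOb F X) (FOb F X) (?e X) (basis_ix X) \<boxtimes> arrow_sum (FOb F Y) (FOb F Y) (?e Y) (basis_ix Y)"
    using ar X by (intro arrow_sum_tens[symmetric] comp_in)
  also have "\<dots> = idn ?W" using F X by (simp add: linear_functor_decomp tens_idn)
  finally show "arrow_sum ?W ?W ?E (basis_ix X \<times> basis_ix Y) = idn ?W" .
  fix pq assume "pq \<in> basis_ix X \<times> basis_ix Y"
  then obtain p q where pq: "pq = (p, q)" "p \<in> basis_ix X" "q \<in> basis_ix Y" by blast
  note i = ar[OF pq(2) X(1)] and j = ar[OF pq(3) X(2)]
  note E = interchange[OF i(1) i(2) j(1) j(2)]
  show "?E pq \<in> arr ?W ?W" using i j pq by (auto intro!: tens_in comp_in)
  have "f \<star> (FAr F (col_incl X p) \<boxtimes> FAr F (col_incl Y q)) = f' \<star> (FAr F (col_incl X p) \<boxtimes> FAr F (col_incl Y q))"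
    using pq by (intro eq[OF _ _ col_incl_in[OF X(1)] col_incl_in[OF X(2)]]) auto
  then show "f \<star> ?E pq = f' \<star> ?E pq"
    using comp_assoc[OF f(1) tens_in[OF i(1) j(1)] tens_in[OF i(2) j(2)]]
      comp_assoc[OF f(2) tens_in[OF i(1) j(1)] tens_in[OF i(2) j(2)]] pq E by simp
qed

text \<open>The natural transformation \<open>F \<rightarrow> G\<close> that is the scalar \<open>\<theta> k\<close> on \<open>delta k\<close>.\<close>

definition glue :: "('k \<Rightarrow> complex) \<Rightarrow> ('k gvs, 'k gmap, 'k gvs, 'k gmap) mfun \<Rightarrow>
    ('k gvs, 'k gmap, 'k gvs, 'k gmap) mfun \<Rightarrow> 'k gvs \<Rightarrow> 'k gmap" where
  "glue \<theta> F G X = arrow_sum (FOb F X) (FOb G X) (\<lambda>p. scale (\<theta> (fst p)) (FAr G (col_incl X p) \<star> FAr F (row_proj X p))) (basis_ix X)"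

lemma
  assumes F: "linear_functor F" and G: "linear_functor G" and X: "X \<in> obj"
  shows glue_summand_in: "p \<in> basis_ix X \<Longrightarrow> scale c (FAr G (col_incl X p) \<star> FAr F (row_proj X p)) \<in> arr (FOb F X) (FOb G X)"
    and glue_in: "glue \<theta> F G X \<in> arr (FOb F X) (FOb G X)"
proof -
  show 1: "scale c (FAr G (col_incl X p) \<star> FAr F (row_proj X p)) \<in> arr (FOb F X) (FOb G X)" if p: "p \<in> basis_ix X" for p c
  proof -
    have "FAr G (col_incl X p) \<in> arr (delta (fst p)) (FOb G X)" "FAr F (row_proj X p) \<in> arr (FOb F X) (delta (fst p))"
      using linear_functor_in[OF G col_incl_in[OF X p]] linear_functor_in[OF F row_proj_in[OF X p]] p
      by (auto simp: linear_functor_delta[OF G] linear_functor_delta[OF F])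
    then show ?thesis by blast
  qed
  then show "glue \<theta> F G X \<in> arr (FOb F X) (FOb G X)"
    unfolding glue_def by (intro arrow_sum_in linear_functor_obj F G X)
qed

text \<open>The composite of \<open>row_proj X p\<close> with \<open>x\<close> joins two lines and
  vanishes unless their degrees agree. So \<open>\<theta> (fst p)\<close> may be replaced by
  \<open>\<theta> k\<close> in every summand, and the rest of the sum collapses by
  \<open>idn_decomp\<close>.\<close>

lemma glue_comp:
  assumes F: "linear_functor F" and G: "linear_functor G" and k: "k \<in> carrier K" and x: "x \<in> arr (delta k) X"
  shows "glue \<theta> F G X \<star> FAr F x = scale (\<theta> k) (FAr G x)"
proof -
  have X: "X \<in> obj" using arr_objD[OF x] by simp
  have Fx: "FAr F x \<in> arr (delta k) (FOb F X)" using linear_functor_in[OF F x] k by (simp add: linear_functor_delta[OF F])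
  have summand: "scale (\<theta> (fst p)) (FAr G (col_incl X p) \<star> FAr F (row_proj X p)) \<star> FAr F x =
    scale (\<theta> k) (FAr G (col_incl X p \<star> row_proj X p \<star> x))" if p: "p \<in> basis_ix X" for p
  proof -
    note i = col_incl_in[OF X p] and j = row_proj_in[OF X p]
    have g: "fst p \<in> carrier K" using p by auto
    have Gi: "FAr G (col_incl X p) \<in> arr (delta (fst p)) (FOb G X)" using linear_functor_in[OF G i] g by (simp add: linear_functor_delta[OF G])
    have Fj: "FAr F (row_proj X p) \<in> arr (FOb F X) (delta (fst p))" using linear_functor_in[OF F j] g by (simp add: linear_functor_delta[OF F])
    let ?y = "row_proj X p \<star> x"
    have y: "?y \<in> arr (delta k) (delta (fst p))" using j x by auto
    \<comment> \<open>An arrow between lines is fixed by \<open>F\<close>; here the functor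
      \<open>F\<close> disappears and the same arrow can be absorbed into \<open>G\<close>.\<close>
    have Fy: "FAr F (row_proj X p) \<star> FAr F x = ?y"
      using linear_functor_comp[OF F j x] linear_functor_delta_arr[OF F k g y] by simp
    have "scale (\<theta> (fst p)) (FAr G (col_incl X p) \<star> FAr F (row_proj X p)) \<star> FAr F x =
       scale (\<theta> (fst p)) (FAr G (col_incl X p) \<star> ?y)"
      using scale_comp(1)[OF comp_in[OF Gi Fj] Fx] comp_assoc[OF Gi Fj Fx] Fy by simp
    \<comment> \<open>For different degrees \<open>?y\<close> is zero, so both scalars give the zero
      arrow.\<close>
    also have "\<dots> = scale (\<theta> k) (FAr G (col_incl X p) \<star> ?y)"
    proof (cases "k = fst p")
      case False
      have "scale c (FAr G (col_incl X p) \<star> ?y) = scale 0 (FAr G (col_incl X p) \<star> ?y)" for c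
        using scale_comp(2)[OF Gi y, of 0] arr_delta_zero[OF y k False] scale_scale[of c 0] by (metis mult_zero_right)
      then show ?thesis by metis
    qed simp
    also have "\<dots> = scale (\<theta> k) (FAr G (col_incl X p \<star> ?y))"
      using linear_functor_comp[OF G i y] linear_functor_delta_arr[OF G k g y] by simp
    finally show ?thesis using comp_assoc[OF i j x] by simp
  qed
  have ijx: "col_incl X p \<star> row_proj X p \<star> x \<in> arr (delta k) X" if "p \<in> basis_ix X" for p
    using col_incl_in[OF X that] row_proj_in[OF X that] x by auto
  have "glue \<theta> F G X \<star> FAr F x =
     arrow_sum (delta k) (FOb G X) (\<lambda>p. scale (\<theta> k) (FAr G (col_incl X p \<star> row_proj X p \<star> x))) (basis_ix X)"
    unfolding glue_def
    by (subst arrow_sum_comp[OF Fx glue_summand_in[OF F G X]]) (auto intro!: arrow_sum_cong summand)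
  also have "\<dots> = scale (\<theta> k) (FAr G (arrow_sum (delta k) X (\<lambda>p. col_incl X p \<star> row_proj X p \<star> x) (basis_ix X)))"
    using ijx k X linear_functor_in[OF G ijx]
    by (subst linear_functor_arrow_sum[OF G]) (auto simp: arrow_sum_scale linear_functor_delta[OF G])
  also have "arrow_sum (delta k) X (\<lambda>p. col_incl X p \<star> row_proj X p \<star> x) (basis_ix X) = x"
    using arrow_sum_comp[where I = "basis_ix X" and f = "\<lambda>p. col_incl X p \<star> row_proj X p", OF x comp_in[OF col_incl_in[OF X] row_proj_in[OF X]]]
      idn_decomp[OF X] x by simp
  finally show ?thesis .
qed

lemma glue_delta:
  assumes F: "linear_functor F" and G: "linear_functor G" and k: "k \<in> carrier K"
  shows "glue \<theta> F G (delta k) = scale (\<theta> k) (idn (delta k))"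
  using glue_comp[OF F G k idn_in[OF delta_obj[OF k]], of \<theta>] k glue_in[OF F G delta_obj[OF k], of \<theta>]
  by (simp add: linear_functor_idn[OF F] linear_functor_idn[OF G] linear_functor_delta[OF F] linear_functor_delta[OF G])

text \<open>On an image \<open>FAr F x\<close> of an arrow from the line of degree \<open>k\<close>,
  both sides are \<open>\<theta> k\<close> times the image of \<open>f \<star> x\<close> under
  \<open>G\<close>, and \<open>epi1\<close> concludes.\<close>

lemma glue_natural:
  assumes F: "linear_functor F" and G: "linear_functor G" and f: "f \<in> arr X Y"
  shows "glue \<theta> F G Y \<star> FAr F f = FAr G f \<star> glue \<theta> F G X"
proof -
  note X = arr_objD(1)[OF f] and Y = arr_objD(2)[OF f]
  note tX = glue_in[OF F G X, of \<theta>] and tY = glue_in[OF F G Y, of \<theta>]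
  note Ff = linear_functor_in[OF F f] and Gf = linear_functor_in[OF G f]
  show ?thesis
  proof (rule epi1[OF F X comp_in[OF tY Ff] comp_in[OF Gf tX]])
    fix k x assume k: "k \<in> carrier K" and x: "x \<in> arr (delta k) X"
    note Fx = linear_functor_in[OF F x] and Gx = linear_functor_in[OF G x]
    have "glue \<theta> F G Y \<star> FAr F f \<star> FAr F x = glue \<theta> F G Y \<star> FAr F (f \<star> x)"
      using comp_assoc[OF tY Ff Fx] linear_functor_comp[OF F f x] by simp
    also have "\<dots> = scale (\<theta> k) (FAr G f \<star> FAr G x)"
      using glue_comp[OF F G k comp_in[OF f x]] linear_functor_comp[OF G f x] by simp
    also have "\<dots> = FAr G f \<star> glue \<theta> F G X \<star> FAr F x"
      using comp_assoc[OF Gf tX Fx] glue_comp[OF F G k x] scale_comp(2)[OF Gf Gx] by simp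
    finally show "glue \<theta> F G Y \<star> FAr F f \<star> FAr F x = FAr G f \<star> glue \<theta> F G X \<star> FAr F x" .
  qed
qed

lemma glue_inverse:
  assumes F: "linear_functor F" and G: "linear_functor G" and X: "X \<in> obj" and "\<And>k. k \<in> carrier K \<Longrightarrow> \<theta> k * \<theta>' k = 1"
  shows "glue \<theta> G F X \<star> glue \<theta>' F G X = idn (FOb F X)"
proof (rule epi1[OF F X])
  note t = glue_in[OF G F X, of \<theta>] and t' = glue_in[OF F G X, of \<theta>']
  show "glue \<theta> G F X \<star> glue \<theta>' F G X \<in> arr (FOb F X) (FOb F X)" using t t' by auto
  show "idn (FOb F X) \<in> arr (FOb F X) (FOb F X)" using linear_functor_obj[OF F X] by auto
  fix k x assume k: "k \<in> carrier K" and x: "x \<in> arr (delta k) X"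
  note Fx = linear_functor_in[OF F x] and Gx = linear_functor_in[OF G x]
  show "glue \<theta> G F X \<star> glue \<theta>' F G X \<star> FAr F x = idn (FOb F X) \<star> FAr F x"
    using comp_assoc[OF t t' Fx] glue_comp[OF F G k x, of \<theta>'] scale_comp(2)[OF t Gx] glue_comp[OF G F k x, of \<theta>]
      Fx assms(4)[OF k] by (simp add: scale_scale mult.commute)
qed

lemma iso_arrow_iff:
  assumes "f \<in> arr X Y"
  shows "iso_arrow (Vec K) f \<longleftrightarrow> (\<exists>g\<in>arr Y X. g \<star> f = idn X \<and> f \<star> g = idn Y)"
  using arrD[OF assms] by (auto simp: iso_arrow_def)

lemma glue_nat_iso:
  assumes F: "linear_functor F" and G: "linear_functor G" and \<theta>: "\<And>k. k \<in> carrier K \<Longrightarrow> \<theta> k \<noteq> 0"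
  shows "nat_iso (Vec K) (Vec K) (FOb F) (FAr F) (FOb G) (FAr G) (\<lambda>X\<in>obj. glue \<theta> F G X)"
  unfolding nat_iso_def
proof (intro conjI ballI)
  show "(\<lambda>X\<in>obj. glue \<theta> F G X) \<in> Ob (Vec K) \<rightarrow>\<^sub>E Ar (Vec K)"
    using arrD(1)[OF glue_in[OF F G]] by auto
  fix X assume "X \<in> Ob (Vec K)"
  then have X: "X \<in> obj" by simp
  have inv: "glue (\<lambda>k. inverse (\<theta> k)) G F X \<star> glue \<theta> F G X = idn (FOb F X)"
    "glue \<theta> F G X \<star> glue (\<lambda>k. inverse (\<theta> k)) G F X = idn (FOb G X)"
    using \<theta> by (auto intro!: glue_inverse F G X)
  show "(\<lambda>X\<in>obj. glue \<theta> F G X) X \<in> arr (FOb F X) (FOb G X)" using glue_in[OF F G X] X by simp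
  show "iso_arrow (Vec K) ((\<lambda>X\<in>obj. glue \<theta> F G X) X)"
    using iso_arrow_iff[OF glue_in[OF F G X]] X inv glue_in[OF G F X] by auto
next
  fix f assume "f \<in> Ar (Vec K)"
  then obtain X Y where f: "f \<in> arr X Y" by (auto simp: Ar_iff)
  then show "(\<lambda>X\<in>obj. glue \<theta> F G X) (Cd (Vec K) f) \<star> FAr F f = FAr G f \<star> (\<lambda>X\<in>obj. glue \<theta> F G X) (Dm (Vec K) f)"
    using arrD[OF f] arr_objD[OF f] glue_natural[OF F G f] by simp
qed

end

section \<open>Monoidal autoequivalences on one-dimensional objects\<close>

context fin_group begin

abbreviation Aut0 where "Aut0 \<equiv> Aut_tens0 (Vec K)"
abbreviation fun_comp where "fun_comp \<equiv> mfun_comp (Vec K)"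
abbreviation fun_id where "fun_id \<equiv> mfun_id (Vec K)"
abbreviation Aut0_ob where "Aut0_ob \<equiv> Ob Aut0"

lemma Aut0_simps [simp]:
  "Idn Aut0 F = (F, (\<lambda>X\<in>obj. idn (FOb F X)), F)"
  "Cmp Aut0 (G, \<beta>, H) (F, \<alpha>, G') = (F, (\<lambda>X\<in>obj. \<beta> X \<star> \<alpha> X), H)"
  "TensO Aut0 = fun_comp"
  "TensA Aut0 (F, \<alpha>, F') (G, \<beta>, G') =
     (fun_comp F G, (\<lambda>X\<in>obj. \<alpha> (FOb G' X) \<star> FAr F (\<beta> X)), fun_comp F' G')"
  "Unt Aut0 = fun_id"
  "Assc Aut0 F G H = Idn Aut0 (fun_comp (fun_comp F G) H)"
  "LUnt Aut0 = Idn Aut0" "RUnt Aut0 = Idn Aut0"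
  "Dm Aut0 (F, \<alpha>, G) = F" "Cd Aut0 (F, \<alpha>, G) = G"
  by (simp_all add: Aut_tens0_def full_sub_def Aut_tens_def Let_def)

lemma Aut0_ob_iff: "F \<in> Aut0_ob \<longleftrightarrow> F \<in> tensor_autoequivalences (Vec K) \<and> (\<forall>X\<in>obj. isomorphic (Vec K) (FOb F X) X)"
  by (simp add: Aut_tens0_def full_sub_def Aut_tens_def Let_def)

lemma Aut0_arr_iff: "f \<in> arrows Aut0 F G \<longleftrightarrow>
    (\<exists>\<alpha>. f = (F, \<alpha>, G) \<and> F \<in> Aut0_ob \<and> G \<in> Aut0_ob \<and> monoidal_nat_iso (Vec K) (Vec K) F G \<alpha>)"
  by (auto simp: arrows_def Aut0_ob_iff Aut_tens0_def full_sub_def Aut_tens_def Let_def)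

lemma fun_comp_simps [simp]:
  "X \<in> obj \<Longrightarrow> FOb (fun_comp F G) X = FOb F (FOb G X)"
  "f \<in> gvs_arrows K \<Longrightarrow> FAr (fun_comp F G) f = FAr F (FAr G f)"
  "X \<in> obj \<Longrightarrow> Y \<in> obj \<Longrightarrow> FTens (fun_comp F G) (X, Y) = FAr F (FTens G (X, Y)) \<star> FTens F (FOb G X, FOb G Y)"
  "FUnt (fun_comp F G) = FAr F (FUnt G) \<star> FUnt F"
  by (simp_all add: mfun_comp_def)

lemma fun_id_simps [simp]:
  "X \<in> obj \<Longrightarrow> FOb fun_id X = X"
  "f \<in> gvs_arrows K \<Longrightarrow> FAr fun_id f = f"
  "X \<in> obj \<Longrightarrow> Y \<in> obj \<Longrightarrow> FTens fun_id (X, Y) = idn (X \<boxdot> Y)"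
  "FUnt fun_id = idn (delta \<one>)"
  by (simp_all add: mfun_id_def)

text \<open>Hence an autoequivalence preserving isomorphism classes fixes every \<open>delta k\<close> on the nose, not just up
  to isomorphism, and its structure maps on these objects are plain scalars.\<close>

lemma isomorphic_delta:
  assumes k: "k \<in> carrier K" and "isomorphic (Vec K) X (delta k)"
  shows "X = delta k"
proof -
  obtain f g where f: "f \<in> arr X (delta k)" and g: "g \<in> arr (delta k) X"
    and gf: "g \<star> f = idn X" "f \<star> g = idn (delta k)"
    using assms(2) iso_arrow_iff unfolding isomorphic_def by metis
  have X: "X \<in> obj" using arr_objD[OF f] by simp
  let ?n = "fst X"
  obtain M where M: "f = (X, M, delta k)" "M \<in> carrier_mat 1 ?n"
     "\<And>u. u \<in> carrier K \<Longrightarrow> M * snd X u = snd (delta k) u * M" using f by (auto simp: arr_iff)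
  obtain N where N: "g = (delta k, N, X)" "N \<in> carrier_mat ?n 1" using g by (auto simp: arr_iff)
  have NM: "N * M = 1\<^sub>m ?n" and MN: "M * N = 1\<^sub>m 1"
    using gf M N by (simp_all add: Vec_ops gvs_id_def)
  have e: "N $$ (i, 0) * M $$ (0, j) = (if i = j then 1 else 0)" if "i < ?n" "j < ?n" for i j
  proof -
    have "(N * M) $$ (i, j) = N $$ (i, 0) * M $$ (0, j)"
      using M(2) N(2) that by (auto simp: scalar_prod_def)
    then show ?thesis using NM that by simp
  qed
  \<comment> \<open>A composite through the zero space is zero, but here it is the identity of a
    line.\<close>
  have "?n \<noteq> 0"
  proof
    assume "?n = 0"
    with M(2) N(2) have "(M * N) $$ (0, 0) = 0" by (auto simp: scalar_prod_def)
    then show False using MN by simp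
  qed
  \<comment> \<open>A column times a row has rank at most one, so it is no identity matrix of size
    two or more: nonzero entries at (0, 0) and (1, 1) force a nonzero entry at (0, 1).\<close>
  moreover have "\<not> 1 < ?n"
  proof
    assume n: "1 < ?n"
    have "N $$ (0, 0) * M $$ (0, 0) = 1" "N $$ (1, 0) * M $$ (0, 1) = 1" "N $$ (0, 0) * M $$ (0, 1) = 0"
      using e[of 0 0] e[of 1 1] e[of 0 1] n by auto
    then show False by auto
  qed
  ultimately have n: "?n = 1" by simp
  have m: "M $$ (0, 0) \<noteq> 0" using e[of 0 0] n by auto
  show ?thesis
  proof (rule obj_eqI)
    fix u assume u: "u \<in> carrier K"
    let ?D = "snd (delta k) u"
    have D: "?D \<in> carrier_mat 1 1" and P: "snd X u \<in> carrier_mat 1 1"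
      using objD(1)[OF delta_obj[OF k] u] objD(1)[OF X u] n by simp_all
    have "(M * snd X u) $$ (0, 0) = M $$ (0, 0) * snd X u $$ (0, 0)"
      "(?D * M) $$ (0, 0) = ?D $$ (0, 0) * M $$ (0, 0)"
      using M(2) D P n by (auto simp: scalar_prod_def simp del: delta_snd)
    \<comment> \<open>The nonzero scalar \<open>M\<close> cancels from the intertwining relation, so
      the projections are equal and not merely conjugate.\<close>
    then have "snd X u $$ (0, 0) = ?D $$ (0, 0)" using M(3)[OF u] m by (simp del: delta_snd)
    then show "snd X u = ?D" using D P by (intro eq_matI) (auto simp del: delta_snd)
  qed (use n objD(3)[OF X] objD(3)[OF delta_obj[OF k]] in auto)
qed

lemma Aut0_ob_monoidal: "F \<in> Aut0_ob \<Longrightarrow> F \<in> monoidal_functors (Vec K) (Vec K)"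
  by (simp add: Aut0_ob_iff tensor_autoequivalences_def)

lemma Aut0_ob_linear_functor:
  assumes "F \<in> Aut0_ob"
  shows "linear_functor F"
  unfolding linear_functor_def
proof (intro conjI ballI)
  show "is_functor (Vec K) (Vec K) (FOb F) (FAr F)"
    using Aut0_ob_monoidal[OF assms] by (simp add: monoidal_functors_def)
  show "linear_on_arrows (Vec K) (FAr F)"
    using assms by (simp add: Aut0_ob_iff tensor_autoequivalences_def)
  show "FOb F (delta k) = delta k" if "k \<in> carrier K" for k
    using assms that by (intro isomorphic_delta) (auto simp: Aut0_ob_iff)
qed

section \<open>Scalars of tensor structures and of monoidal transformations on lines\<close>

definition tens_coeff :: "('k gvs, 'k gmap, 'k gvs, 'k gmap) mfun \<Rightarrow> 'k \<Rightarrow> 'k \<Rightarrow> complex" where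
  "tens_coeff F k l = entry (FTens F (delta k, delta l))"

lemma iso_scale_nonzero:
  assumes "k \<in> carrier K" "f \<in> arr (delta k) (delta k)" "iso_arrow (Vec K) f"
  shows "entry f \<noteq> 0"
proof -
  obtain g where g: "g \<in> arr (delta k) (delta k)" "g \<star> f = idn (delta k)"
    using assms iso_arrow_iff[OF assms(2)] by auto
  have i: "idn (delta k) \<in> arr (delta k) (delta k)" using assms(1) by auto
  have "g \<star> f = scale (entry g) (idn (delta k)) \<star> scale (entry f) (idn (delta k))"
    using arr_delta[OF g(1)] arr_delta[OF assms(2)] by simp
  also have "\<dots> = scale (entry g * entry f) (idn (delta k))"
    using i by (simp add: scale_comp[of _ "delta k" "delta k"] scale_scale mult.commute)
  finally have "entry (idn (delta k)) = entry g * entry f" using g(2) entry_scale by metis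
  moreover have "entry (idn (delta k)) = 1" using entry_scale[of 1 k] by simp
  ultimately show ?thesis by auto
qed

lemma FTens_in:
  assumes "F \<in> Aut0_ob" "X \<in> obj" "Y \<in> obj"
  shows "FTens F (X, Y) \<in> arr (FOb F X \<boxdot> FOb F Y) (FOb F (X \<boxdot> Y))" "iso_arrow (Vec K) (FTens F (X, Y))"
  using Aut0_ob_monoidal[OF assms(1)] assms(2,3) by (auto simp: monoidal_functors_def)

lemma FTens_delta:
  assumes F: "F \<in> Aut0_ob" and kl: "k \<in> carrier K" "l \<in> carrier K"
  shows "FTens F (delta k, delta l) = scale (tens_coeff F k l) (idn (delta (k \<otimes> l)))" "tens_coeff F k l \<noteq> 0"
proof -
  have "FTens F (delta k, delta l) \<in> arr (delta (k \<otimes> l)) (delta (k \<otimes> l))"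
    using FTens_in(1)[OF F delta_obj[OF kl(1)] delta_obj[OF kl(2)]] kl
    by (simp add: linear_functor_delta[OF Aut0_ob_linear_functor[OF F]] tensO_delta)
  note * = this
  show "FTens F (delta k, delta l) = scale (tens_coeff F k l) (idn (delta (k \<otimes> l)))"
    using arr_delta[OF *] by (simp add: tens_coeff_def)
  show "tens_coeff F k l \<noteq> 0"
    unfolding tens_coeff_def using kl FTens_in(2)[OF F] by (intro iso_scale_nonzero[OF _ *]) auto
qed

lemma FTens_natural:
  assumes F: "F \<in> Aut0_ob" and f: "f \<in> arr X X'" and g: "g \<in> arr Y Y'"
  shows "FAr F (f \<boxtimes> g) \<star> FTens F (X, Y) = FTens F (X', Y') \<star> (FAr F f \<boxtimes> FAr F g)"
proof -
  have "\<forall>f\<in>gvs_arrows K. \<forall>g\<in>gvs_arrows K. FAr F (f \<boxtimes> g) \<star> FTens F (Dm (Vec K) f, Dm (Vec K) g) =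
     FTens F (Cd (Vec K) f, Cd (Vec K) g) \<star> (FAr F f \<boxtimes> FAr F g)"
    using Aut0_ob_monoidal[OF F] by (simp add: monoidal_functors_def)
  then show ?thesis using arrD[OF f] arrD[OF g] by metis
qed

text \<open>Naturality moves the tensor structure from \<open>(X, Y)\<close> to a pair of lines,
  where it is a scalar.\<close>

lemma FTens_comp:
  assumes F: "F \<in> Aut0_ob" and kl: "k \<in> carrier K" "l \<in> carrier K" and x: "x \<in> arr (delta k) X" and y: "y \<in> arr (delta l) Y"
  shows "FTens F (X, Y) \<star> (FAr F x \<boxtimes> FAr F y) = scale (tens_coeff F k l) (FAr F (x \<boxtimes> y))"
proof -
  note L = Aut0_ob_linear_functor[OF F]
  have "FAr F (x \<boxtimes> y) \<in> arr (delta (k \<otimes> l)) (FOb F (X \<boxdot> Y))"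
    using linear_functor_in[OF L tens_in[OF x y]] kl by (simp add: tensO_delta linear_functor_delta[OF L])
  then have "FAr F (x \<boxtimes> y) \<star> FTens F (delta k, delta l) = scale (tens_coeff F k l) (FAr F (x \<boxtimes> y))"
    using kl by (simp add: FTens_delta[OF F] scale_comp[of _ "delta (k \<otimes> l)" _ _ "delta (k \<otimes> l)"])
  then show ?thesis using FTens_natural[OF F x y] by simp
qed

lemma scale_idn_comp:
  "k \<in> carrier K \<Longrightarrow> scale c (idn (delta k)) \<star> scale d (idn (delta k)) = scale (c * d) (idn (delta k))"
  by (simp add: scale_comp[of _ "delta k" "delta k" _ "delta k"] comp_idn(1)[of _ "delta k" "delta k"] scale_scale mult.commute)

lemma scale_idn_tens:
  "k \<in> carrier K \<Longrightarrow> l \<in> carrier K \<Longrightarrow> scale c (idn (delta k)) \<boxtimes> scale d (idn (delta l)) = scale (c * d) (idn (delta (k \<otimes> l)))"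
  by (simp add: scale_tens tens_idn tensO_delta)

lemma scale_idn_tens_idn:
  assumes "k \<in> carrier K" "l \<in> carrier K"
  shows "scale c (idn (delta k)) \<boxtimes> idn (delta l) = scale c (idn (delta (k \<otimes> l)))"
    "idn (delta k) \<boxtimes> scale c (idn (delta l)) = scale c (idn (delta (k \<otimes> l)))"
  using scale_idn_tens[OF assms, of c 1] scale_idn_tens[OF assms, of 1 c] by simp_all

lemma scale_idn_comp_idn:
  "k \<in> carrier K \<Longrightarrow> scale c (idn (delta k)) \<star> idn (delta k) = scale c (idn (delta k))"
  "k \<in> carrier K \<Longrightarrow> idn (delta k) \<star> scale c (idn (delta k)) = scale c (idn (delta k))"
  using scale_idn_comp[of k c 1] scale_idn_comp[of k 1 c] by simp_all

lemma scale_idn_inj: "scale c (idn (delta k)) = scale d (idn (delta k)) \<longleftrightarrow> c = d"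
  by (metis entry_scale)

lemma linear_functor_scale_idn: "linear_functor F \<Longrightarrow> k \<in> carrier K \<Longrightarrow> FAr F (scale c (idn (delta k))) = scale c (idn (delta k))"
  by (intro linear_functor_delta_arr) auto

text \<open>Turns an equation between arrows built from lines into an equation between complex
  numbers.\<close>

lemmas delta_simps = scale_idn_comp scale_idn_tens scale_idn_tens_idn scale_idn_comp_idn scale_idn_inj linear_functor_scale_idn
  linear_functor_delta linear_functor_idn tensO_delta tens_idn

lemma tens_coeff_cocycle:
  assumes F: "F \<in> Aut0_ob" and k: "k \<in> carrier K" "l \<in> carrier K" "m \<in> carrier K"
  shows "tens_coeff F (k \<otimes> l) m * tens_coeff F k l = tens_coeff F k (l \<otimes> m) * tens_coeff F l m"
proof -
  note L = Aut0_ob_linear_functor[OF F]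
  have "\<forall>X\<in>obj. \<forall>Y\<in>obj. \<forall>Z\<in>obj.
     FAr F (idn (X \<boxdot> Y \<boxdot> Z)) \<star> (FTens F (X \<boxdot> Y, Z) \<star> (FTens F (X, Y) \<boxtimes> idn (FOb F Z))) =
     FTens F (X, Y \<boxdot> Z) \<star> (idn (FOb F X) \<boxtimes> FTens F (Y, Z) \<star> idn (FOb F X \<boxdot> FOb F Y \<boxdot> FOb F Z))"
    using Aut0_ob_monoidal[OF F] by (simp add: monoidal_functors_def)
  from this[THEN bspec, OF delta_obj[OF k(1)], THEN bspec, OF delta_obj[OF k(2)], THEN bspec, OF delta_obj[OF k(3)]]
  show ?thesis using k L by (simp add: delta_simps FTens_delta[OF F] m_assoc)
qed

text \<open>The left unit axiom at the unit object says that the scalar of \<open>FUnt F\<close>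
  times the tensor coefficient at \<open>(\<one>, \<one>)\<close> is 1, so the unit isomorphism is
  no independent datum.\<close>

lemma FUnt_delta:
  assumes F: "F \<in> Aut0_ob"
  shows "FUnt F = scale (inverse (tens_coeff F \<one> \<one>)) (idn (delta \<one>))"
proof -
  note L = Aut0_ob_linear_functor[OF F]
  have "FUnt F \<in> arr (delta \<one>) (delta \<one>)"
    using Aut0_ob_monoidal[OF F] by (auto simp: monoidal_functors_def linear_functor_delta[OF L])
  then have U: "FUnt F = scale (entry (FUnt F)) (idn (delta \<one>))" by (rule arr_delta)
  have "\<forall>X\<in>obj. FAr F (idn X) \<star> (FTens F (delta \<one>, X) \<star> (FUnt F \<boxtimes> idn (FOb F X))) = idn (FOb F X)"
    using Aut0_ob_monoidal[OF F] by (simp add: monoidal_functors_def)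
  from this[THEN bspec, OF delta_obj[OF one_closed]]
  have "scale (tens_coeff F \<one> \<one> * entry (FUnt F)) (idn (delta \<one>)) = scale 1 (idn (delta \<one>))"
    by (subst (asm) U) (simp add: delta_simps L FTens_delta[OF F])
  then have "tens_coeff F \<one> \<one> * entry (FUnt F) = 1" by (simp only: delta_simps)
  then have "entry (FUnt F) = inverse (tens_coeff F \<one> \<one>)" by (metis inverse_unique)
  then show ?thesis using U by simp
qed

lemma monoidal_nat_iso_D:
  assumes "monoidal_nat_iso (Vec K) (Vec K) F G \<alpha>"
  shows "X \<in> obj \<Longrightarrow> \<alpha> X \<in> arr (FOb F X) (FOb G X)"
    "X \<in> obj \<Longrightarrow> iso_arrow (Vec K) (\<alpha> X)"
    "f \<in> arr X Y \<Longrightarrow> \<alpha> Y \<star> FAr F f = FAr G f \<star> \<alpha> X"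
    "X \<in> obj \<Longrightarrow> Y \<in> obj \<Longrightarrow> \<alpha> (X \<boxdot> Y) \<star> FTens F (X, Y) = FTens G (X, Y) \<star> (\<alpha> X \<boxtimes> \<alpha> Y)"
    "\<alpha> \<in> extensional obj"
proof -
  have "\<forall>f\<in>gvs_arrows K. \<alpha> (Cd (Vec K) f) \<star> FAr F f = FAr G f \<star> \<alpha> (Dm (Vec K) f)"
    using assms by (simp add: monoidal_nat_iso_def nat_iso_def)
  then show "f \<in> arr X Y \<Longrightarrow> \<alpha> Y \<star> FAr F f = FAr G f \<star> \<alpha> X" using arrD[of f X Y] by auto
qed (use assms in \<open>auto simp: monoidal_nat_iso_def nat_iso_def PiE_def\<close>)

definition trans_coeff :: "('k gvs \<Rightarrow> 'k gmap) \<Rightarrow> 'k \<Rightarrow> complex" where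
  "trans_coeff \<alpha> k = entry (\<alpha> (delta k))"

lemma monoidal_nat_iso_delta:
  assumes \<alpha>: "monoidal_nat_iso (Vec K) (Vec K) F G \<alpha>" and F: "linear_functor F" and G: "linear_functor G" and k: "k \<in> carrier K"
  shows "\<alpha> (delta k) = scale (trans_coeff \<alpha> k) (idn (delta k))" "trans_coeff \<alpha> k \<noteq> 0"
proof -
  have *: "\<alpha> (delta k) \<in> arr (delta k) (delta k)"
    using monoidal_nat_iso_D(1)[OF \<alpha> delta_obj[OF k]] k F G by (simp add: linear_functor_delta)
  show "\<alpha> (delta k) = scale (trans_coeff \<alpha> k) (idn (delta k))" using arr_delta[OF *] by (simp add: trans_coeff_def)
  show "trans_coeff \<alpha> k \<noteq> 0" unfolding trans_coeff_def using monoidal_nat_iso_D(2)[OF \<alpha> delta_obj[OF k]] by (rule iso_scale_nonzero[OF k *])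
qed

lemma monoidal_nat_iso_tens_coeff:
  assumes \<alpha>: "monoidal_nat_iso (Vec K) (Vec K) F G \<alpha>" and F: "F \<in> Aut0_ob" and G: "G \<in> Aut0_ob"
    and k: "k \<in> carrier K" "l \<in> carrier K"
  shows "trans_coeff \<alpha> (k \<otimes> l) * tens_coeff F k l = tens_coeff G k l * trans_coeff \<alpha> k * trans_coeff \<alpha> l"
  using monoidal_nat_iso_D(4)[OF \<alpha> delta_obj[OF k(1)] delta_obj[OF k(2)]] k
  by (simp add: delta_simps FTens_delta[OF F] FTens_delta[OF G] monoidal_nat_iso_delta(1)[OF \<alpha> Aut0_ob_linear_functor[OF F] Aut0_ob_linear_functor[OF G]] mult.assoc)

lemma monoidal_nat_iso_comp:
  assumes \<alpha>: "monoidal_nat_iso (Vec K) (Vec K) F G \<alpha>" and F: "linear_functor F" and G: "linear_functor G" and k: "k \<in> carrier K"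
    and x: "x \<in> arr (delta k) X"
  shows "\<alpha> X \<star> FAr F x = scale (trans_coeff \<alpha> k) (FAr G x)"
proof -
  have "FAr G x \<in> arr (delta k) (FOb G X)" using linear_functor_in[OF G x] G k by (simp add: linear_functor_delta)
  then show ?thesis
    using monoidal_nat_iso_D(3)[OF \<alpha> x] k by (simp add: monoidal_nat_iso_delta(1)[OF \<alpha> F G k] scale_comp[of _ "delta k" _ _ "delta k"])
qed

text \<open>\<open>F\<close> fixes the scalar that \<open>G\<close> contributes on a line, so the
  coefficients simply multiply.\<close>

lemma tens_coeff_fun_comp:
  assumes F: "F \<in> Aut0_ob" and G: "G \<in> Aut0_ob" and k: "k \<in> carrier K" "l \<in> carrier K"
  shows "tens_coeff (fun_comp F G) k l = tens_coeff F k l * tens_coeff G k l"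
proof -
  have "FTens (fun_comp F G) (delta k, delta l) = scale (tens_coeff F k l * tens_coeff G k l) (idn (delta (k \<otimes> l)))"
    using k F G by (simp add: FTens_delta Aut0_ob_linear_functor delta_simps mult.commute)
  then show ?thesis by (simp add: tens_coeff_def)
qed

text \<open>By \<open>epi2\<close>, compatibility with the tensor structures needs testing on pairs
  of lines only, and there it is the relation \<open>eq\<close>.\<close>

lemma glue_monoidal:
  assumes F: "F \<in> Aut0_ob" and G: "G \<in> Aut0_ob" and \<theta>: "\<And>k. k \<in> carrier K \<Longrightarrow> \<theta> k \<noteq> 0"
    and eq: "\<And>k l. k \<in> carrier K \<Longrightarrow> l \<in> carrier K \<Longrightarrow> \<theta> (k \<otimes> l) * tens_coeff F k l = tens_coeff G k l * \<theta> k * \<theta> l"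
  shows "monoidal_nat_iso (Vec K) (Vec K) F G (\<lambda>X\<in>obj. glue \<theta> F G X)"
  unfolding monoidal_nat_iso_def
proof (intro conjI ballI)
  note LF = Aut0_ob_linear_functor[OF F] and LG = Aut0_ob_linear_functor[OF G]
  show "nat_iso (Vec K) (Vec K) (FOb F) (FAr F) (FOb G) (FAr G) (\<lambda>X\<in>obj. glue \<theta> F G X)"
    using \<theta> by (rule glue_nat_iso[OF LF LG])
  \<comment> \<open>The unit condition is the case \<open>k = l = \<one>\<close> with one factor
    \<open>\<theta> \<one>\<close> cancelled, since unit scalars are inverse tensor
    coefficients.\<close>
  have "\<theta> \<one> * tens_coeff F \<one> \<one> = tens_coeff G \<one> \<one> * \<theta> \<one> * \<theta> \<one>" using eq[of \<one> \<one>] by simp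
  then have "\<theta> \<one> * inverse (tens_coeff F \<one> \<one>) = inverse (tens_coeff G \<one> \<one>)"
    using \<theta>[of \<one>] FTens_delta(2)[OF F, of \<one> \<one>] FTens_delta(2)[OF G, of \<one> \<one>] by (simp add: field_simps)
  then show "(\<lambda>X\<in>obj. glue \<theta> F G X) (Unt (Vec K)) \<star> FUnt F = FUnt G"
    by (simp add: FUnt_delta[OF F] FUnt_delta[OF G] glue_delta[OF LF LG] delta_simps)
  fix X Y assume "X \<in> Ob (Vec K)" "Y \<in> Ob (Vec K)"
  then have X: "X \<in> obj" and Y: "Y \<in> obj" by auto
  have "glue \<theta> F G (X \<boxdot> Y) \<star> FTens F (X, Y) = FTens G (X, Y) \<star> (glue \<theta> F G X \<boxtimes> glue \<theta> F G Y)"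
  proof (rule epi2[OF LF X Y])
    note t = glue_in[OF LF LG tensO_obj[OF X Y], of \<theta>] and tX = glue_in[OF LF LG X, of \<theta>] and tY = glue_in[OF LF LG Y, of \<theta>]
    note fF = FTens_in(1)[OF F X Y] and fG = FTens_in(1)[OF G X Y]
    show "glue \<theta> F G (X \<boxdot> Y) \<star> FTens F (X, Y) \<in> arr (FOb F X \<boxdot> FOb F Y) (FOb G (X \<boxdot> Y))"
      using t fF by auto
    show "FTens G (X, Y) \<star> (glue \<theta> F G X \<boxtimes> glue \<theta> F G Y) \<in> arr (FOb F X \<boxdot> FOb F Y) (FOb G (X \<boxdot> Y))"
      using tX tY fG by auto
    fix k l x y assume kl: "k \<in> carrier K" "l \<in> carrier K" and x: "x \<in> arr (delta k) X" and y: "y \<in> arr (delta l) Y"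
    note Fx = linear_functor_in[OF LF x] and Fy = linear_functor_in[OF LF y] and Gx = linear_functor_in[OF LG x] and Gy = linear_functor_in[OF LG y]
    have xy: "x \<boxtimes> y \<in> arr (delta (k \<otimes> l)) (X \<boxdot> Y)" using tens_in[OF x y] kl by (simp add: tensO_delta)
    have "glue \<theta> F G (X \<boxdot> Y) \<star> FTens F (X, Y) \<star> (FAr F x \<boxtimes> FAr F y) =
        scale (tens_coeff F k l) (scale (\<theta> (k \<otimes> l)) (FAr G (x \<boxtimes> y)))"
      using comp_assoc[OF t fF tens_in[OF Fx Fy]] FTens_comp[OF F kl x y] scale_comp(2)[OF t linear_functor_in[OF LF xy]]
        glue_comp[OF LF LG _ xy] kl by simp
    also have "\<dots> = scale (tens_coeff G k l * \<theta> k * \<theta> l) (FAr G (x \<boxtimes> y))"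
      using eq[OF kl] by (simp add: scale_scale mult.commute)
    also have "\<dots> = scale (\<theta> k * \<theta> l) (FTens G (X, Y) \<star> (FAr G x \<boxtimes> FAr G y))"
      using FTens_comp[OF G kl x y] by (simp add: scale_scale mult_ac)
    also have "\<dots> = FTens G (X, Y) \<star> ((glue \<theta> F G X \<star> FAr F x) \<boxtimes> (glue \<theta> F G Y \<star> FAr F y))"
      using glue_comp[OF LF LG kl(1) x] glue_comp[OF LF LG kl(2) y] scale_comp(2)[OF fG tens_in[OF Gx Gy]]
      by (simp add: scale_tens)
    also have "\<dots> = FTens G (X, Y) \<star> (glue \<theta> F G X \<boxtimes> glue \<theta> F G Y) \<star> (FAr F x \<boxtimes> FAr F y)"
      using comp_assoc[OF fG tens_in[OF tX tY] tens_in[OF Fx Fy]] interchange[OF tX Fx tY Fy] by simp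
    finally show "glue \<theta> F G (X \<boxdot> Y) \<star> FTens F (X, Y) \<star> (FAr F x \<boxtimes> FAr F y) =
       FTens G (X, Y) \<star> (glue \<theta> F G X \<boxtimes> glue \<theta> F G Y) \<star> (FAr F x \<boxtimes> FAr F y)" .
  qed
  then show "(\<lambda>X\<in>obj. glue \<theta> F G X) (TensO (Vec K) X Y) \<star> FTens F (X, Y) =
     FTens G (X, Y) \<star> ((\<lambda>X\<in>obj. glue \<theta> F G X) X \<boxtimes> (\<lambda>X\<in>obj. glue \<theta> F G X) Y)"
    using X Y by simp
qed

end

section \<open>Cochains of an action\<close>

text \<open>Written without division: \<open>\<omega>\<close> is \<open>\<omega>'\<close> times the
  K-coboundary of \<open>\<theta>\<close>, and \<open>\<eta>\<close> is \<open>\<eta>'\<close> times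
  the Q-coboundary of the same \<open>\<theta>\<close>. In the double complex of \<open>Q\<close>
  and \<open>K\<close> the two pairs differ by a total coboundary, up to the sign
  convention.\<close>

definition cohomologous ::
  "('q, 'a) monoid_scheme \<Rightarrow> ('k, 'b) monoid_scheme \<Rightarrow>
   ('q \<Rightarrow> 'k \<Rightarrow> 'k \<Rightarrow> complex) \<Rightarrow> ('k \<Rightarrow> 'q \<Rightarrow> 'q \<Rightarrow> complex) \<Rightarrow>
   ('q \<Rightarrow> 'k \<Rightarrow> 'k \<Rightarrow> complex) \<Rightarrow> ('k \<Rightarrow> 'q \<Rightarrow> 'q \<Rightarrow> complex) \<Rightarrow> bool" where
  "cohomologous Q K \<omega> \<eta> \<omega>' \<eta>' \<longleftrightarrow> (\<exists>\<theta>.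
     (\<forall>q\<in>carrier Q. \<forall>k\<in>carrier K. \<theta> q k \<noteq> 0) \<and>
     (\<forall>q\<in>carrier Q. \<forall>k\<in>carrier K. \<forall>l\<in>carrier K.
        \<theta> q (k \<otimes>\<^bsub>K\<^esub> l) * \<omega> q k l = \<omega>' q k l * \<theta> q k * \<theta> q l) \<and>
     (\<forall>k\<in>carrier K. \<forall>q\<in>carrier Q. \<forall>r\<in>carrier Q.
        \<theta> (q \<otimes>\<^bsub>Q\<^esub> r) k * \<eta> k q r = \<eta>' k q r * \<theta> q k * \<theta> r k))"

text \<open>Finiteness sits on the grading group, whose degrees are summed over; the locale is
  interpreted a second time with the two groups exchanged.\<close>

locale group_pair = fin_group K + Q: group Q
  for K :: "('k, 'b) monoid_scheme" (structure) and Q :: "('q, 'a) monoid_scheme"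
begin

lemma disc_simps [simp]:
  "Ob (disc Q) = carrier Q" "Ar (disc Q) = carrier Q" "Dm (disc Q) x = x" "Cd (disc Q) x = x"
  "Idn (disc Q) x = x" "Cmp (disc Q) x y = y" "TensO (disc Q) x y = x \<otimes>\<^bsub>Q\<^esub> y" "TensA (disc Q) x y = x \<otimes>\<^bsub>Q\<^esub> y"
  "Unt (disc Q) = \<one>\<^bsub>Q\<^esub>" "Assc (disc Q) x y z = x \<otimes>\<^bsub>Q\<^esub> y \<otimes>\<^bsub>Q\<^esub> z" "LUnt (disc Q) x = x" "RUnt (disc Q) x = x"
  by (simp_all add: disc_def)

abbreviation acts where "acts \<equiv> monoidal_functors (disc Q) Aut0"

text \<open>The differentials with denominators cleared. In this form the conditions match what the
  coherence axioms give on lines.\<close>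

lemma cocycle_conditions_iff:
  assumes "nonvanishing Q K \<omega>" "nonvanishing K Q \<eta>"
  shows "cocycle_conditions Q K \<omega> \<eta> \<longleftrightarrow>
     (\<forall>q\<in>carrier Q. \<forall>r\<in>carrier Q. \<forall>k\<in>carrier K. \<forall>l\<in>carrier K.
        \<eta> (k \<otimes> l) q r * (\<omega> q k l * \<omega> r k l) = \<omega> (q \<otimes>\<^bsub>Q\<^esub> r) k l * \<eta> k q r * \<eta> l q r) \<and>
     (\<forall>q\<in>carrier Q. \<forall>k\<in>carrier K. \<forall>l\<in>carrier K. \<forall>m\<in>carrier K.
        \<omega> q (k \<otimes> l) m * \<omega> q k l = \<omega> q k (l \<otimes> m) * \<omega> q l m) \<and>
     (\<forall>k\<in>carrier K. \<forall>q\<in>carrier Q. \<forall>r\<in>carrier Q. \<forall>s\<in>carrier Q.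
        \<eta> k (q \<otimes>\<^bsub>Q\<^esub> r) s * \<eta> k q r = \<eta> k q (r \<otimes>\<^bsub>Q\<^esub> s) * \<eta> k r s)"
proof -
  have nz: "\<omega> q k l \<noteq> 0" "\<eta> k q r \<noteq> 0"
    if "q \<in> carrier Q" "r \<in> carrier Q" "k \<in> carrier K" "l \<in> carrier K" for q r k l
    using assms that by (auto simp: nonvanishing_def)
  have 1: "cobd1 Q (\<lambda>q. \<omega> q k l) q r = cobd1 K (\<lambda>k. \<eta> k q r) k l \<longleftrightarrow>
     \<eta> (k \<otimes> l) q r * (\<omega> q k l * \<omega> r k l) = \<omega> (q \<otimes>\<^bsub>Q\<^esub> r) k l * \<eta> k q r * \<eta> l q r"
    if "q \<in> carrier Q" "r \<in> carrier Q" "k \<in> carrier K" "l \<in> carrier K" for q r k l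
    using that by (auto simp: cobd1_def nz divide_simps) (auto simp: mult_ac)
  have 2: "cobd2 K (\<omega> q) k l m = 1 \<longleftrightarrow> \<omega> q (k \<otimes> l) m * \<omega> q k l = \<omega> q k (l \<otimes> m) * \<omega> q l m"
    if "q \<in> carrier Q" "k \<in> carrier K" "l \<in> carrier K" "m \<in> carrier K" for q k l m
    using that by (auto simp: cobd2_def nz divide_simps) (auto simp: mult_ac)
  have 3: "cobd2 Q (\<eta> k) q r s = 1 \<longleftrightarrow> \<eta> k (q \<otimes>\<^bsub>Q\<^esub> r) s * \<eta> k q r = \<eta> k q (r \<otimes>\<^bsub>Q\<^esub> s) * \<eta> k r s"
    if "k \<in> carrier K" "q \<in> carrier Q" "r \<in> carrier Q" "s \<in> carrier Q" for k q r s
    using that by (auto simp: cobd2_def nz divide_simps) (auto simp: mult_ac)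
  show ?thesis unfolding cocycle_conditions_def by (simp add: 1 2 3 cong: ball_cong)
qed

definition omega_of :: "('q, 'q, ('k gvs, 'k gmap, 'k gvs, 'k gmap) mfun, ('k gvs, 'k gmap) mtrans) mfun \<Rightarrow>
    'q \<Rightarrow> 'k \<Rightarrow> 'k \<Rightarrow> complex" where
  "omega_of F q k l = tens_coeff (FOb F q) k l"

definition tens_trans :: "('q, 'q, ('k gvs, 'k gmap, 'k gvs, 'k gmap) mfun, ('k gvs, 'k gmap) mtrans) mfun \<Rightarrow>
    'q \<Rightarrow> 'q \<Rightarrow> 'k gvs \<Rightarrow> 'k gmap" where
  "tens_trans F q r = fst (snd (FTens F (q, r)))"

definition unit_trans :: "('q, 'q, ('k gvs, 'k gmap, 'k gvs, 'k gmap) mfun, ('k gvs, 'k gmap) mtrans) mfun \<Rightarrow>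
    'k gvs \<Rightarrow> 'k gmap" where
  "unit_trans F = fst (snd (FUnt F))"

text \<open>The degree comes first, so that \<open>eta_of F\<close> has the shape of a family of
  tensor coefficients for the exchanged groups.\<close>

definition eta_of :: "('q, 'q, ('k gvs, 'k gmap, 'k gvs, 'k gmap) mfun, ('k gvs, 'k gmap) mtrans) mfun \<Rightarrow>
    'k \<Rightarrow> 'q \<Rightarrow> 'q \<Rightarrow> complex" where
  "eta_of F k q r = trans_coeff (tens_trans F q r) k"

lemma acts_Aut0_ob: "F \<in> acts \<Longrightarrow> q \<in> carrier Q \<Longrightarrow> FOb F q \<in> Aut0_ob"
  by (auto simp: monoidal_functors_def is_functor_def)

text \<open>All arrows of \<open>disc Q\<close> are identities, so functoriality leaves no choice on
  arrows.\<close>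

lemma acts_FAr:
  assumes F: "F \<in> acts" and q: "q \<in> carrier Q"
  shows "FAr F q = (FOb F q, (\<lambda>X\<in>obj. idn (FOb (FOb F q) X)), FOb F q)"
proof -
  have "\<forall>x\<in>carrier Q. FAr F (Idn (disc Q) x) = Idn Aut0 (FOb F x)"
    using F by (simp add: monoidal_functors_def is_functor_def)
  then show ?thesis using q by simp
qed

lemma acts_FTens:
  assumes F: "F \<in> acts" and q: "q \<in> carrier Q" "r \<in> carrier Q"
  shows "FTens F (q, r) = (fun_comp (FOb F q) (FOb F r), tens_trans F q r, FOb F (q \<otimes>\<^bsub>Q\<^esub> r))"
    "fun_comp (FOb F q) (FOb F r) \<in> Aut0_ob"
    "monoidal_nat_iso (Vec K) (Vec K) (fun_comp (FOb F q) (FOb F r)) (FOb F (q \<otimes>\<^bsub>Q\<^esub> r)) (tens_trans F q r)"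
proof -
  have "FTens F (q, r) \<in> arrows Aut0 (fun_comp (FOb F q) (FOb F r)) (FOb F (q \<otimes>\<^bsub>Q\<^esub> r))"
    using F q by (simp add: monoidal_functors_def)
  then show "FTens F (q, r) = (fun_comp (FOb F q) (FOb F r), tens_trans F q r, FOb F (q \<otimes>\<^bsub>Q\<^esub> r))"
    "fun_comp (FOb F q) (FOb F r) \<in> Aut0_ob"
    "monoidal_nat_iso (Vec K) (Vec K) (fun_comp (FOb F q) (FOb F r)) (FOb F (q \<otimes>\<^bsub>Q\<^esub> r)) (tens_trans F q r)"
    by (auto simp: Aut0_arr_iff tens_trans_def)
qed

lemma acts_FUnt:
  assumes F: "F \<in> acts"
  shows "FUnt F = (fun_id, unit_trans F, FOb F \<one>\<^bsub>Q\<^esub>)" "fun_id \<in> Aut0_ob"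
    "monoidal_nat_iso (Vec K) (Vec K) fun_id (FOb F \<one>\<^bsub>Q\<^esub>) (unit_trans F)"
proof -
  have "FUnt F \<in> arrows Aut0 fun_id (FOb F \<one>\<^bsub>Q\<^esub>)"
    using F by (simp add: monoidal_functors_def)
  then show "FUnt F = (fun_id, unit_trans F, FOb F \<one>\<^bsub>Q\<^esub>)" "fun_id \<in> Aut0_ob"
    "monoidal_nat_iso (Vec K) (Vec K) fun_id (FOb F \<one>\<^bsub>Q\<^esub>) (unit_trans F)"
    by (auto simp: Aut0_arr_iff unit_trans_def)
qed

lemma eta_of_FTens:
  assumes F: "F \<in> acts" and q: "q \<in> carrier Q" "r \<in> carrier Q" and k: "k \<in> carrier K"
  shows "tens_trans F q r (delta k) = scale (eta_of F k q r) (idn (delta k))" "eta_of F k q r \<noteq> 0"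
  using monoidal_nat_iso_delta[OF acts_FTens(3)[OF F q] Aut0_ob_linear_functor[OF acts_FTens(2)[OF F q]] Aut0_ob_linear_functor[OF acts_Aut0_ob[OF F Q.m_closed[OF q]]] k]
  by (simp_all add: eta_of_def)

lemma acts_nonvanishing:
  assumes F: "F \<in> acts"
  shows "nonvanishing Q K (omega_of F)" "nonvanishing K Q (eta_of F)"
  using eta_of_FTens(2)[OF F] FTens_delta(2)[OF acts_Aut0_ob[OF F]] by (auto simp: nonvanishing_def omega_of_def)

text \<open>The associativity axiom of the action is read at the line of degree \<open>k\<close>.
  The functors fix the line and its scalars, and the structural isomorphisms of \<open>Aut0\<close>
  are identities, so only the four values of \<open>eta_of F\<close> remain.\<close>

lemma eta_of_assoc:
  assumes F: "F \<in> acts" and q: "q \<in> carrier Q" "r \<in> carrier Q" "s \<in> carrier Q" and k: "k \<in> carrier K"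
  shows "eta_of F k (q \<otimes>\<^bsub>Q\<^esub> r) s * eta_of F k q r = eta_of F k q (r \<otimes>\<^bsub>Q\<^esub> s) * eta_of F k r s"
proof -
  have lf: "linear_functor (FOb F x)" if "x \<in> carrier Q" for x using Aut0_ob_linear_functor[OF acts_Aut0_ob[OF F that]] .
  have idA: "idn (delta k) \<in> gvs_arrows K" using arrD(1)[OF idn_in[OF delta_obj[OF k]]] .
  have "\<forall>q\<in>carrier Q. \<forall>r\<in>carrier Q. \<forall>s\<in>carrier Q.
    Cmp Aut0 (FAr F (q \<otimes>\<^bsub>Q\<^esub> r \<otimes>\<^bsub>Q\<^esub> s)) (Cmp Aut0 (FTens F (q \<otimes>\<^bsub>Q\<^esub> r, s)) (TensA Aut0 (FTens F (q, r)) (Idn Aut0 (FOb F s)))) =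
    Cmp Aut0 (FTens F (q, r \<otimes>\<^bsub>Q\<^esub> s)) (Cmp Aut0 (TensA Aut0 (Idn Aut0 (FOb F q)) (FTens F (r, s)))
       (Assc Aut0 (FOb F q) (FOb F r) (FOb F s)))"
    using F by (simp add: monoidal_functors_def del: Aut0_simps)
  from this[THEN bspec, OF q(1), THEN bspec, OF q(2), THEN bspec, OF q(3)]
  have "fst (snd (Cmp Aut0 (FAr F (q \<otimes>\<^bsub>Q\<^esub> r \<otimes>\<^bsub>Q\<^esub> s)) (Cmp Aut0 (FTens F (q \<otimes>\<^bsub>Q\<^esub> r, s)) (TensA Aut0 (FTens F (q, r)) (Idn Aut0 (FOb F s)))))) (delta k) =
    fst (snd (Cmp Aut0 (FTens F (q, r \<otimes>\<^bsub>Q\<^esub> s)) (Cmp Aut0 (TensA Aut0 (Idn Aut0 (FOb F q)) (FTens F (r, s)))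
       (Assc Aut0 (FOb F q) (FOb F r) (FOb F s))))) (delta k)" by simp
  moreover note FT = acts_FTens(1)[OF F]
  ultimately show ?thesis
    using q k idA eta_of_FTens(1)[OF F _ _ k] lf
    by (simp add: acts_FAr[OF F] FT[of "q \<otimes>\<^bsub>Q\<^esub> r" s] FT[of q r] FT[of q "r \<otimes>\<^bsub>Q\<^esub> s"] FT[of r s] delta_simps)
qed

text \<open>The left unit axiom of the action at the neutral element of \<open>Q\<close>, read on a
  line, forces the scalar of the unit transformation.\<close>

lemma eta_of_unit:
  assumes F: "F \<in> acts" and k: "k \<in> carrier K"
  shows "eta_of F k \<one>\<^bsub>Q\<^esub> \<one>\<^bsub>Q\<^esub> * trans_coeff (unit_trans F) k = 1"
    and "unit_trans F (delta k) = scale (inverse (eta_of F k \<one>\<^bsub>Q\<^esub> \<one>\<^bsub>Q\<^esub>)) (idn (delta k))"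
proof -
  let ?u = "unit_trans F"
  have lf: "linear_functor (FOb F x)" if "x \<in> carrier Q" for x using Aut0_ob_linear_functor[OF acts_Aut0_ob[OF F that]] .
  have u: "?u (delta k) = scale (trans_coeff ?u k) (idn (delta k))"
    using monoidal_nat_iso_delta(1)[OF acts_FUnt(3)[OF F] Aut0_ob_linear_functor[OF acts_FUnt(2)[OF F]] lf k] by simp
  have idA: "idn (delta k) \<in> gvs_arrows K" using arrD(1)[OF idn_in[OF delta_obj[OF k]]] .
  have "\<forall>q\<in>carrier Q. Cmp Aut0 (FAr F q) (Cmp Aut0 (FTens F (\<one>\<^bsub>Q\<^esub>, q)) (TensA Aut0 (FUnt F) (Idn Aut0 (FOb F q)))) =
    LUnt Aut0 (FOb F q)"
    using F by (simp add: monoidal_functors_def del: Aut0_simps)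
  from this[THEN bspec, OF Q.one_closed]
  have "fst (snd (Cmp Aut0 (FAr F \<one>\<^bsub>Q\<^esub>) (Cmp Aut0 (FTens F (\<one>\<^bsub>Q\<^esub>, \<one>\<^bsub>Q\<^esub>)) (TensA Aut0 (FUnt F) (Idn Aut0 (FOb F \<one>\<^bsub>Q\<^esub>)))))) (delta k) =
    fst (snd (LUnt Aut0 (FOb F \<one>\<^bsub>Q\<^esub>))) (delta k)" by (simp del: Aut0_simps)
  then have "scale (eta_of F k \<one>\<^bsub>Q\<^esub> \<one>\<^bsub>Q\<^esub> * trans_coeff ?u k) (idn (delta k)) = scale 1 (idn (delta k))"
    using k idA eta_of_FTens(1)[OF F _ _ k] lf u
    by (subst (asm) acts_FUnt(1)[OF F])
       (simp add: acts_FAr[OF F] acts_FTens(1)[OF F, of "\<one>\<^bsub>Q\<^esub>" "\<one>\<^bsub>Q\<^esub>"] delta_simps)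
  then show 1: "eta_of F k \<one>\<^bsub>Q\<^esub> \<one>\<^bsub>Q\<^esub> * trans_coeff ?u k = 1" by (simp only: delta_simps)
  show "?u (delta k) = scale (inverse (eta_of F k \<one>\<^bsub>Q\<^esub> \<one>\<^bsub>Q\<^esub>)) (idn (delta k))"
    using u inverse_unique[OF 1] by simp
qed

text \<open>The mixed condition says that the composition isomorphisms are monoidal. The condition
  on \<open>omega_of F\<close> is the associativity axiom of each single functor, and that on
  \<open>eta_of F\<close> the associativity axiom of the action.\<close>

lemma acts_cocycle:
  assumes F: "F \<in> acts"
  shows "cocycle_conditions Q K (omega_of F) (eta_of F)"
proof -
  have "eta_of F (k \<otimes> l) q r * (omega_of F q k l * omega_of F r k l) = omega_of F (q \<otimes>\<^bsub>Q\<^esub> r) k l * eta_of F k q r * eta_of F l q r"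
    if q: "q \<in> carrier Q" "r \<in> carrier Q" and k: "k \<in> carrier K" "l \<in> carrier K" for q r k l
    using monoidal_nat_iso_tens_coeff[OF acts_FTens(3)[OF F q] acts_FTens(2)[OF F q] acts_Aut0_ob[OF F Q.m_closed[OF q]] k]
    by (simp add: tens_coeff_fun_comp[OF acts_Aut0_ob[OF F q(1)] acts_Aut0_ob[OF F q(2)] k] omega_of_def eta_of_def)
  then show ?thesis
    using eta_of_assoc[OF F] tens_coeff_cocycle[OF acts_Aut0_ob[OF F]]
    by (simp add: cocycle_conditions_iff[OF acts_nonvanishing[OF F]] omega_of_def)
qed

text \<open>The witness \<open>\<theta> q k\<close> is the scalar of the component
  \<open>a q\<close> on the line of degree \<open>k\<close>. That \<open>a q\<close> is monoidal
  gives the relation for \<open>\<omega>\<close>; compatibility with the composition isomorphisms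
  gives the one for \<open>\<eta>\<close>.\<close>

lemma equiv_cohomologous:
  assumes FG: "(F, G) \<in> mfun_equiv (disc Q) Aut0"
  shows "cohomologous Q K (omega_of F) (eta_of F) (omega_of G) (eta_of G)"
proof -
  obtain a where F: "F \<in> acts" and G: "G \<in> acts" and a: "monoidal_nat_iso (disc Q) Aut0 F G a"
    using FG by (auto simp: mfun_equiv_def)
  define b where "b q = fst (snd (a q))" for q
  have *: "a q \<in> arrows Aut0 (FOb F q) (FOb G q)" if "q \<in> carrier Q" for q
    using a that by (simp add: monoidal_nat_iso_def nat_iso_def)
  have aq: "a q = (FOb F q, b q, FOb G q)"
    and b: "monoidal_nat_iso (Vec K) (Vec K) (FOb F q) (FOb G q) (b q)" if "q \<in> carrier Q" for q
    using *[OF that] by (auto simp: Aut0_arr_iff b_def)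
  have lF: "linear_functor (FOb F q)" and lG: "linear_functor (FOb G q)" if "q \<in> carrier Q" for q
    using Aut0_ob_linear_functor acts_Aut0_ob[OF F that] acts_Aut0_ob[OF G that] by auto
  note bdl = monoidal_nat_iso_delta[OF b lF lG]
  have "trans_coeff (b (q \<otimes>\<^bsub>Q\<^esub> r)) k * eta_of F k q r = eta_of G k q r * trans_coeff (b q) k * trans_coeff (b r) k"
    if q: "q \<in> carrier Q" "r \<in> carrier Q" and k: "k \<in> carrier K" for q r k
  proof -
    have "Cmp Aut0 (a (q \<otimes>\<^bsub>Q\<^esub> r)) (FTens F (q, r)) = Cmp Aut0 (FTens G (q, r)) (TensA Aut0 (a q) (a r))"
      using a q by (simp add: monoidal_nat_iso_def del: Aut0_simps)
    then have "fst (snd (Cmp Aut0 (a (q \<otimes>\<^bsub>Q\<^esub> r)) (FTens F (q, r)))) (delta k) =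
      fst (snd (Cmp Aut0 (FTens G (q, r)) (TensA Aut0 (a q) (a r)))) (delta k)" by simp
    then show ?thesis
      using q k bdl(1)[OF _ _ _ k] eta_of_FTens(1)[OF F q k] eta_of_FTens(1)[OF G q k] lF lG
      by (simp add: aq acts_FTens(1)[OF F q] acts_FTens(1)[OF G q] delta_simps mult.assoc)
  qed
  then show ?thesis
    unfolding cohomologous_def omega_of_def
    using bdl(2) monoidal_nat_iso_tens_coeff[OF b acts_Aut0_ob[OF F] acts_Aut0_ob[OF G]] by (intro exI[of _ "\<lambda>q. trans_coeff (b q)"]) auto
qed

text \<open>The right side is the horizontal composite of the glued transformations followed by the
  structure map of \<open>G\<close>. By \<open>epi_comp\<close> it suffices to look at images of
  arrows from lines under both functors, where each side is a multiple of one arrow and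
  \<open>eq\<close> compares the scalars.\<close>

lemma glue_FTens:
  assumes F: "F \<in> acts" and G: "G \<in> acts" and q: "q \<in> carrier Q" "r \<in> carrier Q" and X: "X \<in> obj"
    and eq: "\<And>k. k \<in> carrier K \<Longrightarrow>
       \<theta> (q \<otimes>\<^bsub>Q\<^esub> r) k * eta_of F k q r = eta_of G k q r * \<theta> q k * \<theta> r k"
  shows "glue (\<theta> (q \<otimes>\<^bsub>Q\<^esub> r)) (FOb F (q \<otimes>\<^bsub>Q\<^esub> r)) (FOb G (q \<otimes>\<^bsub>Q\<^esub> r)) X \<star> tens_trans F q r X =
    tens_trans G q r X \<star>
      (glue (\<theta> q) (FOb F q) (FOb G q) (FOb (FOb G r) X) \<star> FAr (FOb F q) (glue (\<theta> r) (FOb F r) (FOb G r) X))"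
proof -
  have lF: "linear_functor (FOb F q)" and lG: "linear_functor (FOb G q)" if "q \<in> carrier Q" for q
    using Aut0_ob_linear_functor acts_Aut0_ob[OF F that] acts_Aut0_ob[OF G that] by auto
  have qr: "q \<otimes>\<^bsub>Q\<^esub> r \<in> carrier Q" using q by simp
  let ?F = "\<lambda>q. FOb F q" and ?G = "\<lambda>q. FOb G q" and ?n = "\<lambda>q. glue (\<theta> q) (FOb F q) (FOb G q)"
  let ?a = "tens_trans F q r" and ?b = "tens_trans G q r"
  have lFF: "linear_functor (fun_comp (?F q) (?F r))" and lGG: "linear_functor (fun_comp (?G q) (?G r))"
    using Aut0_ob_linear_functor acts_FTens(2)[OF F q] acts_FTens(2)[OF G q] by auto
  have aX: "?a X \<in> arr (FOb (?F q) (FOb (?F r) X)) (FOb (?F (q \<otimes>\<^bsub>Q\<^esub> r)) X)"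
    using monoidal_nat_iso_D(1)[OF acts_FTens(3)[OF F q] X] X by simp
  have bX: "?b X \<in> arr (FOb (?G q) (FOb (?G r) X)) (FOb (?G (q \<otimes>\<^bsub>Q\<^esub> r)) X)"
    using monoidal_nat_iso_D(1)[OF acts_FTens(3)[OF G q] X] X by simp
  have GX: "FOb (?G r) X \<in> obj" using linear_functor_obj[OF lG[OF q(2)] X] .
  note n1 = glue_in[OF lF[OF qr] lG[OF qr] X, of "\<theta> (q \<otimes>\<^bsub>Q\<^esub> r)"]
  note n2 = glue_in[OF lF[OF q(1)] lG[OF q(1)] GX, of "\<theta> q"]
  note n3 = glue_in[OF lF[OF q(2)] lG[OF q(2)] X, of "\<theta> r"]
  note Fn3 = linear_functor_in[OF lF[OF q(1)] n3]
  show ?thesis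
  proof (rule epi_comp[OF lF[OF q(1)] lF[OF q(2)] X comp_in[OF n1 aX] comp_in[OF bX comp_in[OF n2 Fn3]]])
    fix k x assume k: "k \<in> carrier K" and x: "x \<in> arr (delta k) X"
    have xA: "x \<in> gvs_arrows K" using arrD(1)[OF x] .
    let ?Fx = "FAr (?F q) (FAr (?F r) x)"
    note Frx = linear_functor_in[OF lF[OF q(2)] x] and Grx = linear_functor_in[OF lG[OF q(2)] x]
    \<comment> \<open>Since \<open>G\<close> at \<open>r\<close> fixes lines, the image of
      \<open>x\<close> again starts at the line of degree \<open>k\<close>, so
      \<open>glue_comp\<close> applies a second time, now over the object
      \<open>FOb (?G r) X\<close>.\<close>
    have Grx': "FAr (?G r) x \<in> arr (delta k) (FOb (?G r) X)"
      using Grx linear_functor_delta[OF lG[OF q(2)] k] by simp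
    note FFx = linear_functor_in[OF lF[OF q(1)] Frx] and GGx = linear_functor_in[OF lG[OF q(1)] Grx]
    note Fqrx = linear_functor_in[OF lF[OF qr] x] and Gqrx = linear_functor_in[OF lG[OF qr] x]
    have "?n (q \<otimes>\<^bsub>Q\<^esub> r) X \<star> ?a X \<star> ?Fx = ?n (q \<otimes>\<^bsub>Q\<^esub> r) X \<star> (?a X \<star> ?Fx)"
      by (rule comp_assoc[OF n1 aX FFx])
    also have "\<dots> = scale (eta_of F k q r * \<theta> (q \<otimes>\<^bsub>Q\<^esub> r) k) (FAr (?G (q \<otimes>\<^bsub>Q\<^esub> r)) x)"
      using monoidal_nat_iso_comp[OF acts_FTens(3)[OF F q] lFF lF[OF qr] k x] xA scale_comp(2)[OF n1 Fqrx]
        glue_comp[OF lF[OF qr] lG[OF qr] k x] by (simp add: scale_scale eta_of_def)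
    also have "\<dots> = scale (\<theta> r k * \<theta> q k) (?b X \<star> FAr (?G q) (FAr (?G r) x))"
      using monoidal_nat_iso_comp[OF acts_FTens(3)[OF G q] lGG lG[OF qr] k x] xA eq[OF k]
      by (simp add: scale_scale eta_of_def mult_ac)
    also have "\<dots> = ?b X \<star> (?n q (FOb (?G r) X) \<star> FAr (?F q) (scale (\<theta> r k) (FAr (?G r) x)))"
      using linear_functor_scale[OF lF[OF q(1)] Grx'] glue_comp[OF lF[OF q(1)] lG[OF q(1)] k Grx'] scale_comp(2)[OF bX GGx]
        scale_comp(2)[OF n2 linear_functor_in[OF lF[OF q(1)] Grx]]
      by (simp add: scale_scale)
    also have "\<dots> = ?b X \<star> (?n q (FOb (?G r) X) \<star> (FAr (?F q) (?n r X) \<star> ?Fx))"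
      using glue_comp[OF lF[OF q(2)] lG[OF q(2)] k x, of "\<theta> r"] linear_functor_comp[OF lF[OF q(1)] n3 Frx] by simp
    also have "\<dots> = ?b X \<star> (?n q (FOb (?G r) X) \<star> FAr (?F q) (?n r X)) \<star> ?Fx"
      using comp_assoc[OF bX comp_in[OF n2 Fn3] FFx] comp_assoc[OF n2 Fn3 FFx] by simp
    finally show "?n (q \<otimes>\<^bsub>Q\<^esub> r) X \<star> ?a X \<star> ?Fx = ?b X \<star> (?n q (FOb (?G r) X) \<star> FAr (?F q) (?n r X)) \<star> ?Fx" .
  qed
qed

lemma glue_FUnt:
  assumes F: "F \<in> acts" and G: "G \<in> acts" and X: "X \<in> obj"
    and eq: "\<And>k. k \<in> carrier K \<Longrightarrow> \<theta> k * eta_of F k \<one>\<^bsub>Q\<^esub> \<one>\<^bsub>Q\<^esub> = eta_of G k \<one>\<^bsub>Q\<^esub> \<one>\<^bsub>Q\<^esub> * \<theta> k * \<theta> k"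
    and nz: "\<And>k. k \<in> carrier K \<Longrightarrow> \<theta> k \<noteq> 0"
  shows "glue \<theta> (FOb F \<one>\<^bsub>Q\<^esub>) (FOb G \<one>\<^bsub>Q\<^esub>) X \<star> unit_trans F X = unit_trans G X"
proof -
  have lF: "linear_functor (FOb F \<one>\<^bsub>Q\<^esub>)" and lG: "linear_functor (FOb G \<one>\<^bsub>Q\<^esub>)"
    using Aut0_ob_linear_functor acts_Aut0_ob[OF F] acts_Aut0_ob[OF G] by auto
  have lid: "linear_functor fun_id" using Aut0_ob_linear_functor[OF acts_FUnt(2)[OF F]] .
  note u = monoidal_nat_iso_D(1)[OF acts_FUnt(3)[OF F] X] and v = monoidal_nat_iso_D(1)[OF acts_FUnt(3)[OF G] X]
  note n = glue_in[OF lF lG X, of \<theta>]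
  show ?thesis
  proof (rule epi1[OF lid X comp_in[OF n u] v])
    fix k x assume k: "k \<in> carrier K" and x: "x \<in> arr (delta k) X"
    note ux = monoidal_nat_iso_comp[OF acts_FUnt(3)[OF F] lid lF k x] and vx = monoidal_nat_iso_comp[OF acts_FUnt(3)[OF G] lid lG k x]
    \<comment> \<open>Multiply the relation \<open>eq\<close> by both unit coefficients: each
      cancels its own value of \<open>eta_of\<close> by \<open>eta_of_unit\<close>, and then one
      \<open>\<theta> k\<close> cancels.\<close>
    have tms: "\<theta> k * trans_coeff (unit_trans F) k = trans_coeff (unit_trans G) k"
    proof -
      have "\<theta> k * eta_of F k \<one>\<^bsub>Q\<^esub> \<one>\<^bsub>Q\<^esub> * (trans_coeff (unit_trans F) k * trans_coeff (unit_trans G) k) =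
         eta_of G k \<one>\<^bsub>Q\<^esub> \<one>\<^bsub>Q\<^esub> * \<theta> k * \<theta> k * (trans_coeff (unit_trans F) k * trans_coeff (unit_trans G) k)"
        using eq[OF k] by simp
      then have "\<theta> k * trans_coeff (unit_trans G) k * (eta_of F k \<one>\<^bsub>Q\<^esub> \<one>\<^bsub>Q\<^esub> * trans_coeff (unit_trans F) k) =
         \<theta> k * \<theta> k * trans_coeff (unit_trans F) k * (eta_of G k \<one>\<^bsub>Q\<^esub> \<one>\<^bsub>Q\<^esub> * trans_coeff (unit_trans G) k)"
        by (simp only: mult_ac)
      then show ?thesis using eta_of_unit(1)[OF F k] eta_of_unit(1)[OF G k] nz[OF k] by simp
    qed
    show "glue \<theta> (FOb F \<one>\<^bsub>Q\<^esub>) (FOb G \<one>\<^bsub>Q\<^esub>) X \<star> unit_trans F X \<star> FAr fun_id x = unit_trans G X \<star> FAr fun_id x"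
      using comp_assoc[OF n u linear_functor_in[OF lid x]] ux vx scale_comp(2)[OF n linear_functor_in[OF lF x]] glue_comp[OF lF lG k x, of \<theta>]
        tms by (simp add: scale_scale mult.commute)
  qed
qed

lemma cohomologous_equiv:
  assumes F: "F \<in> acts" and G: "G \<in> acts" and co: "cohomologous Q K (omega_of F) (eta_of F) (omega_of G) (eta_of G)"
  shows "(F, G) \<in> mfun_equiv (disc Q) Aut0"
proof -
  obtain \<theta> where *: "\<forall>q\<in>carrier Q. \<forall>k\<in>carrier K. \<theta> q k \<noteq> 0"
      "\<forall>q\<in>carrier Q. \<forall>k\<in>carrier K. \<forall>l\<in>carrier K.
        \<theta> q (k \<otimes> l) * tens_coeff (FOb F q) k l = tens_coeff (FOb G q) k l * \<theta> q k * \<theta> q l"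
      "\<forall>k\<in>carrier K. \<forall>q\<in>carrier Q. \<forall>r\<in>carrier Q.
        \<theta> (q \<otimes>\<^bsub>Q\<^esub> r) k * eta_of F k q r = eta_of G k q r * \<theta> q k * \<theta> r k"
    using co unfolding cohomologous_def omega_of_def by blast
  then have nz: "\<And>q k. q \<in> carrier Q \<Longrightarrow> k \<in> carrier K \<Longrightarrow> \<theta> q k \<noteq> 0"
    and e1: "\<And>q k l. q \<in> carrier Q \<Longrightarrow> k \<in> carrier K \<Longrightarrow> l \<in> carrier K \<Longrightarrow>
        \<theta> q (k \<otimes> l) * tens_coeff (FOb F q) k l = tens_coeff (FOb G q) k l * \<theta> q k * \<theta> q l"
    and e2: "\<And>k q r. k \<in> carrier K \<Longrightarrow> q \<in> carrier Q \<Longrightarrow> r \<in> carrier Q \<Longrightarrow>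
        \<theta> (q \<otimes>\<^bsub>Q\<^esub> r) k * eta_of F k q r = eta_of G k q r * \<theta> q k * \<theta> r k"
    by blast+
  have lF: "linear_functor (FOb F q)" and lG: "linear_functor (FOb G q)" if "q \<in> carrier Q" for q
    using Aut0_ob_linear_functor acts_Aut0_ob[OF F that] acts_Aut0_ob[OF G that] by auto
  let ?n = "\<lambda>q. glue (\<theta> q) (FOb F q) (FOb G q)" and ?m = "\<lambda>q. glue (\<lambda>k. inverse (\<theta> q k)) (FOb G q) (FOb F q)"
  let ?a = "\<lambda>q\<in>carrier Q. (FOb F q, (\<lambda>X\<in>obj. ?n q X), FOb G q)"
  have aq: "?a q \<in> arrows Aut0 (FOb F q) (FOb G q)" if q: "q \<in> carrier Q" for q
    using glue_monoidal[OF acts_Aut0_ob[OF F q] acts_Aut0_ob[OF G q] nz[OF q] e1[OF q]] acts_Aut0_ob[OF F q] acts_Aut0_ob[OF G q] q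
    by (simp add: Aut0_arr_iff)
  have iso: "iso_arrow Aut0 (?a q)" if q: "q \<in> carrier Q" for q
  proof -
    \<comment> \<open>The inverse scalars satisfy the relation with \<open>F\<close> and
      \<open>G\<close> exchanged, so the glued inverse is monoidal too and is an arrow of
      \<open>Aut0\<close>.\<close>
    have inv: "inverse (\<theta> q (k \<otimes> l)) * tens_coeff (FOb G q) k l = tens_coeff (FOb F q) k l * inverse (\<theta> q k) * inverse (\<theta> q l)"
      if "k \<in> carrier K" "l \<in> carrier K" for k l
      using e1[OF q that] nz[OF q] that by (simp add: field_simps)
    have m: "(FOb G q, (\<lambda>X\<in>obj. ?m q X), FOb F q) \<in> arrows Aut0 (FOb G q) (FOb F q)"
      using glue_monoidal[OF acts_Aut0_ob[OF G q] acts_Aut0_ob[OF F q] _ inv] acts_Aut0_ob[OF F q] acts_Aut0_ob[OF G q] nz[OF q]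
      by (simp add: Aut0_arr_iff)
    have "?m q X \<star> ?n q X = idn (FOb (FOb F q) X)" "?n q X \<star> ?m q X = idn (FOb (FOb G q) X)"
      if X: "X \<in> obj" for X
      using nz[OF q] by (auto intro!: glue_inverse lF lG q X)
    then show ?thesis
      unfolding iso_arrow_def using m aq[OF q] q
      by (auto simp: arrows_def intro!: bexI[of _ "(FOb G q, (\<lambda>X\<in>obj. ?m q X), FOb F q)"] restrict_ext)
  qed
  have "monoidal_nat_iso (disc Q) Aut0 F G ?a"
    unfolding monoidal_nat_iso_def nat_iso_def
  proof (intro conjI ballI)
    show "?a \<in> Ob (disc Q) \<rightarrow>\<^sub>E Ar Aut0" using aq by (auto simp: arrows_def)
    show "?a q \<in> arrows Aut0 (FOb F q) (FOb G q)" "iso_arrow Aut0 (?a q)" if "q \<in> Ob (disc Q)" for q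
      using that aq iso by simp_all
    fix q assume "q \<in> Ar (disc Q)"
    then have q: "q \<in> carrier Q" by simp
    then show "Cmp Aut0 (?a (Cd (disc Q) q)) (FAr F q) = Cmp Aut0 (FAr G q) (?a (Dm (disc Q) q))"
      by (auto simp: acts_FAr[OF F q] acts_FAr[OF G q] glue_in[OF lF[OF q] lG[OF q]]
          comp_idn[OF glue_in[OF lF[OF q] lG[OF q]]] intro!: restrict_ext)
  next
    fix q r assume "q \<in> Ob (disc Q)" "r \<in> Ob (disc Q)"
    then have q: "q \<in> carrier Q" "r \<in> carrier Q" by auto
    show "Cmp Aut0 (?a (TensO (disc Q) q r)) (FTens F (q, r)) = Cmp Aut0 (FTens G (q, r)) (TensA Aut0 (?a q) (?a r))"
      using q glue_FTens[where \<theta> = \<theta>, OF F G q _ e2[OF _ q]] linear_functor_obj[OF lG[OF q(2)]]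
      by (auto simp: acts_FTens(1)[OF F q] acts_FTens(1)[OF G q] intro!: restrict_ext)
  next
    have "\<theta> \<one>\<^bsub>Q\<^esub> k * eta_of F k \<one>\<^bsub>Q\<^esub> \<one>\<^bsub>Q\<^esub> = eta_of G k \<one>\<^bsub>Q\<^esub> \<one>\<^bsub>Q\<^esub> * \<theta> \<one>\<^bsub>Q\<^esub> k * \<theta> \<one>\<^bsub>Q\<^esub> k" if "k \<in> carrier K" for k
      using e2[OF that, of "\<one>\<^bsub>Q\<^esub>" "\<one>\<^bsub>Q\<^esub>"] by simp
    note n = glue_FUnt[where \<theta> = "\<theta> \<one>\<^bsub>Q\<^esub>", OF F G _ this nz[OF Q.one_closed]]
    \<comment> \<open>Arrows of \<open>Aut0\<close> are equal only as extensional families, so the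
      values outside \<open>obj\<close> have to match as well; \<open>monoidal_nat_iso_D(5)\<close>
      settles them.\<close>
    have "(\<lambda>X\<in>obj. (\<lambda>X\<in>obj. ?n \<one>\<^bsub>Q\<^esub> X) X \<star> unit_trans F X) = unit_trans G"
      using monoidal_nat_iso_D(5)[OF acts_FUnt(3)[OF G]] n by (intro extensionalityI[of _ obj]) auto
    then show "Cmp Aut0 (?a (Unt (disc Q))) (FUnt F) = FUnt G"
      by (simp add: acts_FUnt(1)[OF F] acts_FUnt(1)[OF G])
  qed
  then show ?thesis using F G by (auto simp: mfun_equiv_def)
qed

end

section \<open>Actions defined by cochains\<close>

context fin_group begin

lemma arrow_sum_delta:
  assumes "finite I" "j \<in> I" "e j \<in> arr X Y" "\<And>i. i \<in> I \<Longrightarrow> i \<noteq> j \<Longrightarrow> e i = scale 0 f" "f \<in> arr X Y"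
  shows "arrow_sum X Y e I = e j"
proof -
  have "fst (snd (e i)) = 0\<^sub>m (fst Y) (fst X)" if "i \<in> I" "i \<noteq> j" for i
  proof -
    have "fst (snd (e i)) = 0 \<cdot>\<^sub>m fst (snd f)"
      using assms(4)[OF that] arr_mat(1)[OF assms(5)] by (metis Vec_ops(3) fst_conv snd_conv)
    then show ?thesis using arr_mat(2)[OF assms(5)] by (intro eq_matI) auto
  qed
  then have "mat_sum (fst Y) (fst X) (\<lambda>i. fst (snd (e i))) I = fst (snd (e j))"
    using assms(1,2) arr_mat(2)[OF assms(3)] by (intro mat_sum_delta) auto
  then show ?thesis using arr_mat(1)[OF assms(3)] by (simp add: arrow_sum_def)
qed

section \<open>Block scalar endomorphisms \<open>scalar1\<close> and \<open>scalar2\<close>, and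
  their action on lines\<close>

definition proj_arr :: "'k gvs \<Rightarrow> 'k \<Rightarrow> 'k gmap" where
  "proj_arr X g = (X, snd X g, X)"

lemma proj_arr_in: "X \<in> obj \<Longrightarrow> g \<in> carrier K \<Longrightarrow> proj_arr X g \<in> arr X X"
  by (auto simp: proj_arr_def arr_iff objD)

text \<open>An arrow out of the line of degree \<open>k\<close> lands in degree \<open>k\<close>, so
  every other projection kills it.\<close>

lemma proj_arr_comp:
  assumes "x \<in> arr (delta k) X" "k \<in> carrier K" "g \<in> carrier K"
  shows "proj_arr X g \<star> x = (if g = k then x else scale 0 x)"
proof -
  obtain M where M: "x = (delta k, M, X)" "M \<in> carrier_mat (fst X) 1"
     "\<And>g. g \<in> carrier K \<Longrightarrow> M * snd (delta k) g = snd X g * M" using assms(1) by (auto simp: arr_iff)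
  have "0 \<cdot>\<^sub>m M = 0\<^sub>m (fst X) 1" using M(2) by (intro eq_matI) auto
  then show ?thesis
    using M(1) M(3)[OF assms(3)] assms(3) right_mult_one_mat[OF M(2)] right_mult_zero_mat[OF M(2), of 1]
    by (auto simp: proj_arr_def Vec_ops)
qed

lemma scalar1_arrow_sum: "scalar1 K c X = arrow_sum X X (\<lambda>g. scale (c g) (proj_arr X g)) (carrier K)"
  by (simp add: scalar1_def arrow_sum_def proj_arr_def Vec_ops)

lemma scalar2_arrow_sum:
  "scalar2 K c X Y = arrow_sum (X \<boxdot> Y) (X \<boxdot> Y) (\<lambda>(g, h). scale (c g h) (proj_arr X g \<boxtimes> proj_arr Y h)) (carrier K \<times> carrier K)"
  by (simp add: scalar2_def arrow_sum_def proj_arr_def Vec_ops case_prod_unfold)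

lemma scalar1_in: "X \<in> obj \<Longrightarrow> scalar1 K c X \<in> arr X X"
  unfolding scalar1_arrow_sum using proj_arr_in by (intro arrow_sum_in) auto

lemma scalar2_in: "X \<in> obj \<Longrightarrow> Y \<in> obj \<Longrightarrow> scalar2 K c X Y \<in> arr (X \<boxdot> Y) (X \<boxdot> Y)"
  unfolding scalar2_arrow_sum by (intro arrow_sum_in) (auto intro!: scale_in tens_in proj_arr_in)

text \<open>The sum over degrees collapses to the summand \<open>k\<close>. With
  \<open>idn_epi1\<close> this characterizes \<open>scalar1\<close>, and identities such as
  \<open>scalar1_mult\<close> are checked on lines.\<close>

lemma scalar1_comp:
  assumes k: "k \<in> carrier K" and x: "x \<in> arr (delta k) X"
  shows "scalar1 K c X \<star> x = scale (c k) x"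
proof -
  have X: "X \<in> obj" using arr_objD[OF x] by simp
  let ?e = "\<lambda>g. scale (c g) (proj_arr X g) \<star> x"
  have e: "?e g = (if g = k then scale (c k) x else scale 0 x)" if "g \<in> carrier K" for g
    using scale_comp(1)[OF proj_arr_in[OF X that] x] proj_arr_comp[OF x k that] by (simp add: scale_scale)
  have "scalar1 K c X \<star> x = arrow_sum (delta k) X ?e (carrier K)"
    unfolding scalar1_arrow_sum using proj_arr_in[OF X] by (intro arrow_sum_comp[OF x]) auto
  also have "\<dots> = ?e k" by (rule arrow_sum_delta[OF fin k _ _ x]) (use e k x in auto)
  finally show ?thesis using e[OF k] by simp
qed

lemma scalar2_comp:
  assumes k: "k \<in> carrier K" "l \<in> carrier K" and x: "x \<in> arr (delta k) X" and y: "y \<in> arr (delta l) Y"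
  shows "scalar2 K c X Y \<star> (x \<boxtimes> y) = scale (c k l) (x \<boxtimes> y)"
proof -
  have X: "X \<in> obj" and Y: "Y \<in> obj" using arr_objD[OF x] arr_objD[OF y] by auto
  have xy: "x \<boxtimes> y \<in> arr (delta (k \<otimes> l)) (X \<boxdot> Y)" using tens_in[OF x y] k by (simp add: tensO_delta)
  let ?p = "\<lambda>(g, h). scale (c g h) (proj_arr X g \<boxtimes> proj_arr Y h)"
  let ?e = "\<lambda>p. ?p p \<star> (x \<boxtimes> y)"
  have e: "?e (g, h) = (if (g, h) = (k, l) then scale (c k l) (x \<boxtimes> y) else scale 0 (x \<boxtimes> y))"
    if "g \<in> carrier K" "h \<in> carrier K" for g h
  proof -
    note p = proj_arr_in[OF X that(1)] and q = proj_arr_in[OF Y that(2)]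
    have "?e (g, h) = scale (c g h) ((proj_arr X g \<star> x) \<boxtimes> (proj_arr Y h \<star> y))"
      using scale_comp(1)[OF tens_in[OF p q] tens_in[OF x y]] interchange[OF p x q y] by simp
    then show ?thesis
      using proj_arr_comp[OF x k(1) that(1)] proj_arr_comp[OF y k(2) that(2)] scale_tens[of 0 x 1 y] scale_tens[of 1 x 0 y]
        scale_tens[of 0 x 0 y] by (auto simp: scale_scale)
  qed
  have "scalar2 K c X Y \<star> (x \<boxtimes> y) = arrow_sum (delta (k \<otimes> l)) (X \<boxdot> Y) ?e (carrier K \<times> carrier K)"
    unfolding scalar2_arrow_sum using proj_arr_in[OF X] proj_arr_in[OF Y]
    by (intro arrow_sum_comp[OF xy]) (auto intro!: scale_in tens_in)
  also have "\<dots> = ?e (k, l)"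
  proof (rule arrow_sum_delta[OF _ _ _ _ xy])
    show "?e (k, l) \<in> arr (delta (k \<otimes> l)) (X \<boxdot> Y)" using e k xy by simp
    fix p assume "p \<in> carrier K \<times> carrier K" "p \<noteq> (k, l)"
    then show "?e p = scale 0 (x \<boxtimes> y)" using e[of "fst p" "snd p"] by (cases p) auto
  qed (use fin k in auto)
  finally show ?thesis using e[OF k] by simp
qed

lemma add_in:
  assumes "f \<in> arr X Y" "g \<in> arr X Y"
  shows "AddA (Vec K) f g \<in> arr X Y"
proof -
  obtain M where M: "f = (X, M, Y)" "M \<in> carrier_mat (fst Y) (fst X)" "X \<in> obj" "Y \<in> obj"
     "\<And>g. g \<in> carrier K \<Longrightarrow> M * snd X g = snd Y g * M" by (rule arrE[OF assms(1)]) blast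
  obtain N where N: "g = (X, N, Y)" "N \<in> carrier_mat (fst Y) (fst X)"
     "\<And>g. g \<in> carrier K \<Longrightarrow> N * snd X g = snd Y g * N" by (rule arrE[OF assms(2)]) blast
  have "(M + N) * snd X h = snd Y h * (M + N)" if h: "h \<in> carrier K" for h
    using add_mult_distrib_mat[OF M(2) N(2) objD(1)[OF M(3) h]]
      mult_add_distrib_mat[OF objD(1)[OF M(4) h] M(2) N(2)] M(5)[OF h] N(3)[OF h] by simp
  then show ?thesis using M N by (auto simp: arr_iff Vec_ops)
qed

section \<open>Twisted identity functors as objects of the 2-group\<close>

lemma twisted_simps [simp]:
  "X \<in> obj \<Longrightarrow> FOb (twisted_id K c) X = X"
  "f \<in> gvs_arrows K \<Longrightarrow> FAr (twisted_id K c) f = f"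
  "X \<in> obj \<Longrightarrow> Y \<in> obj \<Longrightarrow> FTens (twisted_id K c) (X, Y) = scalar2 K c X Y"
  "FUnt (twisted_id K c) = scale (inverse (c \<one> \<one>)) (idn (delta \<one>))"
  by (simp_all add: twisted_id_def)

lemma twisted_FAr: "f \<in> arr X Y \<Longrightarrow> FAr (twisted_id K c) f = f"
  using arrD(1) by simp

lemma twisted_functor: "is_functor (Vec K) (Vec K) (FOb (twisted_id K c)) (FAr (twisted_id K c))"
  unfolding is_functor_def
proof (intro conjI ballI impI)
  show "FOb (twisted_id K c) \<in> Ob (Vec K) \<rightarrow>\<^sub>E Ob (Vec K)" "FAr (twisted_id K c) \<in> Ar (Vec K) \<rightarrow>\<^sub>E Ar (Vec K)"
    by (auto simp: twisted_id_def)
  fix f assume "f \<in> Ar (Vec K)"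
  then obtain X Y where f: "f \<in> arr X Y" by (auto simp: Ar_iff)
  show "Dm (Vec K) (FAr (twisted_id K c) f) = FOb (twisted_id K c) (Dm (Vec K) f)"
    "Cd (Vec K) (FAr (twisted_id K c) f) = FOb (twisted_id K c) (Cd (Vec K) f)"
    using arrD[OF f] arr_objD[OF f] by simp_all
  fix g assume g: "g \<in> Ar (Vec K)" "Dm (Vec K) g = Cd (Vec K) f"
  then have "g \<in> arr Y (Cd (Vec K) g)" using arrD[OF f] by (auto simp: arrows_def)
  note gf = comp_in[OF this f]
  show "FAr (twisted_id K c) (g \<star> f) = FAr (twisted_id K c) g \<star> FAr (twisted_id K c) f"
    using arrD(1)[OF f] g arrD(1)[OF gf] by simp
next
  fix X assume "X \<in> Ob (Vec K)"
  then show "FAr (twisted_id K c) (Idn (Vec K) X) = Idn (Vec K) (FOb (twisted_id K c) X)"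
    using arrD(1)[OF idn_in] by simp
qed

lemma twisted_linear: "linear_on_arrows (Vec K) (FAr (twisted_id K c))"
  unfolding linear_on_arrows_def
proof (intro conjI ballI allI impI)
  fix f assume "f \<in> Ar (Vec K)"
  then obtain X Y where f: "f \<in> arr X Y" by (auto simp: Ar_iff)
  show "FAr (twisted_id K c) (scale a f) = scale a (FAr (twisted_id K c) f)" for a
    using arrD(1)[OF f] arrD(1)[OF scale_in[OF f]] by simp
  fix g assume g: "g \<in> Ar (Vec K)" "Dm (Vec K) f = Dm (Vec K) g \<and> Cd (Vec K) f = Cd (Vec K) g"
  then have "g \<in> arr X Y" using arrD[OF f] by (auto simp: arrows_def)
  from arrD(1)[OF add_in[OF f this]]
  show "FAr (twisted_id K c) (AddA (Vec K) f g) = AddA (Vec K) (FAr (twisted_id K c) f) (FAr (twisted_id K c) g)"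
    using arrD(1)[OF f] g by simp
qed

lemma twisted_linear_functor: "linear_functor (twisted_id K c)"
  using twisted_functor twisted_linear by (simp add: linear_functor_def)

text \<open>The identity functor enters \<open>epi1\<close> as the underlying functor of
  \<open>twisted_id\<close> with constant coefficient 1.\<close>

lemma idn_epi1:
  assumes X: "X \<in> obj" and f: "f \<in> arr X Z" "f' \<in> arr X Z"
    and eq: "\<And>k x. k \<in> carrier K \<Longrightarrow> x \<in> arr (delta k) X \<Longrightarrow> f \<star> x = f' \<star> x"
  shows "f = f'"
  by (rule epi1[OF twisted_linear_functor[of "\<lambda>_ _. 1"] X]) (use f eq X in \<open>simp_all add: twisted_FAr\<close>)

lemma idn_epi2:
  assumes X: "X \<in> obj" and Y: "Y \<in> obj" and f: "f \<in> arr (X \<boxdot> Y) Z" "f' \<in> arr (X \<boxdot> Y) Z"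
    and eq: "\<And>k l x y. k \<in> carrier K \<Longrightarrow> l \<in> carrier K \<Longrightarrow> x \<in> arr (delta k) X \<Longrightarrow> y \<in> arr (delta l) Y \<Longrightarrow>
      f \<star> (x \<boxtimes> y) = f' \<star> (x \<boxtimes> y)"
  shows "f = f'"
  by (rule epi2[OF twisted_linear_functor[of "\<lambda>_ _. 1"] X Y]) (use f eq X Y in \<open>simp_all add: twisted_FAr\<close>)

text \<open>Made for the associativity axiom, whose two sides start at a product of three objects;
  the identity there is resolved by products of three composites through lines.\<close>

lemma idn_epi3:
  assumes X: "X \<in> obj" and Y: "Y \<in> obj" and Z: "Z \<in> obj"
    and f: "f \<in> arr (X \<boxdot> Y \<boxdot> Z) W" "f' \<in> arr (X \<boxdot> Y \<boxdot> Z) W"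
    and eq: "\<And>k l m x y z. k \<in> carrier K \<Longrightarrow> l \<in> carrier K \<Longrightarrow> m \<in> carrier K \<Longrightarrow>
      x \<in> arr (delta k) X \<Longrightarrow> y \<in> arr (delta l) Y \<Longrightarrow> z \<in> arr (delta m) Z \<Longrightarrow>
      f \<star> (x \<boxtimes> y \<boxtimes> z) = f' \<star> (x \<boxtimes> y \<boxtimes> z)"
  shows "f = f'"
proof (rule arrow_sum_eqI[OF _ f])
  let ?e = "\<lambda>X p. col_incl X p \<star> row_proj X p"
  let ?E = "\<lambda>(p, q). ?e X p \<boxtimes> ?e Y q"
  let ?D = "\<lambda>(pq, r). ?E pq \<boxtimes> ?e Z r"
  let ?W = "X \<boxdot> Y" and ?V = "X \<boxdot> Y \<boxdot> Z"
  have e: "?e X p \<in> arr X X" if "p \<in> basis_ix X" "X \<in> obj" for p X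
    using comp_in[OF col_incl_in[OF that(2,1)] row_proj_in[OF that(2,1)]] .
  have E: "?E pq \<in> arr ?W ?W" if "pq \<in> basis_ix X \<times> basis_ix Y" for pq
    using that by (cases pq) (auto intro!: tens_in e simp: X Y)
  have "arrow_sum ?V ?V ?D ((basis_ix X \<times> basis_ix Y) \<times> basis_ix Z) = arrow_sum ?W ?W ?E (basis_ix X \<times> basis_ix Y) \<boxtimes> arrow_sum Z Z (?e Z) (basis_ix Z)"
    by (rule arrow_sum_tens[symmetric]) (use e[OF _ Z] E in auto)
  also have "arrow_sum ?W ?W ?E (basis_ix X \<times> basis_ix Y) = arrow_sum X X (?e X) (basis_ix X) \<boxtimes> arrow_sum Y Y (?e Y) (basis_ix Y)"
    using e X Y by (intro arrow_sum_tens[symmetric]) auto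
  finally show "arrow_sum ?V ?V ?D ((basis_ix X \<times> basis_ix Y) \<times> basis_ix Z) = idn ?V"
    using X Y Z by (simp add: idn_decomp tens_idn)
  fix pqr assume "pqr \<in> (basis_ix X \<times> basis_ix Y) \<times> basis_ix Z"
  then obtain p q r where pqr: "pqr = ((p, q), r)" "p \<in> basis_ix X" "q \<in> basis_ix Y" "r \<in> basis_ix Z" by blast
  note i = col_incl_in[OF X pqr(2)] col_incl_in[OF Y pqr(3)] col_incl_in[OF Z pqr(4)]
  note j = row_proj_in[OF X pqr(2)] row_proj_in[OF Y pqr(3)] row_proj_in[OF Z pqr(4)]
  note i2 = tens_in[OF i(1) i(2)] and j2 = tens_in[OF j(1) j(2)]
  note i3 = tens_in[OF i2 i(3)] and j3 = tens_in[OF j2 j(3)]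
  have D: "?D pqr = (col_incl X p \<boxtimes> col_incl Y q \<boxtimes> col_incl Z r) \<star> (row_proj X p \<boxtimes> row_proj Y q \<boxtimes> row_proj Z r)"
    using interchange[OF i(1) j(1) i(2) j(2)] interchange[OF i2 j2 i(3) j(3)] pqr(1) by simp
  show "?D pqr \<in> arr ?V ?V" unfolding D using comp_in[OF i3 j3] .
  have "f \<star> (col_incl X p \<boxtimes> col_incl Y q \<boxtimes> col_incl Z r) = f' \<star> (col_incl X p \<boxtimes> col_incl Y q \<boxtimes> col_incl Z r)"
    using pqr by (intro eq[OF _ _ _ i]) auto
  then show "f \<star> ?D pqr = f' \<star> ?D pqr"
    unfolding D using comp_assoc[OF f(1) i3 j3] comp_assoc[OF f(2) i3 j3] by simp
qed

lemma tens_unit: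
  assumes "f \<in> arr X Y"
  shows "idn (delta \<one>) \<boxtimes> f = f" "f \<boxtimes> idn (delta \<one>) = f"
  using assms by (auto elim!: arrE simp: Vec_ops gvs_id_def kron_one_left kron_one_right tensO_unit)

lemma scalar1_cong: "(\<And>k. k \<in> carrier K \<Longrightarrow> c k = d k) \<Longrightarrow> scalar1 K c X = scalar1 K d X"
  unfolding scalar1_arrow_sum by (intro arrow_sum_cong) auto

lemma scalar2_cong:
  "(\<And>k l. k \<in> carrier K \<Longrightarrow> l \<in> carrier K \<Longrightarrow> c k l = d k l) \<Longrightarrow> scalar2 K c X Y = scalar2 K d X Y"
  unfolding scalar2_arrow_sum by (intro arrow_sum_cong) auto

lemma scalar1_delta: "k \<in> carrier K \<Longrightarrow> scalar1 K c (delta k) = scale (c k) (idn (delta k))"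
  using scalar1_comp[of k "idn (delta k)" "delta k" c] comp_idn(1)[OF scalar1_in[of "delta k"]] by simp

lemma scalar2_delta:
  "k \<in> carrier K \<Longrightarrow> l \<in> carrier K \<Longrightarrow> scalar2 K c (delta k) (delta l) = scale (c k l) (idn (delta (k \<otimes> l)))"
  using scalar2_comp[of k l "idn (delta k)" "delta k" "idn (delta l)" "delta l" c]
    comp_idn(1)[OF scalar2_in[of "delta k" "delta l"]] by (simp add: tens_idn tensO_delta)

lemma scalar1_mult:
  assumes X: "X \<in> obj"
  shows "scalar1 K c X \<star> scalar1 K d X = scalar1 K (\<lambda>k. c k * d k) X"
proof (rule idn_epi1[OF X comp_in[OF scalar1_in[OF X] scalar1_in[OF X]] scalar1_in[OF X]])
  fix k x assume k: "k \<in> carrier K" and x: "x \<in> arr (delta k) X"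
  note s = scalar1_in[OF X]
  show "scalar1 K c X \<star> scalar1 K d X \<star> x = scalar1 K (\<lambda>k. c k * d k) X \<star> x"
    using comp_assoc[OF s s x] scale_comp(2)[OF s x] by (simp add: scalar1_comp[OF k x] scale_scale mult.commute)
qed

lemma scalar1_one: "X \<in> obj \<Longrightarrow> scalar1 K (\<lambda>_. 1) X = idn X"
  by (rule idn_epi1[OF _ scalar1_in idn_in]) (auto simp: scalar1_comp)

lemma scalar2_mult:
  assumes X: "X \<in> obj" and Y: "Y \<in> obj"
  shows "scalar2 K c X Y \<star> scalar2 K d X Y = scalar2 K (\<lambda>k l. c k l * d k l) X Y"
proof (rule idn_epi2[OF X Y comp_in[OF scalar2_in[OF X Y] scalar2_in[OF X Y]] scalar2_in[OF X Y]])
  fix k l x y assume k: "k \<in> carrier K" "l \<in> carrier K" and x: "x \<in> arr (delta k) X" and y: "y \<in> arr (delta l) Y"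
  note s = scalar2_in[OF X Y] and xy = tens_in[OF x y]
  show "scalar2 K c X Y \<star> scalar2 K d X Y \<star> (x \<boxtimes> y) = scalar2 K (\<lambda>k l. c k l * d k l) X Y \<star> (x \<boxtimes> y)"
    using comp_assoc[OF s s xy] scale_comp(2)[OF s xy] by (simp add: scalar2_comp[OF k x y] scale_scale mult.commute)
qed

lemma scalar2_one: "X \<in> obj \<Longrightarrow> Y \<in> obj \<Longrightarrow> scalar2 K (\<lambda>_ _. 1) X Y = idn (X \<boxdot> Y)"
  by (rule idn_epi2[OF _ _ scalar2_in idn_in]) (auto simp: scalar2_comp comp_idn(2)[OF tens_in])

definition cocycle2 :: "('k \<Rightarrow> 'k \<Rightarrow> complex) \<Rightarrow> bool" where
  "cocycle2 c \<longleftrightarrow> (\<forall>k\<in>carrier K. \<forall>l\<in>carrier K. c k l \<noteq> 0) \<and>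
     (\<forall>k\<in>carrier K. \<forall>l\<in>carrier K. \<forall>m\<in>carrier K. c (k \<otimes> l) m * c k l = c k (l \<otimes> m) * c l m)"

text \<open>The cocycle identity at \<open>(\<one>, \<one>, k)\<close> and at
  \<open>(k, \<one>, \<one>)\<close> has a common nonzero factor to cancel. This stands in for
  normalization.\<close>

lemma cocycle2_unit:
  assumes "cocycle2 c" "k \<in> carrier K"
  shows "c \<one> k = c \<one> \<one>" "c k \<one> = c \<one> \<one>"
proof -
  have nz: "c l m \<noteq> 0" if "l \<in> carrier K" "m \<in> carrier K" for l m using assms that by (auto simp: cocycle2_def)
  have "c (\<one> \<otimes> \<one>) k * c \<one> \<one> = c \<one> (\<one> \<otimes> k) * c \<one> k" "c (k \<otimes> \<one>) \<one> * c k \<one> = c k (\<one> \<otimes> \<one>) * c \<one> \<one>"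
    using assms unfolding cocycle2_def by blast+
  then show "c \<one> k = c \<one> \<one>" "c k \<one> = c \<one> \<one>" using nz[of \<one> k] nz[of k \<one>] assms(2) by simp_all
qed

text \<open>Tensoring with the unit object is strict, so these are endomorphisms of
  \<open>X\<close>, and \<open>cocycle2_unit\<close> makes them plain scalars. The unit map of
  \<open>twisted_id\<close> inverts exactly this scalar.\<close>

lemma scalar2_unit:
  assumes c: "cocycle2 c" and X: "X \<in> obj"
  shows "scalar2 K c (delta \<one>) X = scale (c \<one> \<one>) (idn X)" "scalar2 K c X (delta \<one>) = scale (c \<one> \<one>) (idn X)"
proof -
  have i: "idn (delta \<one>) \<in> arr (delta \<one>) (delta \<one>)" by auto
  have l: "scalar2 K c (delta \<one>) X \<in> arr X X" and r: "scalar2 K c X (delta \<one>) \<in> arr X X"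
    using scalar2_in[OF delta_obj[OF one_closed] X] scalar2_in[OF X delta_obj[OF one_closed]] tensO_unit[OF X] by simp_all
  have s: "scale (c \<one> \<one>) (idn X) \<in> arr X X" using X by auto
  have sx: "scale (c \<one> \<one>) (idn X) \<star> x = scale (c \<one> \<one>) x" if "x \<in> arr (delta k) X" for k x
    using scale_comp(1)[OF idn_in[OF X] that] that by simp
  show "scalar2 K c (delta \<one>) X = scale (c \<one> \<one>) (idn X)"
  proof (rule idn_epi1[OF X l s])
    fix k x assume k: "k \<in> carrier K" and x: "x \<in> arr (delta k) X"
    show "scalar2 K c (delta \<one>) X \<star> x = scale (c \<one> \<one>) (idn X) \<star> x"
      using scalar2_comp[OF one_closed k i x, of c] tens_unit(1)[OF x] cocycle2_unit[OF c k] sx[OF x] by simp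
  qed
  show "scalar2 K c X (delta \<one>) = scale (c \<one> \<one>) (idn X)"
  proof (rule idn_epi1[OF X r s])
    fix k x assume k: "k \<in> carrier K" and x: "x \<in> arr (delta k) X"
    show "scalar2 K c X (delta \<one>) \<star> x = scale (c \<one> \<one>) (idn X) \<star> x"
      using scalar2_comp[OF k one_closed x i, of c] tens_unit(2)[OF x] cocycle2_unit[OF c k] sx[OF x] by simp
  qed
qed

lemma scalar2_natural:
  assumes f: "f \<in> arr X X'" and g: "g \<in> arr Y Y'"
  shows "(f \<boxtimes> g) \<star> scalar2 K c X Y = scalar2 K c X' Y' \<star> (f \<boxtimes> g)"
proof -
  note fg = tens_in[OF f g]
  note X = arr_objD(1)[OF f] arr_objD(1)[OF g] and Y = arr_objD(2)[OF f] arr_objD(2)[OF g]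
  note s = scalar2_in[OF X] and s' = scalar2_in[OF Y]
  show ?thesis
  proof (rule idn_epi2[OF X comp_in[OF fg s] comp_in[OF s' fg]])
    fix k l x y assume k: "k \<in> carrier K" "l \<in> carrier K" and x: "x \<in> arr (delta k) X" and y: "y \<in> arr (delta l) Y"
    note xy = tens_in[OF x y]
    show "(f \<boxtimes> g) \<star> scalar2 K c X Y \<star> (x \<boxtimes> y) = scalar2 K c X' Y' \<star> (f \<boxtimes> g) \<star> (x \<boxtimes> y)"
      using comp_assoc[OF fg s xy] comp_assoc[OF s' fg xy] scalar2_comp[OF k x y] scale_comp(2)[OF fg xy]
        interchange[OF f x g y] scalar2_comp[OF k comp_in[OF f x] comp_in[OF g y]] by simp
  qed
qed

text \<open>Tested on three lines with \<open>idn_epi3\<close>, both sides are scalars and the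
  equation becomes the cocycle identity for \<open>c\<close>.\<close>

lemma scalar2_assoc:
  assumes c: "cocycle2 c" and X: "X \<in> obj" and Y: "Y \<in> obj" and Z: "Z \<in> obj"
  shows "scalar2 K c (X \<boxdot> Y) Z \<star> (scalar2 K c X Y \<boxtimes> idn Z) = scalar2 K c X (Y \<boxdot> Z) \<star> (idn X \<boxtimes> scalar2 K c Y Z)"
proof -
  note XY = tensO_obj[OF X Y] and YZ = tensO_obj[OF Y Z]
  note s = scalar2_in[OF XY Z, of c] and t = tens_in[OF scalar2_in[OF X Y, of c] idn_in[OF Z]]
  have s': "scalar2 K c X (Y \<boxdot> Z) \<in> arr (X \<boxdot> Y \<boxdot> Z) (X \<boxdot> Y \<boxdot> Z)"
    and t': "idn X \<boxtimes> scalar2 K c Y Z \<in> arr (X \<boxdot> Y \<boxdot> Z) (X \<boxdot> Y \<boxdot> Z)"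
    using scalar2_in[OF X YZ, of c] tens_in[OF idn_in[OF X] scalar2_in[OF Y Z, of c]]
    by (simp_all add: tensO_assoc[OF X Y Z])
  show ?thesis
  proof (rule idn_epi3[OF X Y Z comp_in[OF s t] comp_in[OF s' t']])
    fix k l m x y z assume k: "k \<in> carrier K" "l \<in> carrier K" "m \<in> carrier K"
      and x: "x \<in> arr (delta k) X" and y: "y \<in> arr (delta l) Y" and z: "z \<in> arr (delta m) Z"
    note xy = tens_in[OF x y] and yz = tens_in[OF y z]
    note xyz = tens_in[OF xy z]
    \<comment> \<open>The right side evaluates on the other bracketing of the same test arrow;
      strict associativity identifies the two.\<close>
    have xyz': "x \<boxtimes> y \<boxtimes> z = x \<boxtimes> (y \<boxtimes> z)" by (rule tens_assoc[OF x y z])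
    have xy': "x \<boxtimes> y \<in> arr (delta (k \<otimes> l)) (X \<boxdot> Y)" and yz': "y \<boxtimes> z \<in> arr (delta (l \<otimes> m)) (Y \<boxdot> Z)"
      using xy yz k by (simp_all add: tensO_delta)
    have "scalar2 K c (X \<boxdot> Y) Z \<star> (scalar2 K c X Y \<boxtimes> idn Z) \<star> (x \<boxtimes> y \<boxtimes> z) =
       scale (c k l * c (k \<otimes> l) m) (x \<boxtimes> y \<boxtimes> z)"
      using comp_assoc[OF s t xyz] interchange[OF scalar2_in[OF X Y] xy idn_in[OF Z] z]
        scalar2_comp[OF k(1,2) x y] z scale_tens[of "c k l" "x \<boxtimes> y" 1 z] scale_comp(2)[OF s xyz]
        scalar2_comp[OF _ k(3) xy' z] k by (simp add: scale_scale)
    also have "\<dots> = scale (c l m * c k (l \<otimes> m)) (x \<boxtimes> y \<boxtimes> z)"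
      using c k by (auto simp: cocycle2_def mult.commute)
    also have "\<dots> = scalar2 K c X (Y \<boxdot> Z) \<star> (idn X \<boxtimes> scalar2 K c Y Z) \<star> (x \<boxtimes> y \<boxtimes> z)"
      using comp_assoc[OF s' t' xyz] interchange[OF idn_in[OF X] x scalar2_in[OF Y Z] yz] xyz'
        scalar2_comp[OF k(2,3) y z] x scale_tens[of 1 x "c l m" "y \<boxtimes> z"] scale_comp(2)[OF s' xyz]
        scalar2_comp[OF k(1) _ x yz'] k by (simp add: scale_scale)
    finally show "scalar2 K c (X \<boxdot> Y) Z \<star> (scalar2 K c X Y \<boxtimes> idn Z) \<star> (x \<boxtimes> y \<boxtimes> z) =
       scalar2 K c X (Y \<boxdot> Z) \<star> (idn X \<boxtimes> scalar2 K c Y Z) \<star> (x \<boxtimes> y \<boxtimes> z)" .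
  qed
qed

lemma iso_idn: "X \<in> obj \<Longrightarrow> iso_arrow (Vec K) (idn X)"
  using iso_arrow_iff[OF idn_in, of X] comp_idn(1)[OF idn_in, of X] by auto

lemma iso_scale_idn:
  assumes X: "X \<in> obj" and "c \<noteq> 0"
  shows "iso_arrow (Vec K) (scale c (idn X))"
proof -
  note i = idn_in[OF X]
  have "scale a (idn X) \<star> scale b (idn X) = scale (a * b) (idn X)" for a b
    using scale_comp(1)[OF i scale_in[OF i]] scale_comp(2)[OF i i] comp_idn(1)[OF i] by (simp add: scale_scale)
  then show ?thesis
    using iso_arrow_iff[OF scale_in[OF i]] assms(2) i
    by (auto intro!: bexI[of _ "scale (inverse c) (idn X)"])
qed

lemma twisted_monoidal:
  assumes c: "cocycle2 c"
  shows "twisted_id K c \<in> monoidal_functors (Vec K) (Vec K)"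
  unfolding monoidal_functors_def mem_Collect_eq
proof (intro conjI ballI)
  let ?T = "twisted_id K c"
  have nz: "c k l \<noteq> 0" if "k \<in> carrier K" "l \<in> carrier K" for k l using c that by (auto simp: cocycle2_def)
  show "is_functor (Vec K) (Vec K) (FOb ?T) (FAr ?T)" by (rule twisted_functor)
  show "FTens ?T \<in> Ob (Vec K) \<times> Ob (Vec K) \<rightarrow>\<^sub>E Ar (Vec K)"
    using arrD(1)[OF scalar2_in] by (auto simp: twisted_id_def)
  show "FUnt ?T \<in> arr (Unt (Vec K)) (FOb ?T (Unt (Vec K)))" by auto
  show "iso_arrow (Vec K) (FUnt ?T)" using nz by (auto intro!: iso_scale_idn)
  {
    fix f g assume "f \<in> Ar (Vec K)" "g \<in> Ar (Vec K)"
    then obtain X X' Y Y' where f: "f \<in> arr X X'" and g: "g \<in> arr Y Y'" by (auto simp: Ar_iff)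
    show "FAr ?T (f \<boxtimes> g) \<star> FTens ?T (Dm (Vec K) f, Dm (Vec K) g) =
      FTens ?T (Cd (Vec K) f, Cd (Vec K) g) \<star> (FAr ?T f \<boxtimes> FAr ?T g)"
      using scalar2_natural[OF f g] arrD[OF f] arrD[OF g] arr_objD[OF f] arr_objD[OF g]
      by (simp add: twisted_FAr[OF f] twisted_FAr[OF g] twisted_FAr[OF tens_in[OF f g]])
  }
  fix X assume "X \<in> Ob (Vec K)"
  then have X: "X \<in> obj" by simp
  have one: "delta \<one> \<in> obj" by auto
  note iX = idn_in[OF X]
  have i: "scale a (idn X) \<star> scale b (idn X) = scale (a * b) (idn X)" for a b
    using scale_comp(1)[OF iX scale_in[OF iX]] scale_comp(2)[OF iX iX] comp_idn(1)[OF iX] by (simp add: scale_scale)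
  show "FAr ?T (LUnt (Vec K) X) \<star> (FTens ?T (Unt (Vec K), X) \<star> (FUnt ?T \<boxtimes> Idn (Vec K) (FOb ?T X))) = LUnt (Vec K) (FOb ?T X)"
    using X one scale_tens[of "inverse (c \<one> \<one>)" "idn (delta \<one>)" 1 "idn X"] tens_unit(1)[OF iX] nz[of \<one> \<one>]
      comp_idn(2)[OF iX] by (simp add: scalar2_unit[OF c X] i twisted_FAr[OF iX])
  show "FAr ?T (RUnt (Vec K) X) \<star> (FTens ?T (X, Unt (Vec K)) \<star> (Idn (Vec K) (FOb ?T X) \<boxtimes> FUnt ?T)) = RUnt (Vec K) (FOb ?T X)"
    using X one scale_tens[of 1 "idn X" "inverse (c \<one> \<one>)" "idn (delta \<one>)"] tens_unit(2)[OF iX] nz[of \<one> \<one>]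
      comp_idn(2)[OF iX] by (simp add: scalar2_unit[OF c X] i twisted_FAr[OF iX])
  fix Y assume "Y \<in> Ob (Vec K)"
  then have Y: "Y \<in> obj" by simp
  note s = scalar2_in[OF X Y]
  show "FTens ?T (X, Y) \<in> arr (TensO (Vec K) (FOb ?T X) (FOb ?T Y)) (FOb ?T (TensO (Vec K) X Y))"
    using X Y s by simp
  have "scalar2 K (\<lambda>k l. inverse (c k l)) X Y \<star> scalar2 K c X Y = idn (X \<boxdot> Y)"
    "scalar2 K c X Y \<star> scalar2 K (\<lambda>k l. inverse (c k l)) X Y = idn (X \<boxdot> Y)"
    unfolding scalar2_mult[OF X Y] scalar2_one[OF X Y, symmetric] using nz by (auto intro!: scalar2_cong)
  then show "iso_arrow (Vec K) (FTens ?T (X, Y))"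
    using X Y s iso_arrow_iff[OF s] by auto
  fix Z assume "Z \<in> Ob (Vec K)"
  then have Z: "Z \<in> obj" by simp
  note XYZ = tensO_obj[OF tensO_obj[OF X Y] Z]
  have XYZ': "X \<boxdot> (Y \<boxdot> Z) = X \<boxdot> Y \<boxdot> Z" using tensO_assoc[OF X Y Z] by simp
  have t: "scalar2 K c (X \<boxdot> Y) Z \<star> (scalar2 K c X Y \<boxtimes> idn Z) \<in> arr (X \<boxdot> Y \<boxdot> Z) (X \<boxdot> Y \<boxdot> Z)"
    by (intro comp_in[OF scalar2_in tens_in[OF scalar2_in idn_in]] tensO_obj X Y Z)
  have t': "idn X \<boxtimes> scalar2 K c Y Z \<in> arr (X \<boxdot> Y \<boxdot> Z) (X \<boxdot> Y \<boxdot> Z)"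
    using tens_in[OF idn_in[OF X] scalar2_in[OF Y Z, of c]] XYZ' by simp
  show "FAr ?T (Assc (Vec K) X Y Z) \<star> (FTens ?T (TensO (Vec K) X Y, Z) \<star> (FTens ?T (X, Y) \<boxtimes> Idn (Vec K) (FOb ?T Z))) =
    FTens ?T (X, TensO (Vec K) Y Z) \<star> ((Idn (Vec K) (FOb ?T X) \<boxtimes> FTens ?T (Y, Z)) \<star> Assc (Vec K) (FOb ?T X) (FOb ?T Y) (FOb ?T Z))"
    using X Y Z scalar2_assoc[OF c X Y Z] comp_idn(2)[OF t] comp_idn(1)[OF t']
    by (simp add: twisted_FAr[OF idn_in[OF XYZ]])
qed

lemma twisted_Aut0_ob:
  assumes c: "cocycle2 c"
  shows "twisted_id K c \<in> Aut0_ob"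
proof -
  let ?T = "twisted_id K c"
  \<comment> \<open>On objects and arrows \<open>?T\<close> is the identity, so it is its own
    quasi-inverse, with identity transformations on both sides.\<close>
  have id: "nat_iso (Vec K) (Vec K) (\<lambda>X. FOb ?T (FOb ?T X)) (\<lambda>f. FAr ?T (FAr ?T f)) (\<lambda>X. X) (\<lambda>f. f) (\<lambda>X\<in>obj. idn X)"
    unfolding nat_iso_def
  proof (intro conjI ballI)
    show "(\<lambda>X\<in>obj. idn X) \<in> Ob (Vec K) \<rightarrow>\<^sub>E Ar (Vec K)" using arrD(1)[OF idn_in] by auto
    fix f assume "f \<in> Ar (Vec K)"
    then obtain X Y where f: "f \<in> arr X Y" by (auto simp: Ar_iff)
    show "(\<lambda>X\<in>obj. idn X) (Cd (Vec K) f) \<star> FAr ?T (FAr ?T f) = f \<star> (\<lambda>X\<in>obj. idn X) (Dm (Vec K) f)"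
      using f arrD[OF f] arr_objD[OF f] by (simp add: twisted_FAr[OF f])
  qed (auto simp: iso_idn)
  have "is_equivalence (Vec K) (Vec K) (FOb ?T) (FAr ?T)"
    unfolding is_equivalence_def using twisted_functor id by blast
  moreover have "isomorphic (Vec K) (FOb ?T X) X" if "X \<in> obj" for X
    unfolding isomorphic_def using that iso_idn[OF that] idn_in[OF that] by auto
  ultimately show ?thesis
    using twisted_monoidal[OF c] twisted_linear by (simp add: Aut0_ob_iff tensor_autoequivalences_def)
qed

lemma twisted_cong:
  assumes "\<And>k l. k \<in> carrier K \<Longrightarrow> l \<in> carrier K \<Longrightarrow> c k l = d k l"
  shows "twisted_id K c = twisted_id K d"
proof -
  have "scalar2 K c = scalar2 K d" using scalar2_cong[OF assms] by (intro ext) simp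
  then show ?thesis using assms[of \<one> \<one>] by (simp add: twisted_id_def)
qed

text \<open>An equality of functors, not only an isomorphism: composites never leave the twisted
  identities, and coefficients multiply.\<close>

lemma twisted_fun_comp: "fun_comp (twisted_id K c) (twisted_id K d) = twisted_id K (\<lambda>k l. c k l * d k l)"
proof -
  have "(\<lambda>X\<in>obj. FOb (twisted_id K c) (FOb (twisted_id K d) X)) = (\<lambda>X\<in>obj. X)" by (auto intro!: restrict_ext)
  moreover have "(\<lambda>f\<in>gvs_arrows K. FAr (twisted_id K c) (FAr (twisted_id K d) f)) = (\<lambda>f\<in>gvs_arrows K. f)"
    by (auto intro!: restrict_ext)
  moreover have "(\<lambda>(X, Y)\<in>obj \<times> obj. FAr (twisted_id K c) (FTens (twisted_id K d) (X, Y)) \<star>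
      FTens (twisted_id K c) (FOb (twisted_id K d) X, FOb (twisted_id K d) Y)) =
     (\<lambda>(X, Y)\<in>obj \<times> obj. scalar2 K (\<lambda>k l. c k l * d k l) X Y)"
    by (auto intro!: restrict_ext simp: twisted_FAr[OF scalar2_in] scalar2_mult mult.commute)
  moreover have "FAr (twisted_id K c) (FUnt (twisted_id K d)) \<star> FUnt (twisted_id K c) =
     scale (inverse (c \<one> \<one> * d \<one> \<one>)) (idn (delta \<one>))"
    by (simp add: linear_functor_scale_idn twisted_linear_functor scale_idn_comp mult.commute)
  ultimately show ?thesis
    unfolding mfun_comp_def by (subst (3) twisted_id_def) simp
qed

lemma twisted_fun_id: "fun_id = twisted_id K (\<lambda>_ _. 1)"
  by (auto simp: mfun_id_def twisted_id_def scalar2_one intro!: restrict_ext)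

lemma tens_coeff_twisted: "k \<in> carrier K \<Longrightarrow> l \<in> carrier K \<Longrightarrow> tens_coeff (twisted_id K c) k l = c k l"
  by (simp add: tens_coeff_def scalar2_delta)

lemma cocycle2_mult: "cocycle2 c \<Longrightarrow> cocycle2 d \<Longrightarrow> cocycle2 (\<lambda>k l. c k l * d k l)"
  unfolding cocycle2_def by (auto simp: mult_ac)

lemma cocycle2_one: "cocycle2 (\<lambda>_ _. 1)"
  by (simp add: cocycle2_def)

text \<open>A calculus for the arrows of an action given by cochains: identities, composition and
  tensor product in \<open>Aut0\<close> become constants and pointwise products, so coherence axioms
  turn into identities between functions on \<open>K\<close>.\<close>

definition scalar_trans :: "('k \<Rightarrow> 'k \<Rightarrow> complex) \<Rightarrow> ('k \<Rightarrow> complex) \<Rightarrow> ('k \<Rightarrow> 'k \<Rightarrow> complex) \<Rightarrow> ('k gvs, 'k gmap) mtrans" where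
  "scalar_trans c t d = (twisted_id K c, (\<lambda>X\<in>obj. scalar1 K t X), twisted_id K d)"

lemma scalar_trans_cong:
  assumes "\<And>k l. k \<in> carrier K \<Longrightarrow> l \<in> carrier K \<Longrightarrow> c k l = c' k l"
    "\<And>k l. k \<in> carrier K \<Longrightarrow> l \<in> carrier K \<Longrightarrow> d k l = d' k l"
    "\<And>k. k \<in> carrier K \<Longrightarrow> t k = t' k"
  shows "scalar_trans c t d = scalar_trans c' t' d'"
  using twisted_cong[OF assms(1)] twisted_cong[OF assms(2)] scalar1_cong[of t t', OF assms(3)]
  by (simp add: scalar_trans_def)

text \<open>Both sides multiply an arrow out of the line of degree \<open>k\<close> by
  \<open>t k\<close>, hence agree. So \<open>glue_monoidal\<close> becomes available for block
  scalar transformations.\<close>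

lemma glue_twisted: "X \<in> obj \<Longrightarrow> glue t (twisted_id K c) (twisted_id K d) X = scalar1 K t X"
  using glue_in[OF twisted_linear_functor twisted_linear_functor, of X t c d] glue_comp[OF twisted_linear_functor twisted_linear_functor, of _ _ X t c d]
  by (intro idn_epi1[OF _ _ scalar1_in]) (simp_all add: twisted_FAr scalar1_comp)

lemma scalar_trans_Idn: "Idn Aut0 (twisted_id K c) = scalar_trans c (\<lambda>_. 1) c"
  by (auto simp: scalar_trans_def scalar1_one intro!: restrict_ext)

text \<open>Composition in \<open>Aut0\<close> discards the middle object, so the labels
  \<open>d\<close> and \<open>d'\<close> may be written differently.\<close>

lemma scalar_trans_Cmp: "Cmp Aut0 (scalar_trans d t' e) (scalar_trans c t d') = scalar_trans c (\<lambda>k. t' k * t k) e"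
  by (auto simp: scalar_trans_def scalar1_mult intro!: restrict_ext)

lemma scalar_trans_TensA: "TensA Aut0 (scalar_trans c t d) (scalar_trans c' t' d') =
    scalar_trans (\<lambda>k l. c k l * c' k l) (\<lambda>k. t k * t' k) (\<lambda>k l. d k l * d' k l)"
  by (auto simp: scalar_trans_def scalar1_mult twisted_fun_comp twisted_FAr[OF scalar1_in] intro!: restrict_ext)

lemma scalar_trans_arrow:
  assumes "cocycle2 c" "cocycle2 d" "\<And>k. k \<in> carrier K \<Longrightarrow> t k \<noteq> 0"
    "\<And>k l. k \<in> carrier K \<Longrightarrow> l \<in> carrier K \<Longrightarrow> t (k \<otimes> l) * c k l = d k l * t k * t l"
  shows "scalar_trans c t d \<in> arrows Aut0 (twisted_id K c) (twisted_id K d)"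
proof -
  have "monoidal_nat_iso (Vec K) (Vec K) (twisted_id K c) (twisted_id K d)
     (\<lambda>X\<in>obj. glue t (twisted_id K c) (twisted_id K d) X)"
    using assms by (intro glue_monoidal twisted_Aut0_ob) (auto simp: tens_coeff_twisted)
  moreover have "(\<lambda>X\<in>obj. glue t (twisted_id K c) (twisted_id K d) X) = (\<lambda>X\<in>obj. scalar1 K t X)"
    by (auto simp: glue_twisted intro!: restrict_ext)
  ultimately show ?thesis using assms twisted_Aut0_ob by (simp add: scalar_trans_def Aut0_arr_iff)
qed

lemma scalar_trans_iso:
  assumes c: "cocycle2 c" and d: "cocycle2 d" and t: "\<And>k. k \<in> carrier K \<Longrightarrow> t k \<noteq> 0"
    and eq: "\<And>k l. k \<in> carrier K \<Longrightarrow> l \<in> carrier K \<Longrightarrow> t (k \<otimes> l) * c k l = d k l * t k * t l"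
  shows "iso_arrow Aut0 (scalar_trans c t d)"
proof -
  let ?u = "\<lambda>k. inverse (t k)"
  have "?u (k \<otimes> l) * d k l = c k l * ?u k * ?u l" if "k \<in> carrier K" "l \<in> carrier K" for k l
    using eq[OF that] t that by (simp add: field_simps)
  then have u: "scalar_trans d ?u c \<in> arrows Aut0 (twisted_id K d) (twisted_id K c)"
    using t by (intro scalar_trans_arrow c d) auto
  have "Cmp Aut0 (scalar_trans d ?u c) (scalar_trans c t d) = Idn Aut0 (twisted_id K c)"
    "Cmp Aut0 (scalar_trans c t d) (scalar_trans d ?u c) = Idn Aut0 (twisted_id K d)"
    unfolding scalar_trans_Cmp scalar_trans_Idn using t by (auto intro!: scalar_trans_cong)
  then show ?thesis
    using u scalar_trans_arrow[OF assms] unfolding iso_arrow_def arrows_def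
    by (intro conjI bexI[of _ "scalar_trans d ?u c"]) (simp_all del: Aut0_simps(1))
qed

end

context group_pair begin

lemma action_of_simps [simp]:
  "q \<in> carrier Q \<Longrightarrow> FOb (action_of Q K \<omega> \<eta>) q = twisted_id K (\<omega> q)"
  "q \<in> carrier Q \<Longrightarrow> FAr (action_of Q K \<omega> \<eta>) q = scalar_trans (\<omega> q) (\<lambda>_. 1) (\<omega> q)"
  "q \<in> carrier Q \<Longrightarrow> r \<in> carrier Q \<Longrightarrow> FTens (action_of Q K \<omega> \<eta>) (q, r) =
     scalar_trans (\<lambda>k l. \<omega> q k l * \<omega> r k l) (\<lambda>k. \<eta> k q r) (\<omega> (q \<otimes>\<^bsub>Q\<^esub> r))"
  "FUnt (action_of Q K \<omega> \<eta>) = scalar_trans (\<lambda>_ _. 1) (\<lambda>k. inverse (\<eta> k \<one>\<^bsub>Q\<^esub> \<one>\<^bsub>Q\<^esub>)) (\<omega> \<one>\<^bsub>Q\<^esub>)"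
  by (simp_all add: action_of_def scalar_trans_Idn[symmetric] twisted_fun_comp twisted_fun_id scalar_trans_def del: Aut0_simps(1))

lemma omega_of_action_of:
  "q \<in> carrier Q \<Longrightarrow> k \<in> carrier K \<Longrightarrow> l \<in> carrier K \<Longrightarrow> omega_of (action_of Q K \<omega> \<eta>) q k l = \<omega> q k l"
  by (simp add: omega_of_def tens_coeff_twisted)

lemma eta_of_action_of:
  "k \<in> carrier K \<Longrightarrow> q \<in> carrier Q \<Longrightarrow> r \<in> carrier Q \<Longrightarrow> eta_of (action_of Q K \<omega> \<eta>) k q r = \<eta> k q r"
  by (simp add: eta_of_def tens_trans_def scalar_trans_def trans_coeff_def scalar1_delta)

lemma action_of_in_acts:
  assumes nv: "nonvanishing Q K \<omega>" "nonvanishing K Q \<eta>" and co: "cocycle_conditions Q K \<omega> \<eta>"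
  shows "action_of Q K \<omega> \<eta> \<in> acts"
proof -
  let ?A = "action_of Q K \<omega> \<eta>"
  have c1: "\<eta> (k \<otimes> l) q r * (\<omega> q k l * \<omega> r k l) = \<omega> (q \<otimes>\<^bsub>Q\<^esub> r) k l * \<eta> k q r * \<eta> l q r"
    if "q \<in> carrier Q" "r \<in> carrier Q" "k \<in> carrier K" "l \<in> carrier K" for q r k l
    using co that unfolding cocycle_conditions_iff[OF nv] by blast
  have c2: "cocycle2 (\<omega> q)" if "q \<in> carrier Q" for q
    using co nv(1) that unfolding cocycle_conditions_iff[OF nv] cocycle2_def nonvanishing_def by blast
  have c3: "\<eta> k (q \<otimes>\<^bsub>Q\<^esub> r) s * \<eta> k q r = \<eta> k q (r \<otimes>\<^bsub>Q\<^esub> s) * \<eta> k r s"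
    if "k \<in> carrier K" "q \<in> carrier Q" "r \<in> carrier Q" "s \<in> carrier Q" for k q r s
    using co that unfolding cocycle_conditions_iff[OF nv] by blast
  have nz: "\<eta> k q r \<noteq> 0" "\<omega> q k l \<noteq> 0" if "k \<in> carrier K" "l \<in> carrier K" "q \<in> carrier Q" "r \<in> carrier Q" for k l q r
    using nv that by (auto simp: nonvanishing_def)
  \<comment> \<open>The argument of \<open>cocycle2_unit\<close>, now in the Q-variables: a cocycle
    that is not normalized is constant along the neutral element, and the unit isomorphism inverts
    that constant.\<close>
  have unit: "\<eta> k \<one>\<^bsub>Q\<^esub> q * inverse (\<eta> k \<one>\<^bsub>Q\<^esub> \<one>\<^bsub>Q\<^esub>) = 1" "\<eta> k q \<one>\<^bsub>Q\<^esub> * inverse (\<eta> k \<one>\<^bsub>Q\<^esub> \<one>\<^bsub>Q\<^esub>) = 1"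
    if "k \<in> carrier K" "q \<in> carrier Q" for k q
    using c3[of k "\<one>\<^bsub>Q\<^esub>" "\<one>\<^bsub>Q\<^esub>" q] c3[of k q "\<one>\<^bsub>Q\<^esub>" "\<one>\<^bsub>Q\<^esub>"] nz(1)[OF that(1) that(1)] that
    by (auto simp: field_simps)
  have id: "scalar_trans (\<omega> q) (\<lambda>_. 1) (\<omega> q) \<in> arrows Aut0 (twisted_id K (\<omega> q)) (twisted_id K (\<omega> q))"
    if "q \<in> carrier Q" for q
    using c2[OF that] by (intro scalar_trans_arrow) auto
  have tens_trans: "scalar_trans (\<lambda>k l. \<omega> q k l * \<omega> r k l) (\<lambda>k. \<eta> k q r) (\<omega> (q \<otimes>\<^bsub>Q\<^esub> r)) \<in>
       arrows Aut0 (twisted_id K (\<lambda>k l. \<omega> q k l * \<omega> r k l)) (twisted_id K (\<omega> (q \<otimes>\<^bsub>Q\<^esub> r)))"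
    and tens_trans_iso: "iso_arrow Aut0 (scalar_trans (\<lambda>k l. \<omega> q k l * \<omega> r k l) (\<lambda>k. \<eta> k q r) (\<omega> (q \<otimes>\<^bsub>Q\<^esub> r)))"
    if "q \<in> carrier Q" "r \<in> carrier Q" for q r
    using c1[OF that] nz that by (auto intro!: scalar_trans_arrow scalar_trans_iso cocycle2_mult c2)
  \<comment> \<open>The mixed condition at the neutral element of \<open>Q\<close> in both
    arguments, with one \<open>\<omega>\<close> cancelled; it says that the unit transformation out
    of the untwisted identity is monoidal.\<close>
  have u: "inverse (\<eta> (k \<otimes> l) \<one>\<^bsub>Q\<^esub> \<one>\<^bsub>Q\<^esub>) * 1 =
       \<omega> \<one>\<^bsub>Q\<^esub> k l * inverse (\<eta> k \<one>\<^bsub>Q\<^esub> \<one>\<^bsub>Q\<^esub>) * inverse (\<eta> l \<one>\<^bsub>Q\<^esub> \<one>\<^bsub>Q\<^esub>)"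
    if k: "k \<in> carrier K" "l \<in> carrier K" for k l
    using c1[of "\<one>\<^bsub>Q\<^esub>" "\<one>\<^bsub>Q\<^esub>" k l] k nz[of k l "\<one>\<^bsub>Q\<^esub>" "\<one>\<^bsub>Q\<^esub>"] nz[of l k "\<one>\<^bsub>Q\<^esub>" "\<one>\<^bsub>Q\<^esub>"]
      nz[of "k \<otimes> l" k "\<one>\<^bsub>Q\<^esub>" "\<one>\<^bsub>Q\<^esub>"] by (simp add: field_simps)
  have unit_trans: "scalar_trans (\<lambda>_ _. 1) (\<lambda>k. inverse (\<eta> k \<one>\<^bsub>Q\<^esub> \<one>\<^bsub>Q\<^esub>)) (\<omega> \<one>\<^bsub>Q\<^esub>) \<in>
      arrows Aut0 (twisted_id K (\<lambda>_ _. 1)) (twisted_id K (\<omega> \<one>\<^bsub>Q\<^esub>))"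
    and unit_trans_iso: "iso_arrow Aut0 (scalar_trans (\<lambda>_ _. 1) (\<lambda>k. inverse (\<eta> k \<one>\<^bsub>Q\<^esub> \<one>\<^bsub>Q\<^esub>)) (\<omega> \<one>\<^bsub>Q\<^esub>))"
    using u nz by (auto intro!: scalar_trans_arrow scalar_trans_iso cocycle2_one c2)
  show ?thesis
    unfolding monoidal_functors_def mem_Collect_eq is_functor_def
  proof (intro conjI ballI impI)
    show "FOb ?A \<in> Ob (disc Q) \<rightarrow>\<^sub>E Aut0_ob" using twisted_Aut0_ob[OF c2] by (auto simp: action_of_def)
    show "FAr ?A \<in> Ar (disc Q) \<rightarrow>\<^sub>E Ar Aut0"
      using id by (auto simp: action_of_def scalar_trans_Idn arrows_def simp del: Aut0_simps(1))
    show "FTens ?A \<in> Ob (disc Q) \<times> Ob (disc Q) \<rightarrow>\<^sub>E Ar Aut0"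
    proof (rule PiE_I)
      fix p assume "p \<in> Ob (disc Q) \<times> Ob (disc Q)"
      then obtain q r where "p = (q, r)" "q \<in> carrier Q" "r \<in> carrier Q" by auto
      then show "FTens ?A p \<in> Ar Aut0" using tens_trans[of q r] by (simp add: arrows_def)
    qed (auto simp: action_of_def)
    show "FUnt ?A \<in> arrows Aut0 (Unt Aut0) (FOb ?A (Unt (disc Q)))" using unit_trans by (simp add: twisted_fun_id)
    show "iso_arrow Aut0 (FUnt ?A)" using unit_trans_iso by simp
  next
    fix q assume "q \<in> Ob (disc Q)"
    then have q: "q \<in> carrier Q" by simp
    then show "FAr ?A (Idn (disc Q) q) = Idn Aut0 (FOb ?A q)" by (simp add: scalar_trans_Idn del: Aut0_simps(1))
    show "Cmp Aut0 (FAr ?A (LUnt (disc Q) q)) (Cmp Aut0 (FTens ?A (Unt (disc Q), q)) (TensA Aut0 (FUnt ?A) (Idn Aut0 (FOb ?A q)))) =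
        LUnt Aut0 (FOb ?A q)"
      using q by (simp add: scalar_trans_Idn scalar_trans_TensA scalar_trans_Cmp del: Aut0_simps(1)) (rule scalar_trans_cong; simp add: unit)
    show "Cmp Aut0 (FAr ?A (RUnt (disc Q) q)) (Cmp Aut0 (FTens ?A (q, Unt (disc Q))) (TensA Aut0 (Idn Aut0 (FOb ?A q)) (FUnt ?A))) =
        RUnt Aut0 (FOb ?A q)"
      using q by (simp add: scalar_trans_Idn scalar_trans_TensA scalar_trans_Cmp del: Aut0_simps(1)) (rule scalar_trans_cong; simp add: unit)
    fix r assume "r \<in> Ob (disc Q)"
    then have r: "r \<in> carrier Q" by simp
    show "FTens ?A (q, r) \<in> arrows Aut0 (TensO Aut0 (FOb ?A q) (FOb ?A r)) (FOb ?A (TensO (disc Q) q r))"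
      using tens_trans[OF q r] q r by (simp add: twisted_fun_comp)
    show "iso_arrow Aut0 (FTens ?A (q, r))" using tens_trans_iso q r by simp
    fix s assume "s \<in> Ob (disc Q)"
    then have s: "s \<in> carrier Q" by simp
    show "Cmp Aut0 (FAr ?A (Assc (disc Q) q r s)) (Cmp Aut0 (FTens ?A (TensO (disc Q) q r, s))
         (TensA Aut0 (FTens ?A (q, r)) (Idn Aut0 (FOb ?A s)))) =
       Cmp Aut0 (FTens ?A (q, TensO (disc Q) r s)) (Cmp Aut0 (TensA Aut0 (Idn Aut0 (FOb ?A q)) (FTens ?A (r, s)))
         (Assc Aut0 (FOb ?A q) (FOb ?A r) (FOb ?A s)))"
      using q r s by (simp add: scalar_trans_Idn scalar_trans_TensA scalar_trans_Cmp twisted_fun_comp Q.m_assoc del: Aut0_simps(1))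
        (rule scalar_trans_cong; simp add: c3 mult.assoc)
  next
    fix q assume "q \<in> Ar (disc Q)"
    then have q: "q \<in> carrier Q" by simp
    then show "Dm Aut0 (FAr ?A q) = FOb ?A (Dm (disc Q) q)" "Cd Aut0 (FAr ?A q) = FOb ?A (Cd (disc Q) q)"
      using id[OF q] by (auto simp: arrows_def)
    fix r assume "r \<in> Ar (disc Q)"
    then have r: "r \<in> carrier Q" by simp
    show "Cmp Aut0 (FAr ?A (TensA (disc Q) q r)) (FTens ?A (Dm (disc Q) q, Dm (disc Q) r)) =
       Cmp Aut0 (FTens ?A (Cd (disc Q) q, Cd (disc Q) r)) (TensA Aut0 (FAr ?A q) (FAr ?A r))"
      using q r by (simp add: scalar_trans_TensA scalar_trans_Cmp)
    assume "Dm (disc Q) r = Cd (disc Q) q"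
    then show "FAr ?A (Cmp (disc Q) r q) = Cmp Aut0 (FAr ?A r) (FAr ?A q)"
      using q r by (simp add: scalar_trans_Cmp)
  qed
qed

text \<open>The cochains read off from the action are \<open>\<omega>\<close> and
  \<open>\<eta>\<close> on the carriers, so necessity is \<open>acts_cocycle\<close> applied to the
  action itself.\<close>

lemma action_of_iff:
  assumes nv: "nonvanishing Q K \<omega>" "nonvanishing K Q \<eta>"
  shows "action_of Q K \<omega> \<eta> \<in> acts \<longleftrightarrow> cocycle_conditions Q K \<omega> \<eta>"
proof
  let ?A = "action_of Q K \<omega> \<eta>"
  assume A: "?A \<in> acts"
  have "cocycle_conditions Q K (omega_of ?A) (eta_of ?A)" by (rule acts_cocycle[OF A])
  then show "cocycle_conditions Q K \<omega> \<eta>"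
    unfolding cocycle_conditions_iff[OF nv] cocycle_conditions_iff[OF acts_nonvanishing[OF A]]
    by (simp add: omega_of_action_of eta_of_action_of)
qed (rule action_of_in_acts[OF nv])

end

section \<open>The symmetry between the two groups\<close>

lemma cohomologous_refl: "cohomologous Q K \<omega> \<eta> \<omega> \<eta>"
  unfolding cohomologous_def by (intro exI[of _ "\<lambda>_ _. 1"]) simp

lemma cohomologous_sym:
  assumes "cohomologous Q K \<omega> \<eta> \<omega>' \<eta>'" "group Q" "group K"
  shows "cohomologous Q K \<omega>' \<eta>' \<omega> \<eta>"
proof -
  interpret Q: group Q by fact
  interpret K: group K by fact
  from assms(1) obtain \<theta> where \<theta>: "\<forall>q\<in>carrier Q. \<forall>k\<in>carrier K. \<theta> q k \<noteq> 0"
    "\<forall>q\<in>carrier Q. \<forall>k\<in>carrier K. \<forall>l\<in>carrier K. \<theta> q (k \<otimes>\<^bsub>K\<^esub> l) * \<omega> q k l = \<omega>' q k l * \<theta> q k * \<theta> q l"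
    "\<forall>k\<in>carrier K. \<forall>q\<in>carrier Q. \<forall>r\<in>carrier Q. \<theta> (q \<otimes>\<^bsub>Q\<^esub> r) k * \<eta> k q r = \<eta>' k q r * \<theta> q k * \<theta> r k"
    unfolding cohomologous_def by blast
  have "inverse (\<theta> q (k \<otimes>\<^bsub>K\<^esub> l)) * \<omega>' q k l = \<omega> q k l * inverse (\<theta> q k) * inverse (\<theta> q l)"
    if "q \<in> carrier Q" "k \<in> carrier K" "l \<in> carrier K" for q k l
    using \<theta>(1,2) that by (simp add: field_simps)
  moreover have "inverse (\<theta> (q \<otimes>\<^bsub>Q\<^esub> r) k) * \<eta>' k q r = \<eta> k q r * inverse (\<theta> q k) * inverse (\<theta> r k)"
    if "q \<in> carrier Q" "r \<in> carrier Q" "k \<in> carrier K" for q k r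
    using \<theta>(1,3) that by (simp add: field_simps)
  ultimately show ?thesis
    unfolding cohomologous_def using \<theta>(1) by (intro exI[of _ "\<lambda>q k. inverse (\<theta> q k)"]) auto
qed

lemma cohomologous_trans:
  assumes "cohomologous Q K \<omega> \<eta> \<omega>' \<eta>'" "cohomologous Q K \<omega>' \<eta>' \<omega>'' \<eta>''"
  shows "cohomologous Q K \<omega> \<eta> \<omega>'' \<eta>''"
proof -
  from assms(1) obtain \<theta> where \<theta>: "\<forall>q\<in>carrier Q. \<forall>k\<in>carrier K. \<theta> q k \<noteq> 0"
    "\<forall>q\<in>carrier Q. \<forall>k\<in>carrier K. \<forall>l\<in>carrier K. \<theta> q (k \<otimes>\<^bsub>K\<^esub> l) * \<omega> q k l = \<omega>' q k l * \<theta> q k * \<theta> q l"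
    "\<forall>k\<in>carrier K. \<forall>q\<in>carrier Q. \<forall>r\<in>carrier Q. \<theta> (q \<otimes>\<^bsub>Q\<^esub> r) k * \<eta> k q r = \<eta>' k q r * \<theta> q k * \<theta> r k"
    unfolding cohomologous_def by blast
  from assms(2) obtain \<psi> where \<psi>: "\<forall>q\<in>carrier Q. \<forall>k\<in>carrier K. \<psi> q k \<noteq> 0"
    "\<forall>q\<in>carrier Q. \<forall>k\<in>carrier K. \<forall>l\<in>carrier K. \<psi> q (k \<otimes>\<^bsub>K\<^esub> l) * \<omega>' q k l = \<omega>'' q k l * \<psi> q k * \<psi> q l"
    "\<forall>k\<in>carrier K. \<forall>q\<in>carrier Q. \<forall>r\<in>carrier Q. \<psi> (q \<otimes>\<^bsub>Q\<^esub> r) k * \<eta>' k q r = \<eta>'' k q r * \<psi> q k * \<psi> r k"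
    unfolding cohomologous_def by blast
  \<comment> \<open>The product of two witnesses is the witness for the composite; both defining
    relations have this one shape.\<close>
  have *: "(s * p) * x = z * (s1 * p1) * (s2 * p2)"
    if "s * x = y * s1 * s2" "p * y = z * p1 * p2" for s p x y z s1 s2 p1 p2 :: complex
  proof -
    have "(s * p) * x = p * y * s1 * s2" using that(1) by (simp add: mult_ac)
    then show ?thesis using that(2) by (simp add: mult_ac)
  qed
  show ?thesis
    unfolding cohomologous_def
  proof (intro exI[of _ "\<lambda>q k. \<theta> q k * \<psi> q k"] conjI ballI)
    fix q k assume "q \<in> carrier Q" "k \<in> carrier K"
    then show "\<theta> q k * \<psi> q k \<noteq> 0" using \<theta>(1) \<psi>(1) by simp
  next
    fix q k l assume "q \<in> carrier Q" "k \<in> carrier K" "l \<in> carrier K"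
    then show "\<theta> q (k \<otimes>\<^bsub>K\<^esub> l) * \<psi> q (k \<otimes>\<^bsub>K\<^esub> l) * \<omega> q k l = \<omega>'' q k l * (\<theta> q k * \<psi> q k) * (\<theta> q l * \<psi> q l)"
      using \<theta>(2) \<psi>(2) by (intro *[of _ _ "\<omega>' q k l"]) auto
  next
    fix k q r assume "k \<in> carrier K" "q \<in> carrier Q" "r \<in> carrier Q"
    then show "\<theta> (q \<otimes>\<^bsub>Q\<^esub> r) k * \<psi> (q \<otimes>\<^bsub>Q\<^esub> r) k * \<eta> k q r = \<eta>'' k q r * (\<theta> q k * \<psi> q k) * (\<theta> r k * \<psi> r k)"
      using \<theta>(3) \<psi>(3) by (intro *[of _ _ "\<eta>' k q r"]) auto
  qed
qed

lemma cohomologous_swap: "cohomologous Q K \<omega> \<eta> \<omega>' \<eta>' \<Longrightarrow> cohomologous K Q \<eta> \<omega> \<eta>' \<omega>'"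
  unfolding cohomologous_def by (elim exE, rule_tac x = "\<lambda>k q. \<theta> q k" in exI) auto

text \<open>Cochains read off from a rebuilt action agree with the given functions on the carriers
  only, so equality of functions is not at hand.\<close>

lemma cohomologous_cong:
  assumes "\<And>q k l. q \<in> carrier Q \<Longrightarrow> k \<in> carrier K \<Longrightarrow> l \<in> carrier K \<Longrightarrow> \<omega> q k l = \<omega>1 q k l \<and> \<omega>' q k l = \<omega>1' q k l"
    "\<And>k q r. k \<in> carrier K \<Longrightarrow> q \<in> carrier Q \<Longrightarrow> r \<in> carrier Q \<Longrightarrow> \<eta> k q r = \<eta>1 k q r \<and> \<eta>' k q r = \<eta>1' k q r"
  shows "cohomologous Q K \<omega> \<eta> \<omega>' \<eta>' \<longleftrightarrow> cohomologous Q K \<omega>1 \<eta>1 \<omega>1' \<eta>1'"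
  unfolding cohomologous_def using assms by simp

lemma cocycle_conditions_swap: "cocycle_conditions Q K \<omega> \<eta> \<longleftrightarrow> cocycle_conditions K Q \<eta> \<omega>"
proof -
  have "cocycle_conditions K Q \<eta> \<omega>" if "cocycle_conditions Q K \<omega> \<eta>"
    using that unfolding cocycle_conditions_def by auto
  moreover have "cocycle_conditions Q K \<omega> \<eta>" if "cocycle_conditions K Q \<eta> \<omega>"
    using that unfolding cocycle_conditions_def by auto
  ultimately show ?thesis by blast
qed

text \<open>A map on representatives descends to a bijection of quotients: one direction of
  \<open>iff\<close> makes it well defined, the other injective, and \<open>surj\<close> asks for
  preimages only up to \<open>S\<close>. The formula for the values keeps the bijection computable
  on given actions.\<close>

lemma bij_betw_quotients:
  assumes R: "equiv A R" and S: "equiv B S" and T: "\<And>x. x \<in> A \<Longrightarrow> T x \<in> B"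
    and iff: "\<And>x y. x \<in> A \<Longrightarrow> y \<in> A \<Longrightarrow> (T x, T y) \<in> S \<longleftrightarrow> (x, y) \<in> R"
    and surj: "\<And>y. y \<in> B \<Longrightarrow> \<exists>x\<in>A. (T x, y) \<in> S"
  shows "\<exists>\<Phi>. bij_betw \<Phi> (A // R) (B // S) \<and> (\<forall>x\<in>A. \<Phi> (R `` {x}) = S `` {T x})"
proof -
  \<comment> \<open>The chosen representative is arbitrary; since \<open>T\<close> respects the
    relations, it does not affect the class.\<close>
  define \<Phi> where "\<Phi> X = S `` {T (SOME x. x \<in> X)}" for X
  have \<Phi>: "\<Phi> (R `` {x}) = S `` {T x}" if x: "x \<in> A" for x
  proof -
    have "x \<in> R `` {x}" using equiv_class_self[OF R x] .
    then have "(SOME y. y \<in> R `` {x}) \<in> R `` {x}" by (rule someI)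
    then have r: "(x, SOME y. y \<in> R `` {x}) \<in> R" by simp
    then have "(SOME y. y \<in> R `` {x}) \<in> A" using R equiv_class_eq_iff by metis
    then have "(T x, T (SOME y. y \<in> R `` {x})) \<in> S" using iff[OF x] r by blast
    then show ?thesis unfolding \<Phi>_def using equiv_class_eq[OF S] by blast
  qed
  have "bij_betw \<Phi> (A // R) (B // S)"
    unfolding bij_betw_def
  proof (intro conjI inj_onI)
    fix X Y assume "X \<in> A // R" "Y \<in> A // R" and eq: "\<Phi> X = \<Phi> Y"
    then obtain x y where x: "x \<in> A" "X = R `` {x}" and y: "y \<in> A" "Y = R `` {y}" by (auto elim!: quotientE)
    have "S `` {T x} = S `` {T y}" using eq x y \<Phi> by simp
    then have "(T x, T y) \<in> S" using eq_equiv_class[OF _ S T[OF y(1)]] by blast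
    then show "X = Y" using iff x y equiv_class_eq[OF R] by blast
  next
    show "\<Phi> ` (A // R) = B // S"
    proof
      show "\<Phi> ` (A // R) \<subseteq> B // S" using \<Phi> quotientI[OF T] by (auto elim!: quotientE)
      show "B // S \<subseteq> \<Phi> ` (A // R)"
      proof
        fix Y assume "Y \<in> B // S"
        then obtain y where y: "y \<in> B" "Y = S `` {y}" by (auto elim!: quotientE)
        obtain x where x: "x \<in> A" "(T x, y) \<in> S" using surj[OF y(1)] by blast
        then have "Y = \<Phi> (R `` {x})" using \<Phi> y equiv_class_eq[OF S] by blast
        then show "Y \<in> \<Phi> ` (A // R)" using imageI[OF quotientI[OF x(1), of R], of \<Phi>] by simp
      qed
    qed
  qed
  then show ?thesis using \<Phi> by blast
qed

context group_pair begin

lemma equiv_iff: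
  "(F, G) \<in> mfun_equiv (disc Q) Aut0 \<longleftrightarrow> F \<in> acts \<and> G \<in> acts \<and> cohomologous Q K (omega_of F) (eta_of F) (omega_of G) (eta_of G)"
  using equiv_cohomologous cohomologous_equiv by (auto simp: mfun_equiv_def)

text \<open>Reflexivity, symmetry and transitivity are inherited from \<open>cohomologous\<close>,
  where they amount to constant, inverse and product witnesses; no transformations have to be
  composed.\<close>

lemma equiv_mfun_equiv: "equiv acts (mfun_equiv (disc Q) Aut0)"
proof (rule equivI)
  show "mfun_equiv (disc Q) Aut0 \<subseteq> acts \<times> acts" by (auto simp: mfun_equiv_def)
  show "refl_on acts (mfun_equiv (disc Q) Aut0)"
    by (auto simp: refl_on_def equiv_iff cohomologous_refl)
  show "sym (mfun_equiv (disc Q) Aut0)"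
    by (auto simp: sym_def equiv_iff intro: cohomologous_sym[OF _ Q.is_group is_group])
  show "trans (mfun_equiv (disc Q) Aut0)"
    using cohomologous_trans by (fastforce simp: trans_def equiv_iff)
qed

text \<open>An action and the one rebuilt from its cochains have the same cochains on the carriers,
  so the constant witness 1 relates them.\<close>

lemma action_of_equiv:
  assumes F: "F \<in> acts"
  shows "(F, action_of Q K (omega_of F) (eta_of F)) \<in> mfun_equiv (disc Q) Aut0"
proof -
  have "cohomologous Q K (omega_of F) (eta_of F) (omega_of (action_of Q K (omega_of F) (eta_of F))) (eta_of (action_of Q K (omega_of F) (eta_of F))) \<longleftrightarrow>
    cohomologous Q K (omega_of F) (eta_of F) (omega_of F) (eta_of F)"
    by (rule cohomologous_cong) (simp_all add: omega_of_action_of eta_of_action_of)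
  then show ?thesis
    using F action_of_in_acts[OF acts_nonvanishing[OF F] acts_cocycle[OF F]] by (simp add: equiv_iff cohomologous_refl)
qed

lemma action_of_equiv_iff:
  assumes "action_of Q K \<omega> \<eta> \<in> acts" "action_of Q K \<omega>' \<eta>' \<in> acts"
  shows "(action_of Q K \<omega> \<eta>, action_of Q K \<omega>' \<eta>') \<in> mfun_equiv (disc Q) Aut0 \<longleftrightarrow> cohomologous Q K \<omega> \<eta> \<omega>' \<eta>'"
proof -
  let ?A = "action_of Q K \<omega> \<eta>" and ?B = "action_of Q K \<omega>' \<eta>'"
  have "cohomologous Q K (omega_of ?A) (eta_of ?A) (omega_of ?B) (eta_of ?B) \<longleftrightarrow> cohomologous Q K \<omega> \<eta> \<omega>' \<eta>'"
    by (rule cohomologous_cong) (simp_all add: omega_of_action_of eta_of_action_of)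
  then show ?thesis using assms by (simp add: equiv_iff)
qed

end

theorem mainTheorem5:
  fixes Q :: "('q, 'a) monoid_scheme" and K :: "('k, 'b) monoid_scheme"
  assumes "group Q" and "finite (carrier Q)" and "group K" and "finite (carrier K)"
  shows "\<exists>\<Phi>.
    bij_betw \<Phi> (Hom_2grp Q (Aut_tens0 (Vec K))) (Hom_2grp K (Aut_tens0 (Vec Q))) \<and>
    (\<forall>\<omega> \<eta>. nonvanishing Q K \<omega> \<and> nonvanishing K Q \<eta> \<longrightarrow>
       (action_of Q K \<omega> \<eta> \<in> actions Q K \<longleftrightarrow> cocycle_conditions Q K \<omega> \<eta>) \<and>
       (action_of K Q \<eta> \<omega> \<in> actions K Q \<longleftrightarrow> cocycle_conditions Q K \<omega> \<eta>) \<and>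
       (cocycle_conditions Q K \<omega> \<eta> \<longrightarrow>
          \<Phi> (hom_class Q (Aut_tens0 (Vec K)) (action_of Q K \<omega> \<eta>)) =
          hom_class K (Aut_tens0 (Vec Q)) (action_of K Q \<eta> \<omega>))) \<and>
    (\<forall>F \<in> actions Q K. \<exists>\<omega> \<eta>. nonvanishing Q K \<omega> \<and> nonvanishing K Q \<eta> \<and>
       cocycle_conditions Q K \<omega> \<eta> \<and>
       (F, action_of Q K \<omega> \<eta>) \<in> mfun_equiv (disc Q) (Aut_tens0 (Vec K))) \<and>
    (\<forall>G \<in> actions K Q. \<exists>\<omega> \<eta>. nonvanishing Q K \<omega> \<and> nonvanishing K Q \<eta> \<and>
       cocycle_conditions Q K \<omega> \<eta> \<and>
       (G, action_of K Q \<eta> \<omega>) \<in> mfun_equiv (disc K) (Aut_tens0 (Vec Q)))"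
proof -
  \<comment> \<open>Two interpretations supply the whole theory for both directions:
    \<open>A\<close> for actions of \<open>Q\<close> on \<open>Vec K\<close>, \<open>B\<close> for
    actions of \<open>K\<close> on \<open>Vec Q\<close>.\<close>
  interpret A: group_pair K Q
    using assms by (intro group_pair.intro fin_group.intro fin_group_axioms.intro)
  interpret B: group_pair Q K
    using assms by (intro group_pair.intro fin_group.intro fin_group_axioms.intro)
  \<comment> \<open>The exchange: the composition scalars of \<open>F\<close> become tensor
    coefficients, and its tensor coefficients become composition scalars.\<close>
  define T where "T F = action_of K Q (A.eta_of F) (A.omega_of F)" for F
  have T: "T F \<in> actions K Q" if F: "F \<in> actions Q K" for F
    unfolding T_def using A.acts_cocycle[OF F] A.acts_nonvanishing[OF F] cocycle_conditions_swap
    by (intro B.action_of_in_acts) auto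
  have TT: "(T F, T G) \<in> mfun_equiv (disc K) (Aut_tens0 (Vec Q)) \<longleftrightarrow>
      (F, G) \<in> mfun_equiv (disc Q) (Aut_tens0 (Vec K))"
    if F: "F \<in> actions Q K" and G: "G \<in> actions Q K" for F G
    using B.action_of_equiv_iff[OF T[OF F, unfolded T_def] T[OF G, unfolded T_def]] F G
      cohomologous_swap[of Q K] cohomologous_swap[of K Q] unfolding A.equiv_iff T_def by blast
  \<comment> \<open>Only an equivalence, because \<open>T\<close> uses the cochains read off again,
    which match \<open>\<eta>\<close> and \<open>\<omega>\<close> on the carriers but may differ
    elsewhere.\<close>
  have T_action: "(T (action_of Q K \<omega> \<eta>), action_of K Q \<eta> \<omega>) \<in> mfun_equiv (disc K) (Aut_tens0 (Vec Q))"
    if nv: "nonvanishing Q K \<omega>" "nonvanishing K Q \<eta>" and co: "cocycle_conditions Q K \<omega> \<eta>" for \<omega> \<eta>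
  proof -
    let ?F = "action_of Q K \<omega> \<eta>"
    have F: "?F \<in> actions Q K" by (rule A.action_of_in_acts[OF nv co])
    have G: "action_of K Q \<eta> \<omega> \<in> actions K Q"
      using co cocycle_conditions_swap by (intro B.action_of_in_acts nv) auto
    have "cohomologous K Q (A.eta_of ?F) (A.omega_of ?F) \<eta> \<omega> \<longleftrightarrow> cohomologous K Q \<eta> \<omega> \<eta> \<omega>"
      by (rule cohomologous_cong) (simp_all add: A.omega_of_action_of A.eta_of_action_of)
    then show ?thesis
      using B.action_of_equiv_iff[OF T[OF F, unfolded T_def] G] by (simp add: T_def cohomologous_refl)
  qed
  have ex: "\<exists>\<omega> \<eta>. nonvanishing Q K \<omega> \<and> nonvanishing K Q \<eta> \<and> cocycle_conditions Q K \<omega> \<eta> \<and>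
       (G, action_of K Q \<eta> \<omega>) \<in> mfun_equiv (disc K) (Aut_tens0 (Vec Q))" if G: "G \<in> actions K Q" for G
    using B.acts_nonvanishing[OF G] B.acts_cocycle[OF G] B.action_of_equiv[OF G] cocycle_conditions_swap by blast
  \<comment> \<open>Surjectivity on classes: replace \<open>G\<close> by the action of its cochains
    and take the action of \<open>Q\<close> with the same cochains as preimage.\<close>
  have "\<exists>F\<in>actions Q K. (T F, G) \<in> mfun_equiv (disc K) (Aut_tens0 (Vec Q))" if G: "G \<in> actions K Q" for G
  proof -
    obtain \<omega> \<eta> where nv: "nonvanishing Q K \<omega>" "nonvanishing K Q \<eta>" and co: "cocycle_conditions Q K \<omega> \<eta>"
      and eq: "(G, action_of K Q \<eta> \<omega>) \<in> mfun_equiv (disc K) (Aut_tens0 (Vec Q))" using ex[OF G] by blast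
    have "(T (action_of Q K \<omega> \<eta>), G) \<in> mfun_equiv (disc K) (Aut_tens0 (Vec Q))"
      using T_action[OF nv co] eq B.equiv_mfun_equiv unfolding equiv_def by (meson symD transD)
    then show ?thesis using A.action_of_in_acts[OF nv co] by blast
  qed
  from bij_betw_quotients[where T = T, OF A.equiv_mfun_equiv B.equiv_mfun_equiv T TT this]
  obtain \<Phi> where bij: "bij_betw \<Phi> (Hom_2grp Q (Aut_tens0 (Vec K))) (Hom_2grp K (Aut_tens0 (Vec Q)))"
    and \<Phi>: "\<And>F. F \<in> actions Q K \<Longrightarrow>
      \<Phi> (hom_class Q (Aut_tens0 (Vec K)) F) = hom_class K (Aut_tens0 (Vec Q)) (T F)"
    unfolding Hom_2grp_def hom_class_def by blast
  have "\<Phi> (hom_class Q (Aut_tens0 (Vec K)) (action_of Q K \<omega> \<eta>)) =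
      hom_class K (Aut_tens0 (Vec Q)) (action_of K Q \<eta> \<omega>)"
    if nv: "nonvanishing Q K \<omega>" "nonvanishing K Q \<eta>" and co: "cocycle_conditions Q K \<omega> \<eta>" for \<omega> \<eta>
    using \<Phi>[OF A.action_of_in_acts[OF nv co]] equiv_class_eq[OF B.equiv_mfun_equiv T_action[OF nv co]]
    by (simp add: hom_class_def)
  note \<Phi>_action = this
  show ?thesis
  proof (intro exI[of _ \<Phi>] conjI allI impI ballI bij ex)
    fix \<omega> \<eta> assume nv: "nonvanishing Q K \<omega> \<and> nonvanishing K Q \<eta>"
    show "action_of Q K \<omega> \<eta> \<in> actions Q K \<longleftrightarrow> cocycle_conditions Q K \<omega> \<eta>"
      using nv A.action_of_iff by simp
    show "action_of K Q \<eta> \<omega> \<in> actions K Q \<longleftrightarrow> cocycle_conditions Q K \<omega> \<eta>"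
      using nv B.action_of_iff cocycle_conditions_swap[of Q K] by simp
    assume "cocycle_conditions Q K \<omega> \<eta>"
    then show "\<Phi> (hom_class Q (Aut_tens0 (Vec K)) (action_of Q K \<omega> \<eta>)) =
        hom_class K (Aut_tens0 (Vec Q)) (action_of K Q \<eta> \<omega>)"
      using nv \<Phi>_action by simp
  next
    fix F assume F: "F \<in> actions Q K"
    show "\<exists>\<omega> \<eta>. nonvanishing Q K \<omega> \<and> nonvanishing K Q \<eta> \<and> cocycle_conditions Q K \<omega> \<eta> \<and>
       (F, action_of Q K \<omega> \<eta>) \<in> mfun_equiv (disc Q) (Aut_tens0 (Vec K))"
      using A.acts_nonvanishing[OF F] A.acts_cocycle[OF F] A.action_of_equiv[OF F] by (intro exI conjI)
  qed
qed

end
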